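(* Let $A=(A^1,\dots,A^d)$ be a normal tensor (each $A^i$ a $D\times D$ complex matrix) with finite correlation length $\xi>0$, and for each $N$ let $$|\phi_N\rangle=\frac{1}{c_N}\sum_{i_1,\dots,i_N=1}^d \mathrm{Tr}\left(A^{i_1}\cdots A^{i_N}\right)|i_1\cdots i_N\rangle$$ be the corresponding normalized translation-invariant matrix product state on $N$ sites ($c_N>0$ a normalization constant). For each $N$ let $|\psi_N\rangle$ be a state of the same $N$ sites obtained by applying a depth-$T$ local quantum circuit to a product state, where $T=T(N)$, and let $\epsilon=\epsilon(N)=1-|\langle\phi_N|\psi_N\rangle|$. If $T=o(\log N)$, then there is some $N_0$ such that for all $N>N_0$ we have $\epsilon>1/2$.
   Context: A tensor $A$ is normal if (i) the matrices $A^1,\dots,A^d$ have no nontrivial common invariant subspace, and (ii) its transfer matrix $E_A=\sum_{i=1}^d (A^i)^*\otimes A^i$ has a unique eigenvalue of largest magnitude, normalized to $\lambda_1=1$, and no other eigenvalue of the same magnitude. The correlation length is $\xi=-1/\ln|\lambda_2|$, where $\lambda_2$ is the subleading eigenvalue (second largest in magnitude) of $E_A$. A depth-$T$ local quantum circuit on a one-dimensional chain of sites consists of $T$ layers, each layer a product of unitary gates acting on disjoint sets of neighboring sites of bounded size. *)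

theory Defs
  imports Complex_Main "Jordan_Normal_Form.Char_Poly" "HOL-Library.Landau_Symbols"
begin

definition tensor :: "nat \<Rightarrow> nat \<Rightarrow> (nat \<Rightarrow> complex mat) \<Rightarrow> bool" where
  "tensor d D A \<longleftrightarrow> (\<forall>i<d. A i \<in> carrier_mat D D)"

text \<open>Transfer matrix E_A = sum_i conj(A^i) (Kronecker) A^i, rows/columns indexed by a*D+b.\<close>
definition transfer_matrix :: "nat \<Rightarrow> nat \<Rightarrow> (nat \<Rightarrow> complex mat) \<Rightarrow> complex mat" where
  "transfer_matrix d D A = mat (D*D) (D*D)
     (\<lambda>(r,c). \<Sum>i<d. cnj (A i $$ (r div D, c div D)) * A i $$ (r mod D, c mod D))"

definition complex_subspace :: "nat \<Rightarrow> complex vec set \<Rightarrow> bool" where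
  "complex_subspace D V \<longleftrightarrow> V \<subseteq> carrier_vec D \<and> 0\<^sub>v D \<in> V \<and>
     (\<forall>u\<in>V. \<forall>w\<in>V. u + w \<in> V) \<and> (\<forall>c. \<forall>u\<in>V. c \<cdot>\<^sub>v u \<in> V)"

definition common_invariant_subspace ::
  "nat \<Rightarrow> nat \<Rightarrow> (nat \<Rightarrow> complex mat) \<Rightarrow> complex vec set \<Rightarrow> bool" where
  "common_invariant_subspace d D A V \<longleftrightarrow> complex_subspace D V \<and>
     (\<forall>i<d. \<forall>v\<in>V. A i *\<^sub>v v \<in> V)"

definition normal_tensor :: "nat \<Rightarrow> nat \<Rightarrow> (nat \<Rightarrow> complex mat) \<Rightarrow> bool" where
  "normal_tensor d D A \<longleftrightarrow> tensor d D A \<and>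
     \<not> (\<exists>V. common_invariant_subspace d D A V \<and> V \<noteq> {0\<^sub>v D} \<and> V \<noteq> carrier_vec D) \<and>
     eigenvalue (transfer_matrix d D A) 1 \<and>
     (\<forall>\<mu>. eigenvalue (transfer_matrix d D A) \<mu> \<and> \<mu> \<noteq> 1 \<longrightarrow> cmod \<mu> < 1)"

definition subleading_eigenvalues :: "nat \<Rightarrow> nat \<Rightarrow> (nat \<Rightarrow> complex mat) \<Rightarrow> complex set" where
  "subleading_eigenvalues d D A = {\<mu>. eigenvalue (transfer_matrix d D A) \<mu> \<and> \<mu> \<noteq> 1}"

definition lambda2_mod :: "nat \<Rightarrow> nat \<Rightarrow> (nat \<Rightarrow> complex mat) \<Rightarrow> real" where
  "lambda2_mod d D A = Max (cmod ` subleading_eigenvalues d D A)"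

definition corr_length :: "nat \<Rightarrow> nat \<Rightarrow> (nat \<Rightarrow> complex mat) \<Rightarrow> real" where
  "corr_length d D A = - 1 / ln (lambda2_mod d D A)"

text \<open>Configurations of N sites with local dimension d: functions x with x i < d for i < N,
  and x i = 0 for i >= N.  A state (vector) is a function from configurations to complex
  amplitudes (values outside the configuration set are irrelevant).\<close>

definition cfgs :: "nat \<Rightarrow> nat \<Rightarrow> (nat \<Rightarrow> nat) set" where
  "cfgs d N = {x. (\<forall>i<N. x i < d) \<and> (\<forall>i\<ge>N. x i = 0)}"

definition inner :: "nat \<Rightarrow> nat \<Rightarrow> ((nat \<Rightarrow> nat) \<Rightarrow> complex) \<Rightarrow> ((nat \<Rightarrow> nat) \<Rightarrow> complex) \<Rightarrow> complex" where
  "inner d N \<phi> \<psi> = (\<Sum>x\<in>cfgs d N. cnj (\<phi> x) * \<psi> x)"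

definition mat_trace :: "complex mat \<Rightarrow> complex" where
  "mat_trace M = (\<Sum>i<dim_row M. M $$ (i, i))"

definition mps_amp :: "nat \<Rightarrow> (nat \<Rightarrow> complex mat) \<Rightarrow> nat \<Rightarrow> (nat \<Rightarrow> nat) \<Rightarrow> complex" where
  "mps_amp D A N x = mat_trace (foldr (\<lambda>M P. M * P) (map (\<lambda>i. A (x i)) [0..<N]) (1\<^sub>m D))"

definition mps_norm_const :: "nat \<Rightarrow> nat \<Rightarrow> (nat \<Rightarrow> complex mat) \<Rightarrow> nat \<Rightarrow> real" where
  "mps_norm_const d D A N = sqrt (\<Sum>x\<in>cfgs d N. (cmod (mps_amp D A N x))\<^sup>2)"

definition mps_state :: "nat \<Rightarrow> nat \<Rightarrow> (nat \<Rightarrow> complex mat) \<Rightarrow> nat \<Rightarrow> (nat \<Rightarrow> nat) \<Rightarrow> complex" where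
  "mps_state d D A N x = mps_amp D A N x / complex_of_real (mps_norm_const d D A N)"

definition product_state :: "nat \<Rightarrow> nat \<Rightarrow> ((nat \<Rightarrow> nat) \<Rightarrow> complex) \<Rightarrow> bool" where
  "product_state d N \<psi> \<longleftrightarrow> (\<exists>v :: nat \<Rightarrow> nat \<Rightarrow> complex.
     (\<forall>i<N. (\<Sum>a<d. (cmod (v i a))\<^sup>2) = 1) \<and>
     (\<forall>x\<in>cfgs d N. \<psi> x = (\<Prod>i<N. v i (x i))))"

type_synonym op = "(nat \<Rightarrow> nat) \<Rightarrow> (nat \<Rightarrow> nat) \<Rightarrow> complex"

definition apply_op :: "nat \<Rightarrow> nat \<Rightarrow> op \<Rightarrow> ((nat \<Rightarrow> nat) \<Rightarrow> complex) \<Rightarrow> ((nat \<Rightarrow> nat) \<Rightarrow> complex)" where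
  "apply_op d N G \<psi> = (\<lambda>x. \<Sum>y\<in>cfgs d N. G x y * \<psi> y)"

definition unitary_op :: "nat \<Rightarrow> nat \<Rightarrow> op \<Rightarrow> bool" where
  "unitary_op d N G \<longleftrightarrow> (\<forall>x\<in>cfgs d N. \<forall>y\<in>cfgs d N.
     (\<Sum>z\<in>cfgs d N. cnj (G z x) * G z y) = (if x = y then 1 else 0))"

definition restr :: "nat set \<Rightarrow> (nat \<Rightarrow> nat) \<Rightarrow> (nat \<Rightarrow> nat)" where
  "restr S x = (\<lambda>i. if i \<in> S then x i else 0)"

text \<open>G acts only on the sites in S, i.e. G = g_S (tensor) identity elsewhere.\<close>
definition acts_on :: "nat \<Rightarrow> nat \<Rightarrow> nat set \<Rightarrow> op \<Rightarrow> bool" where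
  "acts_on d N S G \<longleftrightarrow> (\<exists>g :: (nat \<Rightarrow> nat) \<Rightarrow> (nat \<Rightarrow> nat) \<Rightarrow> complex.
     \<forall>x\<in>cfgs d N. \<forall>y\<in>cfgs d N.
       G x y = (if (\<forall>i\<in>{..<N} - S. x i = y i) then g (restr S x) (restr S y) else 0))"

text \<open>A set of neighbouring sites of size m on the chain of N sites (periodic boundary,
  sites 0..N-1; this includes all ordinary intervals of an open chain).\<close>
definition neighbour_block :: "nat \<Rightarrow> nat \<Rightarrow> nat \<Rightarrow> nat set" where
  "neighbour_block N a m = {(a + j) mod N | j. j < m}"

definition valid_layer :: "nat \<Rightarrow> nat \<Rightarrow> nat \<Rightarrow> (nat set \<times> op) list \<Rightarrow> bool" where
  "valid_layer d N k L \<longleftrightarrow>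
     (\<forall>(S, G)\<in>set L. (\<exists>a m. a < N \<and> 1 \<le> m \<and> m \<le> k \<and> S = neighbour_block N a m) \<and>
        acts_on d N S G \<and> unitary_op d N G) \<and>
     (\<forall>i<length L. \<forall>j<length L. i \<noteq> j \<longrightarrow> fst (L ! i) \<inter> fst (L ! j) = {})"

definition apply_layer :: "nat \<Rightarrow> nat \<Rightarrow> (nat set \<times> op) list \<Rightarrow> ((nat \<Rightarrow> nat) \<Rightarrow> complex) \<Rightarrow> ((nat \<Rightarrow> nat) \<Rightarrow> complex)" where
  "apply_layer d N L \<psi> = foldr (\<lambda>SG \<phi>. apply_op d N (snd SG) \<phi>) L \<psi>"

definition apply_circuit :: "nat \<Rightarrow> nat \<Rightarrow> (nat set \<times> op) list list \<Rightarrow> ((nat \<Rightarrow> nat) \<Rightarrow> complex) \<Rightarrow> ((nat \<Rightarrow> nat) \<Rightarrow> complex)" where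
  "apply_circuit d N C \<psi> = foldr (apply_layer d N) C \<psi>"

definition valid_circuit :: "nat \<Rightarrow> nat \<Rightarrow> nat \<Rightarrow> (nat set \<times> op) list list \<Rightarrow> bool" where
  "valid_circuit d N k C \<longleftrightarrow> (\<forall>L\<in>set C. valid_layer d N k L)"

end

theory Submission
  imports Defs "Jordan_Normal_Form.Spectral_Radius" "HOL-Analysis.L2_Norm" "HOL-Real_Asymp.Real_Asymp"
begin

text \<open>In a depth-\<open>T\<close> circuit state, observables supported more than \<open>2kT\<close> sites apart are exactly
  uncorrelated, whereas in the matrix product state some pair of observables on windows of constant length
  \<open>b\<close> at distance \<open>l = 2kT + 1\<close> has covariance at least \<open>const * |\<lambda>\<^sub>2|^l\<close>, which for \<open>T = o(log N)\<close>
  exceeds every fixed negative power of \<open>N\<close>.  Repeat the two windows in about \<open>sqrt N\<close> cells of width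
  \<open>M \<approx> sqrt N\<close>.  In both states the sums over all cells of the two observables and of their products have
  variance \<open>O(M)\<close>, so if the overlap were at least \<open>1/2\<close>, the expectation values of the two states would
  differ by \<open>O(sqrt M)\<close> in total over the cells, even with absolute values inside the sum.  Hence the
  covariance would be \<open>O(1 / sqrt M) = O(N^(-1/4))\<close>, a contradiction.

  The lower bound on the covariance uses that the powers of the transfer matrix converge exponentially to a
  projection \<open>R \<otimes> L\<close> with \<open>R\<close>, \<open>L\<close> positive definite (Perron--Frobenius), so that the words of length \<open>b\<close>
  in the matrices \<open>A\<^sup>i\<close> span all matrices and every entry of \<open>E\<^sup>l - R \<otimes> L\<close> is a combination of covariances.\<close>

section \<open>Configurations and the inner product\<close>

text \<open>Overlap 1/2 says nothing about one local expectation value: two states with that overlap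
  can differ there by a constant. It only forbids that sums of many weakly correlated observables
  have means much further apart than their fluctuations, hence the repetition of the windows.
  Factorisation is not linear in the state, so the two windows and their joint observable form three
  families, each compared on its own before the product rule of the circuit state can be carried
  over. Cells must be much wider than log N, so that the decay \<open>q ^ g0\<close> beats their
  number, and that number must be a power of N. With \<open>h = k * T N\<close> and \<open>w\<close>
  the logarithm of 1/|\<lambda>2|, the choice of \<delta> gives 2 h w \<le> (ln N) / 8: the
  covariance is at least of order N^(-1/8), against an upper bound of order N^(-1/4). The
  observables are matrix units: contractions that factor over sites, so that transfer matrices
  evaluate them. They are not hermitian, hence the adjoint families and the phases. Normality speaks
  of eigenvalues only, so a Jordan block of the transfer matrix at 1 has to be excluded; positivity
  of the left and right fixed points does this.\<close>

lemma cfgs_0: "cfgs d 0 = {\<lambda>_. 0}"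
  by (auto simp: cfgs_def)

lemma sum_cfgs_Suc:
  "(\<Sum>x\<in>cfgs d (Suc N). f x) = (\<Sum>x\<in>cfgs d N. \<Sum>a<d. f (x(N := a)))"
proof -
  have "(\<Sum>x\<in>cfgs d N. \<Sum>a<d. f (x(N := a))) = (\<Sum>(x,a)\<in>cfgs d N \<times> {..<d}. f (x(N := a)))"
    by (simp add: sum.cartesian_product)
  also have "\<dots> = (\<Sum>x\<in>cfgs d (Suc N). f x)"
    by (rule sum.reindex_bij_witness[where i = "\<lambda>x. (x(N := 0), x N)" and j = "\<lambda>(x, a). x(N := a)"])
      (auto simp: cfgs_def fun_eq_iff less_Suc_eq)
  finally show ?thesis by simp
qed

lemma finite_cfgs [simp]: "finite (cfgs d N)"
proof (induction N)
  case (Suc N)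
  have "cfgs d (Suc N) \<subseteq> (\<lambda>(x, a). x(N := a)) ` (cfgs d N \<times> {..<d})"
  proof
    fix x assume "x \<in> cfgs d (Suc N)"
    then have "x = (\<lambda>(x, a). x(N := a)) (x(N := 0), x N)" "(x(N := 0), x N) \<in> cfgs d N \<times> {..<d}"
      by (auto simp: cfgs_def)
    then show "x \<in> (\<lambda>(x, a). x(N := a)) ` (cfgs d N \<times> {..<d})"
      by (rule image_eqI)
  qed
  then show ?case
    using Suc finite_subset by fastforce
qed (simp add: cfgs_0)

lemma sum_cfgs_prod:
  fixes f :: "nat \<Rightarrow> nat \<Rightarrow> 'a::comm_semiring_1"
  shows "(\<Sum>x\<in>cfgs d N. \<Prod>i<N. f i (x i)) = (\<Prod>i<N. \<Sum>a<d. f i a)"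
proof (induction N)
  case (Suc N)
  have "(\<Prod>i<N. f i (if i = N then a else x i)) = (\<Prod>i<N. f i (x i))" for a and x :: "nat \<Rightarrow> nat"
    by (rule prod.cong) auto
  then show ?case
    by (simp add: sum_cfgs_Suc Suc[symmetric] sum_product fun_upd_def)
qed (simp add: cfgs_0)

definition sqn :: "nat \<Rightarrow> nat \<Rightarrow> ((nat \<Rightarrow> nat) \<Rightarrow> complex) \<Rightarrow> real" where
  "sqn d N u = (\<Sum>x\<in>cfgs d N. (cmod (u x))\<^sup>2)"

lemma sqn_nonneg: "0 \<le> sqn d N u"
  by (simp add: sqn_def sum_nonneg)

lemma inner_self: "inner d N u u = of_real (sqn d N u)"
  unfolding inner_def sqn_def of_real_sum
  by (rule sum.cong) (simp_all only: complex_norm_square mult.commute)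

lemma inner_cnj: "cnj (inner d N u v) = inner d N v u"
  by (simp add: inner_def mult.commute)

lemma inner_cong:
  assumes "\<And>x. x \<in> cfgs d N \<Longrightarrow> u x = u' x" "\<And>x. x \<in> cfgs d N \<Longrightarrow> v x = v' x"
  shows "inner d N u v = inner d N u' v'"
  unfolding inner_def by (rule sum.cong) (simp_all add: assms)

lemma cauchy_schwarz_inner: "cmod (inner d N u v) \<le> sqrt (sqn d N u) * sqrt (sqn d N v)"
proof -
  have "cmod (inner d N u v) \<le> (\<Sum>x\<in>cfgs d N. cmod (u x) * cmod (v x))"
    unfolding inner_def by (rule order_trans[OF norm_sum]) (simp add: norm_mult)
  also have "\<dots> \<le> L2_set (\<lambda>x. cmod (u x)) (cfgs d N) * L2_set (\<lambda>x. cmod (v x)) (cfgs d N)"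
    using L2_set_mult_ineq[of "\<lambda>x. cmod (u x)" "\<lambda>x. cmod (v x)" "cfgs d N"] by simp
  finally show ?thesis
    by (simp add: L2_set_def sqn_def)
qed

lemma inner_sum_left: "inner d N (\<lambda>x. \<Sum>j\<in>J. c j * u j x) v = (\<Sum>j\<in>J. cnj (c j) * inner d N (u j) v)"
  by (simp add: inner_def sum_distrib_left sum_distrib_right mult.assoc) (rule sum.swap)

lemma inner_sum_right: "inner d N v (\<lambda>x. \<Sum>j\<in>J. c j * u j x) = (\<Sum>j\<in>J. c j * inner d N v (u j))"
  by (simp add: inner_def sum_distrib_left sum_distrib_right mult_ac) (rule sum.swap)

lemma inner_diff_right: "inner d N v (\<lambda>x. u x - c * w x) = inner d N v u - c * inner d N v w"
  by (simp add: inner_def sum_distrib_left sum_subtractf algebra_simps)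

lemma inner_diff_left: "inner d N (\<lambda>x. u x - c * w x) v = inner d N u v - cnj c * inner d N w v"
  by (simp add: inner_def sum_distrib_left sum_subtractf algebra_simps)

section \<open>Overlap of states that differ on many weakly correlated observables\<close>

text \<open>Variance of a sum: \<open>w j\<close> is the part of \<open>u j\<close> orthogonal to
  \<psi>, and the inner products of the \<open>w j\<close> form the covariance matrix
  \<open>K\<close>. Its M diagonal entries are at most 1 in modulus, the others at most
  \<open>e\<close>, and the unimodular \<open>s j\<close> do not affect these absolute
  values.\<close>

lemma sum_fluctuation_bound:
  assumes unit: "inner d N \<psi> \<psi> = 1"
    and s: "\<And>j. j < M \<Longrightarrow> cmod (s j) = 1"
    and le1: "\<And>j. j < M \<Longrightarrow> sqn d N (u j) \<le> 1"
    and cov: "\<And>i j. i < M \<Longrightarrow> j < M \<Longrightarrow> i \<noteq> j \<Longrightarrow>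
      cmod (inner d N (u i) (u j) - inner d N (u i) \<psi> * inner d N \<psi> (u j)) \<le> e"
    and e: "0 \<le> e"
  shows "sqn d N (\<lambda>x. \<Sum>j<M. s j * (u j x - inner d N \<psi> (u j) * \<psi> x)) \<le> real M + (real M)\<^sup>2 * e"
proof -
  define w where "w j x = u j x - inner d N \<psi> (u j) * \<psi> x" for j x
  define K where "K i j = inner d N (u i) (u j) - inner d N (u i) \<psi> * inner d N \<psi> (u j)" for i j
  have ww: "inner d N (w i) (w j) = K i j" for i j
    unfolding w_def K_def inner_diff_left inner_diff_right inner_cnj unit by simp
  \<comment> \<open>\<open>K i i\<close> is real, a squared norm minus the squared component along
    \<psi>. Cauchy-Schwarz keeps it nonnegative, so the bound on \<open>sqn\<close> bounds its
    modulus.\<close>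
  have diag: "cmod (K i i) \<le> 1" if "i < M" for i
  proof -
    have "K i i = of_real (sqn d N (u i) - (cmod (inner d N \<psi> (u i)))\<^sup>2)"
      unfolding K_def inner_cnj[of d N \<psi> "u i", symmetric]
      by (simp add: inner_self mult.commute complex_norm_square[symmetric] del: of_real_power)
    moreover have "(cmod (inner d N \<psi> (u i)))\<^sup>2 \<le> sqn d N (u i)"
    proof -
      have "sqn d N \<psi> = 1"
        using unit by (simp add: inner_self)
      then have "cmod (inner d N \<psi> (u i)) \<le> sqrt (sqn d N (u i))"
        using cauchy_schwarz_inner[of d N \<psi> "u i"] by simp
      then show ?thesis
        using power_mono[of "cmod (inner d N \<psi> (u i))" "sqrt (sqn d N (u i))" 2]
        by (simp add: sqn_nonneg)
    qed
    moreover have "0 \<le> (cmod (inner d N \<psi> (u i)))\<^sup>2"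
      by simp
    ultimately show ?thesis
      using le1[OF that] by (simp only: norm_of_real)
  qed
  have "complex_of_real (sqn d N (\<lambda>x. \<Sum>j<M. s j * w j x)) = (\<Sum>i<M. \<Sum>j<M. cnj (s i) * (s j * K i j))"
    unfolding inner_self[symmetric] inner_sum_left inner_sum_right ww
    by (simp add: sum_distrib_left)
  then have "sqn d N (\<lambda>x. \<Sum>j<M. s j * w j x) = cmod (\<Sum>i<M. \<Sum>j<M. cnj (s i) * (s j * K i j))"
    using norm_of_real[of "sqn d N (\<lambda>x. \<Sum>j<M. s j * w j x)", where ?'a = complex]
    by (simp only: abs_of_nonneg[OF sqn_nonneg])
  also have "\<dots> \<le> (\<Sum>i<M. \<Sum>j<M. cmod (cnj (s i) * (s j * K i j)))"
    by (intro order_trans[OF norm_sum] sum_mono norm_sum)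
  \<comment> \<open>The error \<open>e\<close> is charged to the diagonal as well, which makes the
    double sum exactly the stated bound.\<close>
  also have "\<dots> \<le> (\<Sum>i<M. \<Sum>j<M. (if i = j then 1 else 0) + e)"
  proof (intro sum_mono)
    fix i j assume "i \<in> {..<M}" "j \<in> {..<M}"
    then show "cmod (cnj (s i) * (s j * K i j)) \<le> (if i = j then 1 else 0) + e"
      using diag[of i] cov[of i j] e s[of i] s[of j] by (auto simp: norm_mult K_def)
  qed
  also have "\<dots> = real M + (real M)\<^sup>2 * e"
    by (simp add: sum.distrib power2_eq_square distrib_left mult.assoc)
  finally show ?thesis
    by (simp add: w_def)
qed

text \<open>Here \<open>u j\<close> and \<open>u' j\<close> play the roles of \<open>O\<^sub>j \<psi>\<close> and \<open>O\<^sub>j\<^sup>* \<phi>\<close>.  The difference of the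
  expectation values of \<open>\<Sum> s\<^sub>j O\<^sub>j\<close>, multiplied by the overlap, is controlled by its fluctuations in
  the two states; the phases \<open>s\<^sub>j\<close> are chosen so that all differences add up.\<close>

lemma overlap_bound:
  assumes unit: "inner d N \<phi> \<phi> = 1" "inner d N \<psi> \<psi> = 1"
    and dual: "\<And>j. j < M \<Longrightarrow> inner d N (u' j) \<psi> = inner d N \<phi> (u j)"
    and le1: "\<And>j. j < M \<Longrightarrow> sqn d N (u j) \<le> 1"
    and le1': "\<And>j. j < M \<Longrightarrow> sqn d N (u' j) \<le> 1"
    and cov: "\<And>i j. i < M \<Longrightarrow> j < M \<Longrightarrow> i \<noteq> j \<Longrightarrow>
      cmod (inner d N (u i) (u j) - inner d N (u i) \<psi> * inner d N \<psi> (u j)) \<le> e"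
    and cov': "\<And>i j. i < M \<Longrightarrow> j < M \<Longrightarrow> i \<noteq> j \<Longrightarrow>
      cmod (inner d N (u' i) (u' j) - inner d N (u' i) \<phi> * inner d N \<phi> (u' j)) \<le> e"
    and e: "0 \<le> e"
  shows "(\<Sum>j<M. cmod (inner d N \<psi> (u j) - inner d N (u' j) \<phi>)) * cmod (inner d N \<phi> \<psi>)
    \<le> 2 * sqrt (real M + (real M)\<^sup>2 * e)"
proof -
  define z where "z j = inner d N \<psi> (u j) - inner d N (u' j) \<phi>" for j
  define s where "s j = (if z j = 0 then 1 else cnj (z j) / cmod (z j))" for j
  have s1: "cmod (s j) = 1" for j
    by (simp add: s_def norm_divide)
  have sz: "s j * z j = cmod (z j)" for j
    by (simp add: s_def field_simps complex_norm_square[symmetric] power2_eq_square)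
  define W where "W x = (\<Sum>j<M. s j * (u j x - inner d N \<psi> (u j) * \<psi> x))" for x
  define W' where "W' x = (\<Sum>j<M. cnj (s j) * (u' j x - inner d N \<phi> (u' j) * \<phi> x))" for x
  have W: "sqn d N W \<le> real M + (real M)\<^sup>2 * e"
    unfolding W_def[abs_def] by (rule sum_fluctuation_bound) (use unit s1 le1 cov e in auto)
  have W': "sqn d N W' \<le> real M + (real M)\<^sup>2 * e"
    unfolding W'_def[abs_def] by (rule sum_fluctuation_bound) (use unit s1 le1' cov' e in auto)
  have sq: "sqn d N \<phi> = 1" "sqn d N \<psi> = 1"
    using unit by (simp_all add: inner_self)
  have "(\<Sum>j<M. complex_of_real (cmod (z j))) * inner d N \<phi> \<psi>
      = (\<Sum>j<M. s j * z j * inner d N \<phi> \<psi>)"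
    by (simp only: sz sum_distrib_right)
  \<comment> \<open>The terms <\<phi>, O_j \<psi>> occur in both inner products and cancel by
    \<open>dual\<close>; what is left is the difference of the expectation values times the
    overlap.\<close>
  also have "\<dots> = inner d N W' \<psi> - inner d N \<phi> W"
    unfolding W_def W'_def inner_sum_left inner_sum_right inner_diff_left inner_diff_right
    by (simp add: inner_cnj dual z_def sum_subtractf[symmetric] right_diff_distrib left_diff_distrib mult.assoc)
  finally have eq: "complex_of_real (\<Sum>j<M. cmod (z j)) * inner d N \<phi> \<psi> = inner d N W' \<psi> - inner d N \<phi> W"
    by simp
  have "cmod (complex_of_real (\<Sum>j<M. cmod (z j)) * inner d N \<phi> \<psi>) = (\<Sum>j<M. cmod (z j)) * cmod (inner d N \<phi> \<psi>)"
    unfolding norm_mult norm_of_real by (simp add: sum_nonneg)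
  then have "(\<Sum>j<M. cmod (z j)) * cmod (inner d N \<phi> \<psi>) = cmod (inner d N W' \<psi> - inner d N \<phi> W)"
    unfolding eq by simp
  also have "\<dots> \<le> cmod (inner d N W' \<psi>) + cmod (inner d N \<phi> W)"
    by (rule norm_triangle_ineq4)
  also have "\<dots> \<le> sqrt (sqn d N W') + sqrt (sqn d N W)"
    using cauchy_schwarz_inner[of d N W' \<psi>] cauchy_schwarz_inner[of d N \<phi> W] sq by simp
  also have "\<dots> \<le> 2 * sqrt (real M + (real M)\<^sup>2 * e)"
    using real_sqrt_le_mono[OF W] real_sqrt_le_mono[OF W'] by linarith
  finally show ?thesis
    by (simp add: z_def)
qed

section \<open>Local operators and light cones\<close>

definition op_comp :: "nat \<Rightarrow> nat \<Rightarrow> op \<Rightarrow> op \<Rightarrow> op" where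
  "op_comp d N F G = (\<lambda>x z. \<Sum>y\<in>cfgs d N. F x y * G y z)"

definition op_adj :: "op \<Rightarrow> op" where
  "op_adj G = (\<lambda>x y. cnj (G y x))"

lemma apply_op_cong:
  assumes "\<And>x. x \<in> cfgs d N \<Longrightarrow> u x = v x"
  shows "apply_op d N G u x = apply_op d N G v x"
  unfolding apply_op_def by (rule sum.cong) (simp_all add: assms)

lemma apply_op_comp: "apply_op d N (op_comp d N F G) u x = apply_op d N F (apply_op d N G u) x"
  unfolding apply_op_def op_comp_def sum_distrib_left sum_distrib_right
  by (subst sum.swap) (simp add: mult.assoc)

lemma inner_apply_left: "inner d N (apply_op d N G u) v = inner d N u (apply_op d N (op_adj G) v)"
  unfolding inner_def apply_op_def op_adj_def cnj_sum sum_distrib_left sum_distrib_right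
  by (subst sum.swap) (simp add: mult_ac)

lemma unitary_adj_apply:
  assumes "unitary_op d N G" "x \<in> cfgs d N"
  shows "apply_op d N (op_adj G) (apply_op d N G u) x = u x"
proof -
  have "apply_op d N (op_adj G) (apply_op d N G u) x = (\<Sum>y\<in>cfgs d N. (\<Sum>z\<in>cfgs d N. cnj (G z x) * G z y) * u y)"
    unfolding apply_op_comp[symmetric] by (simp add: apply_op_def op_comp_def op_adj_def)
  also have "\<dots> = (\<Sum>y\<in>cfgs d N. (if x = y then 1 else 0) * u y)"
    using assms by (intro sum.cong) (simp_all add: unitary_op_def)
  also have "\<dots> = (\<Sum>y\<in>cfgs d N. if x = y then u y else 0)"
    by (rule sum.cong) auto
  also have "\<dots> = u x"
    using assms by simp
  finally show ?thesis .
qed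

lemma inner_unitary:
  assumes "unitary_op d N G"
  shows "inner d N (apply_op d N G u) (apply_op d N G v) = inner d N u v"
  unfolding inner_apply_left by (rule inner_cong) (simp_all add: unitary_adj_apply[OF assms])

section \<open>Supports of operators\<close>

lemma restr_cfgs: "x \<in> cfgs d N \<Longrightarrow> restr S x \<in> cfgs d N"
  by (force simp: cfgs_def restr_def)

lemma restr_restr: "restr S (restr S' x) = restr (S \<inter> S') x"
  by (auto simp: restr_def fun_eq_iff)

text \<open>The local part \<open>g\<close> can be taken to be \<open>G\<close> itself, because
  restricted configurations agree outside \<open>S\<close> automatically. This removes the
  existential quantifier from all later arguments about supports.\<close>

lemma acts_on_iff:
  "acts_on d N S G \<longleftrightarrow> (\<forall>x\<in>cfgs d N. \<forall>y\<in>cfgs d N.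
     G x y = (if \<forall>i\<in>{..<N} - S. x i = y i then G (restr S x) (restr S y) else 0))"
  (is "_ \<longleftrightarrow> ?R")
proof
  assume "acts_on d N S G"
  then obtain g where g: "\<And>x y. x \<in> cfgs d N \<Longrightarrow> y \<in> cfgs d N \<Longrightarrow>
       G x y = (if (\<forall>i\<in>{..<N} - S. x i = y i) then g (restr S x) (restr S y) else 0)"
    unfolding acts_on_def by blast
  have "G (restr S x) (restr S y) = g (restr S x) (restr S y)" if "x \<in> cfgs d N" "y \<in> cfgs d N" for x y
    using g[OF restr_cfgs[OF that(1), of S] restr_cfgs[OF that(2), of S]] unfolding restr_restr
    by (auto simp: restr_def split: if_splits)
  then show ?R
    using g by simp
next
  assume ?R
  then show "acts_on d N S G"
    unfolding acts_on_def by (intro exI[of _ G]) simp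
qed

lemma acts_on_eq:
  assumes "acts_on d N S G" "x \<in> cfgs d N" "y \<in> cfgs d N" "\<forall>i\<in>{..<N} - S. x i = y i"
  shows "G x y = G (restr S x) (restr S y)"
  using assms unfolding acts_on_iff by simp

lemma acts_on_eq_0:
  assumes "acts_on d N S G" "x \<in> cfgs d N" "y \<in> cfgs d N" "\<not> (\<forall>i\<in>{..<N} - S. x i = y i)"
  shows "G x y = 0"
  using assms unfolding acts_on_iff by auto

lemma acts_on_mono:
  assumes "acts_on d N S G" "S \<subseteq> S'"
  shows "acts_on d N S' G"
  unfolding acts_on_iff
proof (intro ballI)
  fix x y assume xy: "x \<in> cfgs d N" "y \<in> cfgs d N"
  have SS: "S \<inter> S' = S"
    using assms(2) by blast
  have 1: "G x y = (if \<forall>i\<in>{..<N} - S. x i = y i then G (restr S x) (restr S y) else 0)"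
    using assms(1) xy unfolding acts_on_iff by blast
  have 2: "G (restr S' x) (restr S' y) = (if \<forall>i\<in>{..<N} - S. restr S' x i = restr S' y i
      then G (restr S x) (restr S y) else 0)"
    using assms(1)[unfolded acts_on_iff, rule_format, OF restr_cfgs[OF xy(1), of S'] restr_cfgs[OF xy(2), of S']]
    by (simp add: restr_restr SS)
  \<comment> \<open>Agreement outside \<open>S\<close> is agreement on \<open>S' - S\<close>, which
    the restrictions to \<open>S'\<close> still see, together with agreement outside
    \<open>S'\<close>.\<close>
  have 3: "(\<forall>i\<in>{..<N} - S. x i = y i) \<longleftrightarrow>
     (\<forall>i\<in>{..<N} - S. restr S' x i = restr S' y i) \<and> (\<forall>i\<in>{..<N} - S'. x i = y i)"
    using assms(2) by (auto simp: restr_def)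
  show "G x y = (if \<forall>i\<in>{..<N} - S'. x i = y i then G (restr S' x) (restr S' y) else 0)"
    unfolding 1 2 using 3 by simp
qed

lemma acts_on_adj:
  assumes "acts_on d N S G"
  shows "acts_on d N S (op_adj G)"
  unfolding acts_on_iff
proof (intro ballI)
  fix x y assume xy: "x \<in> cfgs d N" "y \<in> cfgs d N"
  have "(\<forall>i\<in>{..<N} - S. x i = y i) \<longleftrightarrow> (\<forall>i\<in>{..<N} - S. y i = x i)"
    by metis
  then show "op_adj G x y = (if \<forall>i\<in>{..<N} - S. x i = y i then op_adj G (restr S x) (restr S y) else 0)"
    using acts_on_eq[OF assms xy(2,1)] acts_on_eq_0[OF assms xy(2,1)] by (simp add: op_adj_def)
qed

text \<open>Only intermediate configurations that agree with the outer one off \<open>S\<close>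
  contribute. Restriction to \<open>S\<close> maps them bijectively to those for the restricted
  arguments; the inverse fills in the outer values again.\<close>

lemma acts_on_comp:
  assumes F: "acts_on d N S F" and G: "acts_on d N S G"
  shows "acts_on d N S (op_comp d N F G)"
  unfolding acts_on_iff
proof (intro ballI)
  fix x z assume xz: "x \<in> cfgs d N" "z \<in> cfgs d N"
  define Y where "Y v = {y \<in> cfgs d N. \<forall>i\<in>{..<N} - S. v i = y i}" for v :: "nat \<Rightarrow> nat"
  have comp_Y: "op_comp d N F G v w = (\<Sum>y\<in>Y v. F v y * G y w)" if "v \<in> cfgs d N" for v w
  proof -
    have "F v y = 0" if "y \<in> cfgs d N - Y v" for y
      by (rule acts_on_eq_0[OF F]) (use that \<open>v \<in> cfgs d N\<close> in \<open>auto simp: Y_def\<close>)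
    then show ?thesis
      unfolding op_comp_def by (intro sum.mono_neutral_right) (auto simp: Y_def)
  qed
  show "op_comp d N F G x z = (if \<forall>i\<in>{..<N} - S. x i = z i
      then op_comp d N F G (restr S x) (restr S z) else 0)"
  proof (cases "\<forall>i\<in>{..<N} - S. x i = z i")
    case False
    have "F x y * G y z = 0" if "y \<in> Y x" for y
    proof -
      have "y \<in> cfgs d N" "\<not> (\<forall>i\<in>{..<N} - S. y i = z i)"
        using that False by (auto simp: Y_def)
      then have "G y z = 0"
        using acts_on_eq_0[OF G _ xz(2)] by blast
      then show ?thesis by simp
    qed
    then have "op_comp d N F G x z = 0"
      unfolding comp_Y[OF xz(1)] by (intro sum.neutral) blast
    then show ?thesis
      unfolding if_not_P[OF False] .
  next
    case True
    have "(\<Sum>y\<in>Y x. F x y * G y z) = (\<Sum>y\<in>Y (restr S x). F (restr S x) y * G y (restr S z))"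
    proof (rule sum.reindex_bij_witness[where i = "\<lambda>y i. if i \<in> S then y i else x i" and j = "restr S"])
      fix y assume y: "y \<in> Y x"
      show "(\<lambda>i. if i \<in> S then restr S y i else x i) = y"
      proof
        fix i show "(if i \<in> S then restr S y i else x i) = y i"
          using y xz(1) by (cases "i < N") (auto simp: Y_def restr_def cfgs_def)
      qed
      show "restr S y \<in> Y (restr S x)"
        using y restr_cfgs[of y d N S] by (auto simp: Y_def restr_def)
      have yc: "y \<in> cfgs d N" and yx: "\<forall>i\<in>{..<N} - S. x i = y i"
        using y by (auto simp: Y_def)
      have yz: "\<forall>i\<in>{..<N} - S. y i = z i"
        using yx True by simp
      have "F x y = F (restr S x) (restr S y)" "G y z = G (restr S y) (restr S z)"
        using acts_on_eq[OF F xz(1) yc yx] acts_on_eq[OF G yc xz(2) yz] by simp_all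
      then show "F (restr S x) (restr S y) * G (restr S y) (restr S z) = F x y * G y z"
        by simp
    next
      fix y assume y: "y \<in> Y (restr S x)"
      show "restr S (\<lambda>i. if i \<in> S then y i else x i) = y"
      proof
        fix i show "restr S (\<lambda>i. if i \<in> S then y i else x i) i = y i"
          using y by (cases "i < N") (auto simp: Y_def restr_def cfgs_def)
      qed
      show "(\<lambda>i. if i \<in> S then y i else x i) \<in> Y x"
        using y xz by (auto simp: Y_def cfgs_def)
    qed
    then show ?thesis
      unfolding if_P[OF True] comp_Y[OF xz(1)] comp_Y[OF restr_cfgs[OF xz(1)]] .
  qed
qed

text \<open>With disjoint supports a single intermediate configuration can contribute, and both
  orders of composition give the same formula, symmetric in the two operators.\<close>

lemma apply_op_commute:
  assumes F: "acts_on d N S F" and G: "acts_on d N B G" and disj: "B \<inter> S = {}"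
    and x: "x \<in> cfgs d N"
  shows "apply_op d N F (apply_op d N G u) x = apply_op d N G (apply_op d N F u) x"
proof -
  have "op_comp d N F G x z = op_comp d N G F x z" if z: "z \<in> cfgs d N" for z
  proof -
    \<comment> \<open>Stated for arbitrary operators and supports, because it is applied a second
      time with the two roles exchanged.\<close>
    have key: "op_comp d N F G x z = (if \<forall>i\<in>{..<N} - (S \<union> B). x i = z i
        then F (restr S x) (restr S z) * G (restr B x) (restr B z) else 0)"
      if F: "acts_on d N S F" and G: "acts_on d N B G" and disj: "B \<inter> S = {}" for S B F G
    proof -
      \<comment> \<open>\<open>F\<close> leaves the sites off \<open>S\<close> as in
        \<open>x\<close>, and \<open>G\<close> does not touch those in \<open>S\<close>, which must
        therefore already agree with \<open>z\<close>.\<close>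
      define y0 where "y0 = (\<lambda>i. if i \<in> S then z i else x i)"
      have y0: "y0 \<in> cfgs d N"
        using x z by (auto simp: y0_def cfgs_def)
      have "F x y * G y z = 0" if "y \<in> cfgs d N" "y \<noteq> y0" for y
      proof (rule ccontr)
        assume "F x y * G y z \<noteq> 0"
        then have "F x y \<noteq> 0" "G y z \<noteq> 0"
          by simp_all
        then have "\<forall>i\<in>{..<N} - S. x i = y i" "\<forall>i\<in>{..<N} - B. y i = z i"
          using acts_on_eq_0[OF F x that(1)] acts_on_eq_0[OF G that(1) z] by blast+
        then have "y i = y0 i" if "i < N" for i
          using disj that by (auto simp: y0_def)
        moreover have "y i = y0 i" if "\<not> i < N" for i
          using that \<open>y \<in> cfgs d N\<close> y0 by (auto simp: cfgs_def)
        ultimately show False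
          using \<open>y \<noteq> y0\<close> by blast
      qed
      then have "op_comp d N F G x z = (\<Sum>y\<in>{y0}. F x y * G y z)"
        unfolding op_comp_def using y0 by (intro sum.mono_neutral_right) auto
      moreover have "F x y0 = F (restr S x) (restr S z)"
      proof -
        have "F x y0 = F (restr S x) (restr S y0)"
          by (rule acts_on_eq[OF F x y0]) (simp add: y0_def)
        moreover have "restr S y0 = restr S z"
          by (auto simp: restr_def y0_def)
        ultimately show ?thesis by simp
      qed
      moreover have "G y0 z = (if \<forall>i\<in>{..<N} - (S \<union> B). x i = z i then G (restr B x) (restr B z) else 0)"
      proof -
        have "G y0 z = (if \<forall>i\<in>{..<N} - B. y0 i = z i then G (restr B y0) (restr B z) else 0)"
          using G z y0 unfolding acts_on_iff by blast
        moreover have "restr B y0 = restr B x"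
          using disj by (auto simp: restr_def y0_def fun_eq_iff)
        moreover have "(\<forall>i\<in>{..<N} - B. y0 i = z i) \<longleftrightarrow> (\<forall>i\<in>{..<N} - (S \<union> B). x i = z i)"
          by (auto simp: y0_def)
        ultimately show ?thesis by simp
      qed
      ultimately show ?thesis by simp
    qed
    show ?thesis
      using key[OF F G disj] key[OF G F] disj by (simp add: Int_commute Un_commute mult.commute)
  qed
  then show ?thesis
    unfolding apply_op_comp[symmetric] by (simp add: apply_op_def)
qed

section \<open>Exact factorisation of expectation values under circuits\<close>

definition uncorrelated :: "nat \<Rightarrow> nat \<Rightarrow> ((nat \<Rightarrow> nat) \<Rightarrow> complex) \<Rightarrow> nat set \<Rightarrow> nat set \<Rightarrow> bool" where
  "uncorrelated d N \<psi> S1 S2 \<longleftrightarrow> (\<forall>F1 F2. acts_on d N S1 F1 \<longrightarrow> acts_on d N S2 F2 \<longrightarrow>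
     inner d N (apply_op d N F1 \<psi>) (apply_op d N F2 \<psi>)
       = inner d N (apply_op d N F1 \<psi>) \<psi> * inner d N \<psi> (apply_op d N F2 \<psi>))"

lemma uncorrelated_commute:
  assumes "uncorrelated d N \<psi> S1 S2"
  shows "uncorrelated d N \<psi> S2 S1"
  unfolding uncorrelated_def
proof (intro allI impI)
  fix F1 F2 assume "acts_on d N S2 F1" "acts_on d N S1 F2"
  then have "cnj (inner d N (apply_op d N F2 \<psi>) (apply_op d N F1 \<psi>))
      = cnj (inner d N (apply_op d N F2 \<psi>) \<psi> * inner d N \<psi> (apply_op d N F1 \<psi>))"
    using assms unfolding uncorrelated_def by simp
  then show "inner d N (apply_op d N F1 \<psi>) (apply_op d N F2 \<psi>)
      = inner d N (apply_op d N F1 \<psi>) \<psi> * inner d N \<psi> (apply_op d N F2 \<psi>)"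
    by (simp add: inner_cnj mult.commute)
qed

text \<open>Heisenberg picture: conjugation by the gate fixes an operator whose support misses
  \<open>B\<close> and otherwise enlarges the support by \<open>B\<close>. Since
  \<open>uncorrelated\<close> quantifies over all operators on its two supports, it is stable under
  this. The gate may meet only one of the supports; the operator on the other one commutes with
  it.\<close>

lemma uncorrelated_apply_gate:
  assumes G: "acts_on d N B G" "unitary_op d N G"
    and unc: "uncorrelated d N \<psi> (if B \<inter> S1 = {} then S1 else S1 \<union> B) (if B \<inter> S2 = {} then S2 else S2 \<union> B)"
    and one: "B \<inter> S1 = {} \<or> B \<inter> S2 = {}"
  shows "uncorrelated d N (apply_op d N G \<psi>) S1 S2"
proof -
  have heis: "\<exists>F'. acts_on d N (if B \<inter> S = {} then S else S \<union> B) F' \<and> (\<forall>x\<in>cfgs d N.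
      apply_op d N (op_adj G) (apply_op d N F (apply_op d N G \<psi>)) x = apply_op d N F' \<psi> x)"
    if F: "acts_on d N S F" for S F
  proof (cases "B \<inter> S = {}")
    case True
    have "apply_op d N (op_adj G) (apply_op d N F (apply_op d N G \<psi>)) x
        = apply_op d N (op_adj G) (apply_op d N G (apply_op d N F \<psi>)) x" for x
      by (rule apply_op_cong) (rule apply_op_commute[OF F G(1) True])
    then show ?thesis
      using True F by (auto simp: unitary_adj_apply[OF G(2)])
  next
    case False
    have "acts_on d N (S \<union> B) (op_comp d N (op_adj G) (op_comp d N F G))"
      by (intro acts_on_comp acts_on_mono[OF acts_on_adj[OF G(1)]] acts_on_mono[OF F] acts_on_mono[OF G(1)]) auto
    moreover have "apply_op d N (op_adj G) (apply_op d N F (apply_op d N G \<psi>)) x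
        = apply_op d N (op_comp d N (op_adj G) (op_comp d N F G)) \<psi> x" for x
      unfolding apply_op_comp by (rule apply_op_cong) (simp add: apply_op_comp)
    ultimately show ?thesis
      using False by auto
  qed
  have main: "uncorrelated d N (apply_op d N G \<psi>) S1 S2"
    if unc: "uncorrelated d N \<psi> S1 (if B \<inter> S2 = {} then S2 else S2 \<union> B)" and B1: "B \<inter> S1 = {}" for S1 S2
    unfolding uncorrelated_def
  proof (intro allI impI)
    fix F1 F2 assume F1: "acts_on d N S1 F1" and F2: "acts_on d N S2 F2"
    obtain F2' where F2': "acts_on d N (if B \<inter> S2 = {} then S2 else S2 \<union> B) F2'"
      and F2'_eq: "\<And>x. x \<in> cfgs d N \<Longrightarrow>
        apply_op d N (op_adj G) (apply_op d N F2 (apply_op d N G \<psi>)) x = apply_op d N F2' \<psi> x"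
      using heis[OF F2] by blast
    have 0: "inner d N (apply_op d N G u) (apply_op d N F2 (apply_op d N G \<psi>)) = inner d N u (apply_op d N F2' \<psi>)" for u
      unfolding inner_apply_left by (rule inner_cong) (simp_all add: F2'_eq)
    \<comment> \<open>Once \<open>F1\<close> has been moved through the gate, the gate stands on
      both sides of every inner product, where it cancels by unitarity or turns \<open>F2\<close>
      into \<open>F2'\<close>.\<close>
    have 1: "inner d N (apply_op d N F1 (apply_op d N G \<psi>)) v = inner d N (apply_op d N G (apply_op d N F1 \<psi>)) v" for v
      by (rule inner_cong) (simp_all add: apply_op_commute[OF F1 G(1) B1])
    show "inner d N (apply_op d N F1 (apply_op d N G \<psi>)) (apply_op d N F2 (apply_op d N G \<psi>)) =
        inner d N (apply_op d N F1 (apply_op d N G \<psi>)) (apply_op d N G \<psi>) *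
        inner d N (apply_op d N G \<psi>) (apply_op d N F2 (apply_op d N G \<psi>))"
      unfolding 1 0 inner_unitary[OF G(2)] using unc F1 F2' unfolding uncorrelated_def by blast
  qed
  show ?thesis
  proof (cases "B \<inter> S1 = {}")
    case True
    then show ?thesis using main unc by simp
  next
    case False
    then have "B \<inter> S2 = {}" using one by blast
    then show ?thesis
      using main[of S2 S1] unc by (auto intro: uncorrelated_commute)
  qed
qed

text \<open>The backward light cone of \<open>S\<close> through one layer. A single round of
  absorption is enough because the blocks of a layer are disjoint.\<close>

definition enlarge :: "(nat set \<times> op) list \<Rightarrow> nat set \<Rightarrow> nat set" where
  "enlarge L S = S \<union> \<Union>{B \<in> fst ` set L. B \<inter> S \<noteq> {}}"

text \<open>The head of the list acts last, so it is the first gate to be absorbed into the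
  supports. By disjointness of the blocks, absorbing it brings no further block into contact with a
  support (\<open>ext\<close>), and disjointness of the enlarged supports ensures that no gate meets
  both.\<close>

lemma uncorrelated_apply_layer:
  assumes "\<forall>(B, G)\<in>set L. acts_on d N B G \<and> unitary_op d N G"
    and "\<forall>i<length L. \<forall>j<length L. i \<noteq> j \<longrightarrow> fst (L ! i) \<inter> fst (L ! j) = {}"
    and "uncorrelated d N \<psi> (enlarge L S1) (enlarge L S2)"
    and "enlarge L S1 \<inter> enlarge L S2 = {}"
  shows "uncorrelated d N (apply_layer d N L \<psi>) S1 S2"
  using assms
proof (induction L arbitrary: S1 S2)
  case Nil
  then show ?case by (simp add: apply_layer_def enlarge_def)
next
  case (Cons BG L)
  obtain B G where BG: "BG = (B, G)" by fastforce
  define ex where "ex S = (if B \<inter> S = {} then S else S \<union> B)" for S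
  have disj: "B \<inter> B' = {}" if B': "B' \<in> fst ` set L" for B'
  proof -
    obtain p where p: "p \<in> set L" "B' = fst p"
      using B' by auto
    obtain j where "j < length L" "L ! j = p"
      using p(1) by (auto simp: in_set_conv_nth)
    then show ?thesis
      using Cons.prems(2)[rule_format, of 0 "Suc j"] p(2) by (simp add: BG)
  qed
  have ext: "enlarge L (ex S) = enlarge (BG # L) S" for S
  proof -
    have "B' \<inter> ex S = {} \<longleftrightarrow> B' \<inter> S = {}" if "B' \<in> fst ` set L" for B'
      using disj[OF that] by (auto simp: ex_def)
    then have *: "{B' \<in> fst ` set L. B' \<inter> ex S \<noteq> {}} = {B' \<in> fst ` set L. B' \<inter> S \<noteq> {}}"
      by blast
    show ?thesis
    proof (cases "B \<inter> S = {}")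
      case True
      then have "{B' \<in> fst ` set (BG # L). B' \<inter> S \<noteq> {}} = {B' \<in> fst ` set L. B' \<inter> S \<noteq> {}}"
        by (auto simp: BG)
      then show ?thesis
        using True unfolding enlarge_def * by (simp add: ex_def)
    next
      case False
      then have "{B' \<in> fst ` set (BG # L). B' \<inter> S \<noteq> {}} = insert B {B' \<in> fst ` set L. B' \<inter> S \<noteq> {}}"
        by (auto simp: BG)
      then show ?thesis
        using False unfolding enlarge_def * by (simp add: ex_def Un_assoc)
    qed
  qed
  have h1: "\<forall>(B, G)\<in>set L. acts_on d N B G \<and> unitary_op d N G"
    using Cons.prems(1) by simp
  have h2: "\<forall>i<length L. \<forall>j<length L. i \<noteq> j \<longrightarrow> fst (L ! i) \<inter> fst (L ! j) = {}"
  proof (intro allI impI)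
    fix i j assume "i < length L" "j < length L" "i \<noteq> j"
    then show "fst (L ! i) \<inter> fst (L ! j) = {}"
      using Cons.prems(2)[rule_format, of "Suc i" "Suc j"] by simp
  qed
  have "uncorrelated d N (apply_layer d N L \<psi>) (ex S1) (ex S2)"
    by (rule Cons.IH[OF h1 h2]) (use Cons.prems(3,4) in \<open>simp_all only: ext\<close>)
  moreover have "B \<inter> S1 = {} \<or> B \<inter> S2 = {}"
    using Cons.prems(4) unfolding enlarge_def BG by fastforce
  ultimately have "uncorrelated d N (apply_op d N G (apply_layer d N L \<psi>)) S1 S2"
    using Cons.prems(1) unfolding ex_def BG
    by (intro uncorrelated_apply_gate) auto
  then show ?case
    by (simp add: apply_layer_def BG)
qed

text \<open>Blocks may wrap around the ring. A site at distance at least \<open>k\<close> from both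
  ends of the chain keeps the reduction modulo \<open>N\<close> harmless: all members of its block
  are then reached by plain addition and subtraction.\<close>

lemma neighbour_block_window:
  assumes B: "i \<in> neighbour_block N p m" "i' \<in> neighbour_block N p m" and m: "m \<le> k"
    and i: "k \<le> i" "i + k \<le> N"
  shows "i - k \<le> i' \<and> i' < i + k"
proof -
  obtain j j' where j: "i = (p + j) mod N" "j < m" and j': "i' = (p + j') mod N" "j' < m"
    using B unfolding neighbour_block_def by blast
  define t where "t = (p + j) div N"
  have ij: "p + j = t * N + i"
    unfolding j(1) t_def by simp
  have le: "j \<le> i + j'" and lt: "i + j' - j < N"
    using i j(2) j'(2) m by linarith+
  have "p + j' = i + j' - j + t * N"
    using ij le by linarith
  then have "i' = (i + j' - j) mod N"
    unfolding j'(1) by simp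
  then have "i' = i + j' - j"
    using lt by simp
  then show ?thesis
    using j(2) j'(2) m by linarith
qed

lemma enlarge_window:
  assumes L: "valid_layer d N k L" and S: "S \<subseteq> {a..<b}" and a: "k \<le> a" and b: "b + k \<le> N"
  shows "enlarge L S \<subseteq> {a - k..<b + k}"
proof
  fix i' assume "i' \<in> enlarge L S"
  then consider "i' \<in> S" | B i where "B \<in> fst ` set L" "i \<in> B" "i \<in> S" "i' \<in> B"
    unfolding enlarge_def by blast
  then show "i' \<in> {a - k..<b + k}"
  proof cases
    case 1
    then have "a \<le> i'" "i' < b"
      using S by auto
    then show ?thesis by simp
  next
    case 2
    then obtain G where "(B, G) \<in> set L"
      by auto
    then have "\<exists>p m. p < N \<and> 1 \<le> m \<and> m \<le> k \<and> B = neighbour_block N p m"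
      using L unfolding valid_layer_def by (auto dest: bspec)
    then obtain p m where m: "m \<le> k" and B: "B = neighbour_block N p m"
      by blast
    have "a \<le> i" "i < b"
      using S 2(3) by auto
    have "k \<le> i" "i + k \<le> N"
      using \<open>a \<le> i\<close> \<open>i < b\<close> a b by linarith+
    then have "i - k \<le> i'" "i' < i + k"
      using neighbour_block_window[of i N p m i' k] 2(2,4) m unfolding B by blast+
    then show ?thesis
      using \<open>a \<le> i\<close> \<open>i < b\<close> by simp
  qed
qed

text \<open>The head of \<open>C\<close> is the last layer in time, so the induction runs backwards,
  and each layer widens both windows by \<open>k\<close> on either side. The gap shrinks from two
  sides, hence the factor 2; the margins at the ends of the chain keep the light cones away from the
  seam of the ring.\<close>

lemma uncorrelated_apply_circuit:
  assumes C: "valid_circuit d N k C"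
    and prod: "\<And>S1 S2. S1 \<inter> S2 = {} \<Longrightarrow> uncorrelated d N \<chi> S1 S2"
    and "S1 \<subseteq> {a1..<b1}" "S2 \<subseteq> {a2..<b2}" "a1 < b1" "a2 < b2"
    and "k * length C \<le> a1" "b1 + 2 * (k * length C) \<le> a2" "b2 + k * length C \<le> N"
  shows "uncorrelated d N (apply_circuit d N C \<chi>) S1 S2"
  using assms(1,3-)
proof (induction C arbitrary: S1 S2 a1 b1 a2 b2)
  case Nil
  then have "S1 \<inter> S2 = {}" by force
  then show ?case by (simp add: apply_circuit_def prod)
next
  case (Cons L C)
  have L: "valid_layer d N k L" and C: "valid_circuit d N k C"
    using Cons.prems(1) by (simp_all add: valid_circuit_def)
  have len: "k * length (L # C) = k * length C + k"
    by simp
  define m where "m = k * length C"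
  note ineqs = Cons.prems(4-)[unfolded len, folded m_def]
  have e1: "enlarge L S1 \<subseteq> {a1 - k..<b1 + k}"
    by (rule enlarge_window[OF L Cons.prems(2)]) (use ineqs in linarith)+
  have e2: "enlarge L S2 \<subseteq> {a2 - k..<b2 + k}"
    by (rule enlarge_window[OF L Cons.prems(3)]) (use ineqs in linarith)+
  have i: "a1 - k < b1 + k" "a2 - k < b2 + k" "m \<le> a1 - k" "b1 + k + 2 * m \<le> a2 - k" "b2 + k + m \<le> N"
    using ineqs by simp_all
  have "uncorrelated d N (apply_circuit d N C \<chi>) (enlarge L S1) (enlarge L S2)"
    by (rule Cons.IH[OF C e1 e2 i[unfolded m_def]])
  moreover have "b1 + k \<le> a2 - k"
    using ineqs by simp
  then have "enlarge L S1 \<inter> enlarge L S2 = {}"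
    using e1 e2 by fastforce
  ultimately have "uncorrelated d N (apply_layer d N L (apply_circuit d N C \<chi>)) S1 S2"
    using L unfolding valid_layer_def by (intro uncorrelated_apply_layer) auto
  then show ?case
    by (simp add: apply_circuit_def)
qed


section \<open>Product states\<close>

text \<open>The tensor product decomposition along a cut: a configuration is an independent choice
  of its restrictions to \<open>S\<close> and to the complement.\<close>

lemma sum_cfgs_cut:
  "(\<Sum>x\<in>cfgs d N. h (restr S x) (restr (- S) x)) =
    (\<Sum>p\<in>restr S ` cfgs d N. \<Sum>q\<in>restr (- S) ` cfgs d N. h p q)"
proof -
  have "(\<Sum>(p, q)\<in>restr S ` cfgs d N \<times> restr (- S) ` cfgs d N. h p q)
      = (\<Sum>x\<in>cfgs d N. h (restr S x) (restr (- S) x))"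
  proof (rule sum.reindex_bij_witness[where i = "\<lambda>x. (restr S x, restr (- S) x)"
        and j = "\<lambda>(p, q) i. if i \<in> S then p i else q i"])
    fix pq assume "pq \<in> restr S ` cfgs d N \<times> restr (- S) ` cfgs d N"
    then obtain x y where xy: "x \<in> cfgs d N" "y \<in> cfgs d N" and pq: "pq = (restr S x, restr (- S) y)"
      by auto
    have m: "(\<lambda>(p, q) i. if i \<in> S then p i else q i) pq = (\<lambda>i. if i \<in> S then x i else y i)"
      by (auto simp: pq restr_def fun_eq_iff)
    show "(\<lambda>(p, q) i. if i \<in> S then p i else q i) pq \<in> cfgs d N"
      unfolding m using xy by (auto simp: cfgs_def)
    show inv: "(restr S ((\<lambda>(p, q) i. if i \<in> S then p i else q i) pq),
        restr (- S) ((\<lambda>(p, q) i. if i \<in> S then p i else q i) pq)) = pq"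
      unfolding m by (auto simp: pq restr_def fun_eq_iff)
    show "h (restr S ((\<lambda>(p, q) i. if i \<in> S then p i else q i) pq))
          (restr (- S) ((\<lambda>(p, q) i. if i \<in> S then p i else q i) pq)) = (case pq of (p, q) \<Rightarrow> h p q)"
      using inv by (cases pq) simp
  qed (auto simp: restr_def fun_eq_iff)
  then show ?thesis
    by (simp add: sum.cartesian_product)
qed

text \<open>An operator on one side of the cut leaves the factor on the other side untouched: the
  same \<open>b\<close> occurs before and after. Only the terms whose configuration off
  \<open>S\<close> is that of \<open>x\<close> survive.\<close>

lemma apply_op_cut:
  assumes F: "acts_on d N S F"
    and u: "\<And>x. x \<in> cfgs d N \<Longrightarrow> u x = a (restr S x) * b (restr (- S) x)"
  shows "\<exists>a'. \<forall>x\<in>cfgs d N. apply_op d N F u x = a' (restr S x) * b (restr (- S) x)"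
proof (intro exI ballI)
  fix x assume x: "x \<in> cfgs d N"
  have "apply_op d N F u x = (\<Sum>y\<in>cfgs d N. F (restr S x) (restr S y) * a (restr S y) *
      (if restr (- S) y = restr (- S) x then b (restr (- S) y) else 0))"
    unfolding apply_op_def
  proof (rule sum.cong)
    fix y assume y: "y \<in> cfgs d N"
    have eq: "(\<forall>i\<in>{..<N} - S. x i = y i) \<longleftrightarrow> restr (- S) y = restr (- S) x" (is "?A \<longleftrightarrow> ?B")
    proof
      assume ?A
      show ?B
      proof
        fix i show "restr (- S) y i = restr (- S) x i"
          using \<open>?A\<close> x y by (cases "i < N") (auto simp: restr_def cfgs_def)
      qed
    qed (auto simp: restr_def fun_eq_iff split: if_splits)
    show "F x y * u y = F (restr S x) (restr S y) * a (restr S y) *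
        (if restr (- S) y = restr (- S) x then b (restr (- S) y) else 0)"
    proof (cases ?A)
      case True
      then show ?thesis
        using acts_on_eq[OF F x y True] eq u[OF y] by (simp add: mult.assoc)
    next
      case False
      then show ?thesis
        using acts_on_eq_0[OF F x y False] eq by simp
    qed
  qed simp
  also have "\<dots> = (\<Sum>p\<in>restr S ` cfgs d N. \<Sum>q\<in>restr (- S) ` cfgs d N.
      F (restr S x) p * a p * (if q = restr (- S) x then b q else 0))"
    by (rule sum_cfgs_cut)
  also have "\<dots> = (\<Sum>p\<in>restr S ` cfgs d N. F (restr S x) p * a p) * b (restr (- S) x)"
    unfolding sum_distrib_right using x by (intro sum.cong) (simp_all add: sum_distrib_left[symmetric] sum.delta)
  finally show "apply_op d N F u x
      = (\<lambda>t. \<Sum>p\<in>restr S ` cfgs d N. F t p * a p) (restr S x) * b (restr (- S) x)" .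
qed

lemma inner_cut:
  assumes "\<And>x. x \<in> cfgs d N \<Longrightarrow> u x = a (restr S x) * b (restr (- S) x)"
    and "\<And>x. x \<in> cfgs d N \<Longrightarrow> v x = a' (restr S x) * b' (restr (- S) x)"
  shows "inner d N u v = (\<Sum>p\<in>restr S ` cfgs d N. cnj (a p) * a' p) *
    (\<Sum>q\<in>restr (- S) ` cfgs d N. cnj (b q) * b' q)"
proof -
  have "inner d N u v = (\<Sum>x\<in>cfgs d N. (cnj (a (restr S x)) * a' (restr S x)) *
      (cnj (b (restr (- S) x)) * b' (restr (- S) x)))"
    unfolding inner_def by (rule sum.cong) (simp_all add: assms)
  then show ?thesis
    unfolding sum_cfgs_cut[where h = "\<lambda>p q. (cnj (a p) * a' p) * (cnj (b q) * b' q)"] sum_product .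
qed

lemma product_state_inner:
  assumes "product_state d N \<chi>"
  shows "inner d N \<chi> \<chi> = 1"
proof -
  obtain v where v: "\<And>i. i < N \<Longrightarrow> (\<Sum>a<d. (cmod (v i a))\<^sup>2) = 1"
    and \<chi>: "\<And>x. x \<in> cfgs d N \<Longrightarrow> \<chi> x = (\<Prod>i<N. v i (x i))"
    using assms unfolding product_state_def by blast
  have "sqn d N \<chi> = (\<Sum>x\<in>cfgs d N. \<Prod>i<N. (cmod (v i (x i)))\<^sup>2)"
    unfolding sqn_def by (rule sum.cong) (simp_all add: \<chi> prod_norm[symmetric] prod_power_distrib)
  also have "\<dots> = 1"
    unfolding sum_cfgs_prod[where f = "\<lambda>i a. (cmod (v i a))\<^sup>2"] by (simp add: v)
  finally show ?thesis
    by (simp add: inner_self)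
qed

text \<open>Cut along \<open>S1\<close>: one operator changes only the first factor, the other only
  the second. All four inner products then split, and the normalisation
  \<open>I a a * J b b = 1\<close> supplies the two missing factors.\<close>

lemma product_state_uncorrelated:
  assumes prod: "product_state d N \<chi>" and disj: "S1 \<inter> S2 = {}"
  shows "uncorrelated d N \<chi> S1 S2"
  unfolding uncorrelated_def
proof (intro allI impI)
  fix F1 F2 assume F1: "acts_on d N S1 F1" and F2: "acts_on d N S2 F2"
  obtain v where v: "\<And>x. x \<in> cfgs d N \<Longrightarrow> \<chi> x = (\<Prod>i<N. v i (x i))"
    using prod unfolding product_state_def by blast
  define a where "a p = (\<Prod>i\<in>{..<N} \<inter> S1. v i (p i))" for p :: "nat \<Rightarrow> nat"
  define b where "b q = (\<Prod>i\<in>{..<N} - S1. v i (q i))" for q :: "nat \<Rightarrow> nat"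
  have \<chi>: "\<chi> x = a (restr S1 x) * b (restr (- S1) x)" if "x \<in> cfgs d N" for x
    unfolding v[OF that] a_def b_def by (subst prod.Int_Diff[where B = S1]) (simp_all add: restr_def)
  then have \<chi>': "\<chi> x = b (restr (- S1) x) * a (restr (- (- S1)) x)" if "x \<in> cfgs d N" for x
    using that by simp
  obtain a' where a': "\<And>x. x \<in> cfgs d N \<Longrightarrow> apply_op d N F1 \<chi> x = a' (restr S1 x) * b (restr (- S1) x)"
    using apply_op_cut[where a = a and b = b, OF F1 \<chi>] by blast
  \<comment> \<open>\<open>F2\<close> is regarded as an operator on the whole complement of
    \<open>S1\<close>, so that one cut serves both operators.\<close>
  have "acts_on d N (- S1) F2"
    by (rule acts_on_mono[OF F2]) (use disj in blast)
  from apply_op_cut[where a = b and b = a, OF this \<chi>'] obtain b' where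
    b': "\<And>x. x \<in> cfgs d N \<Longrightarrow> apply_op d N F2 \<chi> x = a (restr S1 x) * b' (restr (- S1) x)"
    by (auto simp: mult.commute)
  define I where "I u v = (\<Sum>p\<in>restr S1 ` cfgs d N. cnj (u p) * v p)" for u v
  define J where "J u v = (\<Sum>q\<in>restr (- S1) ` cfgs d N. cnj (u q) * v q)" for u v
  have 1: "inner d N \<chi> \<chi> = I a a * J b b"
    unfolding I_def J_def by (rule inner_cut) (fact \<chi>)+
  have 2: "inner d N (apply_op d N F1 \<chi>) \<chi> = I a' a * J b b"
    unfolding I_def J_def by (rule inner_cut) (fact a' \<chi>)+
  have 3: "inner d N \<chi> (apply_op d N F2 \<chi>) = I a a * J b b'"
    unfolding I_def J_def by (rule inner_cut) (fact b' \<chi>)+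
  have 4: "inner d N (apply_op d N F1 \<chi>) (apply_op d N F2 \<chi>) = I a' a * J b b'"
    unfolding I_def J_def by (rule inner_cut) (fact a' b')+
  have "I a a * J b b = 1"
    using 1 product_state_inner[OF prod] by simp
  then have "I a' a * J b b' = I a' a * J b b' * (I a a * J b b)"
    by simp
  then show "inner d N (apply_op d N F1 \<chi>) (apply_op d N F2 \<chi>)
      = inner d N (apply_op d N F1 \<chi>) \<chi> * inner d N \<chi> (apply_op d N F2 \<chi>)"
    unfolding 2 3 4 by (simp only: mult_ac)
qed

lemma inner_apply_circuit:
  assumes "valid_circuit d N k C"
  shows "inner d N (apply_circuit d N C u) (apply_circuit d N C u) = inner d N u u"
proof -
  have layer: "inner d N (apply_layer d N L u) (apply_layer d N L u) = inner d N u u"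
    if "\<forall>(B, G)\<in>set L. unitary_op d N G" for L u
    using that by (induction L) (auto simp: apply_layer_def inner_unitary)
  show ?thesis
    using assms
    by (induction C) (auto simp: apply_circuit_def valid_circuit_def valid_layer_def layer case_prod_beta)
qed

section \<open>Matrix units on a set of sites\<close>

definition repl :: "nat set \<Rightarrow> (nat \<Rightarrow> nat) \<Rightarrow> (nat \<Rightarrow> nat) \<Rightarrow> (nat \<Rightarrow> nat)" where
  "repl W j x = (\<lambda>s. if s \<in> W then j s else x s)"

definition unit_op :: "nat set \<Rightarrow> (nat \<Rightarrow> nat) \<Rightarrow> (nat \<Rightarrow> nat) \<Rightarrow> op" where
  "unit_op W i j = (\<lambda>x y. if (\<forall>s\<in>W. x s = i s \<and> y s = j s) \<and> (\<forall>s. s \<notin> W \<longrightarrow> x s = y s) then 1 else 0)"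

lemma unit_op_adj: "op_adj (unit_op W i j) = unit_op W j i"
  by (auto simp: op_adj_def unit_op_def fun_eq_iff)

lemma acts_on_unit_op: "acts_on d N W (unit_op W i j)"
  unfolding acts_on_def
proof (intro exI ballI)
  fix x y assume xy: "x \<in> cfgs d N" "y \<in> cfgs d N"
  have "x s = y s" if "\<forall>i\<in>{..<N} - W. x i = y i" "s \<notin> W" for s
    using that xy by (cases "s < N") (auto simp: cfgs_def)
  then show "unit_op W i j x y = (if \<forall>i\<in>{..<N} - W. x i = y i
      then (\<lambda>p q. if \<forall>s\<in>W. p s = i s \<and> q s = j s then 1 else 0) (restr W x) (restr W y) else 0)"
    by (auto simp: unit_op_def restr_def)
qed

lemma repl_cfgs:
  assumes "x \<in> cfgs d N" "W \<subseteq> {..<N}" "\<And>s. s \<in> W \<Longrightarrow> j s < d"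
  shows "repl W j x \<in> cfgs d N"
  using assms by (auto simp: cfgs_def repl_def)

lemma apply_unit_op:
  assumes x: "x \<in> cfgs d N" and W: "W \<subseteq> {..<N}" "\<And>s. s \<in> W \<Longrightarrow> j s < d"
  shows "apply_op d N (unit_op W i j) u x = (if \<forall>s\<in>W. x s = i s then u (repl W j x) else 0)"
proof -
  have "unit_op W i j x y = (if y = repl W j x then (if \<forall>s\<in>W. x s = i s then 1 else 0) else 0)" for y
    by (auto simp: unit_op_def repl_def fun_eq_iff)
  then have "apply_op d N (unit_op W i j) u x =
      (\<Sum>y\<in>cfgs d N. if y = repl W j x then (if \<forall>s\<in>W. x s = i s then u y else 0) else 0)"
    unfolding apply_op_def by (intro sum.cong) auto
  then show ?thesis
    by (simp add: repl_cfgs[OF x W])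
qed

text \<open>Replacing the values on \<open>W\<close> by \<open>j\<close> is injective on
  configurations that equal \<open>i\<close> there, so the squared amplitudes of the image are a
  partial sum of those of \<open>u\<close>.\<close>

lemma sqn_unit_op_le:
  assumes W: "W \<subseteq> {..<N}" "\<And>s. s \<in> W \<Longrightarrow> j s < d"
  shows "sqn d N (apply_op d N (unit_op W i j) u) \<le> sqn d N u"
proof -
  define X where "X = {x \<in> cfgs d N. \<forall>s\<in>W. x s = i s}"
  have "sqn d N (apply_op d N (unit_op W i j) u) = (\<Sum>x\<in>X. (cmod (u (repl W j x)))\<^sup>2)"
    unfolding sqn_def X_def sum.inter_filter[OF finite_cfgs]
    by (intro sum.cong) (simp_all add: apply_unit_op W)
  also have "\<dots> = (\<Sum>y\<in>repl W j ` X. (cmod (u y))\<^sup>2)"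
  proof (rule sum.reindex[symmetric, unfolded o_def])
    show "inj_on (repl W j) X"
      by (auto simp: inj_on_def X_def repl_def fun_eq_iff) metis
  qed
  also have "\<dots> \<le> sqn d N u"
    unfolding sqn_def by (rule sum_mono2) (auto simp: X_def intro: repl_cfgs[OF _ W])
  finally show ?thesis .
qed

text \<open>Makes two windows one observable. Both factors share the words \<open>i\<close> and
  \<open>j\<close>; words that are given separately are first merged with
  \<open>unit_op_cong\<close>.\<close>

lemma apply_unit_op_disjoint:
  assumes W: "W \<subseteq> {..<N}" "W' \<subseteq> {..<N}" "W \<inter> W' = {}"
    and j: "\<And>s. s \<in> W \<union> W' \<Longrightarrow> j s < d" and x: "x \<in> cfgs d N"
  shows "apply_op d N (unit_op W i j) (apply_op d N (unit_op W' i j) u) x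
    = apply_op d N (unit_op (W \<union> W') i j) u x"
proof -
  have "repl W' j (repl W j x) = repl (W \<union> W') j x"
    by (auto simp: repl_def fun_eq_iff)
  moreover have "repl W j x s = x s" if "s \<in> W'" for s
    using W(3) that by (auto simp: repl_def)
  moreover have "repl W j x \<in> cfgs d N"
    using W j x by (intro repl_cfgs) auto
  moreover have "apply_op d N (unit_op W i j) v x = (if \<forall>s\<in>W. x s = i s then v (repl W j x) else 0)" for v
    using W j x by (intro apply_unit_op) auto
  moreover have "apply_op d N (unit_op W' i j) u (repl W j x)
      = (if \<forall>s\<in>W'. repl W j x s = i s then u (repl W' j (repl W j x)) else 0)"
    if "repl W j x \<in> cfgs d N"
    using W j that by (intro apply_unit_op) auto
  moreover have "apply_op d N (unit_op (W \<union> W') i j) u x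
      = (if \<forall>s\<in>W \<union> W'. x s = i s then u (repl (W \<union> W') j x) else 0)"
    using W j x by (intro apply_unit_op) auto
  ultimately show ?thesis
    by (auto simp: ball_Un)
qed

lemma unit_op_cong:
  assumes "\<And>s. s \<in> W \<Longrightarrow> i s = i' s \<and> j s = j' s"
  shows "unit_op W i j = unit_op W i' j'"
  using assms by (auto simp: unit_op_def fun_eq_iff)

section \<open>Sesquilinear forms\<close>

text \<open>Bolzano-Weierstrass in finitely many coordinates: each new coordinate is made monotone
  along a further subsequence, and the old limits persist.\<close>

lemma bounded_family_convergent_subseq_real:
  fixes f :: "nat \<Rightarrow> 'i \<Rightarrow> real"
  assumes "finite I" "\<And>n i. i \<in> I \<Longrightarrow> \<bar>f n i\<bar> \<le> K"
  shows "\<exists>r l. strict_mono (r :: nat \<Rightarrow> nat) \<and> (\<forall>i\<in>I. (\<lambda>n. f (r n) i) \<longlonglongrightarrow> l i)"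
  using assms
proof (induction I)
  case empty
  then show ?case by (intro exI[of _ id]) (simp add: strict_mono_def)
next
  case (insert i I)
  have "\<exists>r l. strict_mono (r :: nat \<Rightarrow> nat) \<and> (\<forall>i\<in>I. (\<lambda>n. f (r n) i) \<longlonglongrightarrow> l i)"
    by (rule insert.IH) (simp add: insert.prems)
  then obtain r l where r: "strict_mono r" and l: "\<And>i. i \<in> I \<Longrightarrow> (\<lambda>n. f (r n) i) \<longlonglongrightarrow> l i"
    by blast
  obtain g :: "nat \<Rightarrow> nat" where g: "strict_mono g" "monoseq (\<lambda>n. f (r (g n)) i)"
    using seq_monosub[of "\<lambda>n. f (r n) i"] by blast
  have "Bseq (\<lambda>n. f (r (g n)) i)"
    by (rule BseqI'[of _ K]) (simp add: insert.prems)
  then have "convergent (\<lambda>n. f (r (g n)) i)"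
    using g(2) by (rule Bseq_monoseq_convergent)
  then obtain m where m: "(\<lambda>n. f (r (g n)) i) \<longlonglongrightarrow> m"
    by (auto simp: convergent_def)
  have "(\<lambda>n. f ((r \<circ> g) n) j) \<longlonglongrightarrow> (l(i := m)) j" if "j \<in> insert i I" for j
  proof (cases "j = i")
    case False
    then show ?thesis
      using LIMSEQ_subseq_LIMSEQ[OF l g(1), of j] that by (simp add: o_def)
  qed (simp add: m)
  then show ?case
    using strict_mono_o[OF r g(1)] by blast
qed

lemma bounded_family_convergent_subseq:
  fixes f :: "nat \<Rightarrow> 'i \<Rightarrow> complex"
  assumes "finite I" "\<And>n i. i \<in> I \<Longrightarrow> cmod (f n i) \<le> K"
  shows "\<exists>r l. strict_mono (r :: nat \<Rightarrow> nat) \<and> (\<forall>i\<in>I. (\<lambda>n. f (r n) i) \<longlonglongrightarrow> l i)"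
proof -
  define g where "g n p = (if snd p then Re (f n (fst p)) else Im (f n (fst p)))" for n and p :: "'i \<times> bool"
  have "\<exists>r l. strict_mono (r :: nat \<Rightarrow> nat) \<and> (\<forall>p\<in>I \<times> UNIV. (\<lambda>n. g (r n) p) \<longlonglongrightarrow> l p)"
  proof (rule bounded_family_convergent_subseq_real)
    show "\<bar>g n p\<bar> \<le> K" if "p \<in> I \<times> UNIV" for n p
      using assms(2)[of "fst p" n] abs_Re_le_cmod[of "f n (fst p)"] abs_Im_le_cmod[of "f n (fst p)"] that
      by (auto simp: g_def)
  qed (simp add: assms(1))
  then obtain r l where r: "strict_mono r"
    and l: "\<And>p. p \<in> I \<times> UNIV \<Longrightarrow> (\<lambda>n. g (r n) p) \<longlonglongrightarrow> l p"
    by blast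
  have "(\<lambda>n. f (r n) i) \<longlonglongrightarrow> Complex (l (i, True)) (l (i, False))" if "i \<in> I" for i
    using tendsto_Complex[OF l[of "(i, True)"] l[of "(i, False)"]] that by (simp add: g_def)
  then show ?thesis
    using r by (intro exI[of _ r] exI[of _ "\<lambda>i. Complex (l (i, True)) (l (i, False))"]) simp
qed

text \<open>Operators on the bond space are functions \<open>nat \<Rightarrow> nat \<Rightarrow> complex\<close> of which only the entries with
  both indices below \<open>D\<close> matter.\<close>

definition sform :: "nat \<Rightarrow> (nat \<Rightarrow> nat \<Rightarrow> complex) \<Rightarrow> (nat \<Rightarrow> complex) \<Rightarrow> (nat \<Rightarrow> complex) \<Rightarrow> complex" where
  "sform D X v w = (\<Sum>c<D. \<Sum>e<D. v c * cnj (w e) * X c e)"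

definition nsq :: "nat \<Rightarrow> (nat \<Rightarrow> complex) \<Rightarrow> real" where
  "nsq D v = (\<Sum>a<D. (cmod (v a))\<^sup>2)"

definition hermitian :: "nat \<Rightarrow> (nat \<Rightarrow> nat \<Rightarrow> complex) \<Rightarrow> bool" where
  "hermitian D X \<longleftrightarrow> (\<forall>c<D. \<forall>e<D. cnj (X c e) = X e c)"

definition psd :: "nat \<Rightarrow> (nat \<Rightarrow> nat \<Rightarrow> complex) \<Rightarrow> bool" where
  "psd D X \<longleftrightarrow> hermitian D X \<and> (\<forall>v. 0 \<le> Re (sform D X v v))"

definition mapply :: "nat \<Rightarrow> (nat \<Rightarrow> nat \<Rightarrow> complex) \<Rightarrow> (nat \<Rightarrow> complex) \<Rightarrow> nat \<Rightarrow> complex" where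
  "mapply D X v e = (\<Sum>c<D. X c e * v c)"

lemma nsq_nonneg: "0 \<le> nsq D v"
  by (simp add: nsq_def sum_nonneg)

lemma nsq_eq_0_iff: "nsq D v = 0 \<longleftrightarrow> (\<forall>a<D. v a = 0)"
  by (auto simp: nsq_def sum_nonneg_eq_0_iff)

lemma nsq_scale: "nsq D (\<lambda>a. z * v a) = (cmod z)\<^sup>2 * nsq D v"
  by (simp add: nsq_def norm_mult power_mult_distrib sum_distrib_left)

lemma sform_scale: "sform D X (\<lambda>a. z * v a) (\<lambda>a. z * v a) = of_real ((cmod z)\<^sup>2) * sform D X v v"
  unfolding sform_def complex_norm_square by (simp add: sum_distrib_left mult_ac)

lemma sform_mapply: "sform D X v w = (\<Sum>e<D. cnj (w e) * mapply D X v e)"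
  unfolding sform_def mapply_def sum_distrib_left by (subst sum.swap) (simp add: mult_ac)

lemma sform_commute:
  assumes "hermitian D X"
  shows "sform D X w v = cnj (sform D X v w)"
proof -
  have "cnj (sform D X v w) = (\<Sum>c<D. \<Sum>e<D. w e * cnj (v c) * X e c)"
    unfolding sform_def cnj_sum
    by (intro sum.cong refl) (use assms in \<open>simp add: hermitian_def mult_ac\<close>)
  also have "\<dots> = sform D X w v"
    unfolding sform_def by (rule sum.swap)
  finally show ?thesis by simp
qed

lemma sform_diff:
  "sform D X (\<lambda>a. v a - z * u a) (\<lambda>a. v a - z * u a)
    = sform D X v v - cnj z * sform D X v u - z * sform D X u v + z * cnj z * sform D X u u"
  unfolding sform_def
  by (simp add: algebra_simps sum_subtractf sum.distrib sum_distrib_left)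

lemma sform_sub_op:
  "sform D (\<lambda>c e. X c e - z * Y c e) v w = sform D X v w - z * sform D Y v w"
  unfolding sform_def by (simp add: algebra_simps sum_subtractf sum_distrib_left)

lemma Re_sform_le: "\<bar>Re (sform D X v v)\<bar> \<le> (\<Sum>c<D. \<Sum>e<D. cmod (X c e)) * nsq D v"
proof -
  have ent: "cmod (v a) \<le> sqrt (nsq D v)" if "a < D" for a
  proof (rule real_le_rsqrt)
    show "(cmod (v a))\<^sup>2 \<le> nsq D v"
      unfolding nsq_def by (rule member_le_sum) (use that in auto)
  qed
  have "\<bar>Re (sform D X v v)\<bar> \<le> cmod (sform D X v v)"
    by (rule abs_Re_le_cmod)
  also have "\<dots> \<le> (\<Sum>c<D. \<Sum>e<D. cmod (v c * cnj (v e) * X c e))"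
    unfolding sform_def by (intro order_trans[OF norm_sum] sum_mono norm_sum)
  also have "\<dots> \<le> (\<Sum>c<D. \<Sum>e<D. cmod (X c e) * nsq D v)"
  proof (intro sum_mono)
    fix c e assume "c \<in> {..<D}" "e \<in> {..<D}"
    then have "cmod (v c) * cmod (v e) \<le> sqrt (nsq D v) * sqrt (nsq D v)"
      by (intro mult_mono ent) (auto simp: nsq_nonneg)
    then have "cmod (v c) * cmod (v e) \<le> nsq D v"
      by (simp add: nsq_nonneg)
    then have "cmod (X c e) * (cmod (v c) * cmod (v e)) \<le> cmod (X c e) * nsq D v"
      by (rule mult_left_mono) simp
    then show "cmod (v c * cnj (v e) * X c e) \<le> cmod (X c e) * nsq D v"
      by (simp add: norm_mult mult_ac)
  qed
  also have "\<dots> = (\<Sum>c<D. \<Sum>e<D. cmod (X c e)) * nsq D v"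
    by (simp add: sum_distrib_right)
  finally show ?thesis .
qed

text \<open>The form stays nonnegative along \<open>v - t u\<close> with \<open>u = X v\<close>. As
  \<open>v\<close> is null, the expansion starts with the linear term \<open>- 2 t nsq D u\<close>,
  which dominates for small \<open>t\<close> unless \<open>u\<close> vanishes.\<close>

lemma psd_null_vector:
  assumes X: "psd D X" and v: "Re (sform D X v v) = 0" and e: "e < D"
  shows "mapply D X v e = 0"
proof -
  define u where "u = mapply D X v"
  have vu: "sform D X v u = of_real (nsq D u)"
    unfolding sform_mapply u_def[symmetric] nsq_def of_real_sum
    by (rule sum.cong) (simp_all only: complex_norm_square mult.commute)
  have uv: "sform D X u v = of_real (nsq D u)"
    using sform_commute[of D X u v] X vu unfolding psd_def by simp
  define q where "q = Re (sform D X u u)"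
  have key: "2 * nsq D u \<le> t * q" if "0 < t" for t
  proof -
    have "0 \<le> Re (sform D X (\<lambda>a. v a - of_real t * u a) (\<lambda>a. v a - of_real t * u a))"
      using X unfolding psd_def by blast
    also have "\<dots> = t * (t * q - 2 * nsq D u)"
      unfolding sform_diff using v by (simp add: vu uv q_def algebra_simps)
    finally show ?thesis
      using that by (simp add: zero_le_mult_iff)
  qed
  have "nsq D u \<le> 0"
  proof (rule ccontr)
    assume "\<not> nsq D u \<le> 0"
    then have pos: "0 < nsq D u" by simp
    then have "0 < q"
      using key[of 1] by simp
    then show False
      using key[of "nsq D u / q"] pos by simp
  qed
  then have "nsq D u = 0"
    using nsq_nonneg[of D u] by simp
  then show ?thesis
    using e by (simp add: nsq_eq_0_iff u_def)
qed

lemma psd_null_imp_0: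
  assumes X: "psd D X" and v: "\<And>v. Re (sform D X v v) = 0" and "c < D" "e < D"
  shows "X c e = 0"
proof -
  have "mapply D X (\<lambda>a. if a = c then 1 else 0) e = X c e"
    using assms(3) by (simp add: mapply_def if_distrib[where f = "\<lambda>t. X _ e * t"] cong: if_cong)
  then show ?thesis
    using psd_null_vector[OF X v assms(4)] by metis
qed

text \<open>Compactness of the unit sphere: otherwise normalised vectors with form below 1/(n+1)
  accumulate at a unit vector whose form is not positive.\<close>

lemma pos_def_slack:
  assumes pos: "\<And>v. nsq D v \<noteq> 0 \<Longrightarrow> 0 < Re (sform D X v v)"
  shows "\<exists>\<delta>>0. \<forall>v. \<delta> * nsq D v \<le> Re (sform D X v v)"
proof (rule ccontr)
  assume "\<not> ?thesis"
  then have "\<exists>v. Re (sform D X v v) < 1 / real (Suc n) * nsq D v" for n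
    by (metis not_le zero_less_divide_1_iff of_nat_0_less_iff zero_less_Suc)
  then obtain w where w: "\<And>n. Re (sform D X (w n) (w n)) < 1 / real (Suc n) * nsq D (w n)"
    by metis
  have wpos: "0 < nsq D (w n)" for n
  proof (rule ccontr)
    assume "\<not> 0 < nsq D (w n)"
    then have "nsq D (w n) = 0" using nsq_nonneg[of D "w n"] by simp
    moreover from this have "sform D X (w n) (w n) = 0"
      by (simp add: nsq_eq_0_iff sform_def)
    ultimately show False
      using w[of n] by simp
  qed
  define u where "u n a = of_real (1 / sqrt (nsq D (w n))) * w n a" for n a
  have un: "nsq D (u n) = 1" for n
    unfolding u_def nsq_scale using wpos[of n] by (simp add: power_divide norm_divide)
  have us: "Re (sform D X (u n) (u n)) < 1 / real (Suc n)" for n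
  proof -
    have "Re (sform D X (u n) (u n)) = Re (sform D X (w n) (w n)) / nsq D (w n)"
      unfolding u_def sform_scale using wpos[of n] by (simp add: power_divide norm_divide)
    then show ?thesis
      using w[of n] wpos[of n] by (simp add: divide_less_eq)
  qed
  have "cmod (u n a) \<le> 1" if "a \<in> {..<D}" for n a
  proof -
    have "(cmod (u n a))\<^sup>2 \<le> nsq D (u n)"
      unfolding nsq_def by (rule member_le_sum) (use that in auto)
    then show ?thesis
      unfolding un by (simp add: power_le_one_iff abs_square_le_1)
  qed
  then obtain r l where r: "strict_mono (r :: nat \<Rightarrow> nat)"
    and l: "\<And>a. a \<in> {..<D} \<Longrightarrow> (\<lambda>n. u (r n) a) \<longlonglongrightarrow> l a"
    using bounded_family_convergent_subseq[of "{..<D}" u 1] by blast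
  have "(\<lambda>n. nsq D (u (r n))) \<longlonglongrightarrow> nsq D l"
    unfolding nsq_def by (intro tendsto_intros l)
  then have nl: "nsq D l = 1"
    unfolding un by (simp add: LIMSEQ_const_iff)
  have "(\<lambda>n. Re (sform D X (u (r n)) (u (r n)))) \<longlonglongrightarrow> Re (sform D X l l)"
    unfolding sform_def by (intro tendsto_intros l)
  moreover have "(\<lambda>n. 1 / real (Suc (r n))) \<longlonglongrightarrow> 0"
    using LIMSEQ_subseq_LIMSEQ[OF LIMSEQ_Suc[OF lim_1_over_n] r] by (simp add: o_def)
  ultimately have "Re (sform D X l l) \<le> 0"
    by (rule LIMSEQ_le) (use us in \<open>auto intro: less_imp_le\<close>)
  then show False
    using pos[of l] nl by simp
qed

section \<open>Perron--Frobenius theory of the transfer map\<close>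

text \<open>The transfer matrix on vectorised operators, that is, the completely positive map that
  sends X to the sum of conj(B i) X (B i)^T.\<close>

definition tmap :: "nat \<Rightarrow> nat \<Rightarrow> (nat \<Rightarrow> nat \<Rightarrow> nat \<Rightarrow> complex) \<Rightarrow> (nat \<Rightarrow> nat \<Rightarrow> complex) \<Rightarrow> nat \<Rightarrow> nat \<Rightarrow> complex" where
  "tmap d D B X a b = (\<Sum>c<D. \<Sum>e<D. (\<Sum>i<d. cnj (B i a c) * B i b e) * X c e)"

definition fixed_by :: "nat \<Rightarrow> nat \<Rightarrow> (nat \<Rightarrow> nat \<Rightarrow> nat \<Rightarrow> complex) \<Rightarrow> (nat \<Rightarrow> nat \<Rightarrow> complex) \<Rightarrow> bool" where
  "fixed_by d D B X \<longleftrightarrow> (\<forall>a<D. \<forall>b<D. tmap d D B X a b = X a b)"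

text \<open>The Kraus form of complete positivity. Since \<open>sform\<close> conjugates its second
  argument, both arguments on the right are the adjoint of \<open>B i\<close> applied to
  \<open>v\<close>.\<close>

lemma sform_tmap:
  "sform D (tmap d D B X) v v
    = (\<Sum>i<d. sform D X (\<lambda>c. \<Sum>a<D. cnj (B i a c) * v a) (\<lambda>c. \<Sum>a<D. cnj (B i a c) * v a))"
proof -
  have "sform D (tmap d D B X) v v
      = (\<Sum>a<D. \<Sum>b<D. \<Sum>c<D. \<Sum>e<D. \<Sum>i<d. v a * cnj (v b) * (cnj (B i a c) * B i b e * X c e))"
    unfolding sform_def tmap_def by (simp add: sum_distrib_left sum_distrib_right mult_ac)
  also have "\<dots> = (\<Sum>i<d. \<Sum>c<D. \<Sum>e<D. \<Sum>a<D. \<Sum>b<D. v a * cnj (v b) * (cnj (B i a c) * B i b e * X c e))"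
  proof -
    have "(\<Sum>a<D. \<Sum>b<D. \<Sum>c<D. \<Sum>e<D. \<Sum>i<d. g a b c e i) = (\<Sum>i<d. \<Sum>c<D. \<Sum>e<D. \<Sum>a<D. \<Sum>b<D. g a b c e i)"
      for g :: "nat \<Rightarrow> nat \<Rightarrow> nat \<Rightarrow> nat \<Rightarrow> nat \<Rightarrow> complex"
    proof -
      have pair: "(\<Sum>a<D. \<Sum>b<D. h a b) = (\<Sum>p\<in>{..<D} \<times> {..<D}. h (fst p) (snd p))" for h :: "nat \<Rightarrow> nat \<Rightarrow> complex"
        by (simp add: sum.cartesian_product case_prod_beta)
      have "(\<Sum>a<D. \<Sum>b<D. \<Sum>c<D. \<Sum>e<D. \<Sum>i<d. g a b c e i)
          = (\<Sum>a<D. \<Sum>b<D. \<Sum>q\<in>{..<D} \<times> {..<D}. \<Sum>i<d. g a b (fst q) (snd q) i)"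
        by (intro sum.cong refl pair)
      also have "\<dots> = (\<Sum>p\<in>{..<D} \<times> {..<D}. \<Sum>q\<in>{..<D} \<times> {..<D}. \<Sum>i<d. g (fst p) (snd p) (fst q) (snd q) i)"
        by (rule pair)
      also have "\<dots> = (\<Sum>p\<in>{..<D} \<times> {..<D}. \<Sum>i<d. \<Sum>q\<in>{..<D} \<times> {..<D}. g (fst p) (snd p) (fst q) (snd q) i)"
        by (intro sum.cong sum.swap refl)
      also have "\<dots> = (\<Sum>i<d. \<Sum>p\<in>{..<D} \<times> {..<D}. \<Sum>q\<in>{..<D} \<times> {..<D}. g (fst p) (snd p) (fst q) (snd q) i)"
        by (rule sum.swap)
      also have "\<dots> = (\<Sum>i<d. \<Sum>q\<in>{..<D} \<times> {..<D}. \<Sum>p\<in>{..<D} \<times> {..<D}. g (fst p) (snd p) (fst q) (snd q) i)"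
        by (intro sum.cong sum.swap refl)
      also have "\<dots> = (\<Sum>i<d. \<Sum>q\<in>{..<D} \<times> {..<D}. \<Sum>a<D. \<Sum>b<D. g a b (fst q) (snd q) i)"
        by (intro sum.cong refl pair[symmetric])
      also have "\<dots> = (\<Sum>i<d. \<Sum>c<D. \<Sum>e<D. \<Sum>a<D. \<Sum>b<D. g a b c e i)"
        by (intro sum.cong refl pair[symmetric])
      finally show ?thesis .
    qed
    then show ?thesis .
  qed
  also have "\<dots> = (\<Sum>i<d. sform D X (\<lambda>c. \<Sum>a<D. cnj (B i a c) * v a) (\<lambda>c. \<Sum>a<D. cnj (B i a c) * v a))"
    unfolding sform_def cnj_sum
    by (simp add: sum_distrib_left sum_distrib_right mult_ac) (intro sum.cong refl sum.swap)
  finally show ?thesis .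
qed

lemma sform_cong:
  "(\<And>c e. c < D \<Longrightarrow> e < D \<Longrightarrow> X c e = Y c e) \<Longrightarrow> sform D X v w = sform D Y v w"
  unfolding sform_def by (intro sum.cong refl) simp

text \<open>The nonnegative terms of the Kraus sum add up to the form of the fixed point at
  \<open>v\<close>, so all of them vanish there: the null space is invariant under the adjoints of
  the tensor.\<close>

lemma fixed_psd_null_invariant:
  assumes X: "psd D X" "fixed_by d D B X" and v: "Re (sform D X v v) = 0" and i: "i < d"
  shows "Re (sform D X (\<lambda>c. \<Sum>a<D. cnj (B i a c) * v a) (\<lambda>c. \<Sum>a<D. cnj (B i a c) * v a)) = 0"
proof -
  have "(\<Sum>i<d. Re (sform D X (\<lambda>c. \<Sum>a<D. cnj (B i a c) * v a) (\<lambda>c. \<Sum>a<D. cnj (B i a c) * v a)))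
      = Re (sform D (tmap d D B X) v v)"
    unfolding sform_tmap by simp
  also have "sform D (tmap d D B X) v v = sform D X v v"
    by (rule sform_cong) (use X(2) in \<open>simp add: fixed_by_def\<close>)
  finally have "(\<Sum>i<d. Re (sform D X (\<lambda>c. \<Sum>a<D. cnj (B i a c) * v a) (\<lambda>c. \<Sum>a<D. cnj (B i a c) * v a))) = 0"
    using v by simp
  then show ?thesis
    using X(1) i unfolding psd_def by (subst (asm) sum_nonneg_eq_0_iff) auto
qed

text \<open>Every psd fixed point being definite forces the fixed space to be one-dimensional: subtract from
  \<open>R\<close> the largest multiple of \<open>X\<close> that leaves a positive semidefinite operator.\<close>

lemma hermitian_fixed_proportional:
  assumes R: "psd D R" "fixed_by d D B R"
    and definite: "\<And>Y v. psd D Y \<Longrightarrow> fixed_by d D B Y \<Longrightarrow> \<exists>c<D. \<exists>e<D. Y c e \<noteq> 0 \<Longrightarrow> nsq D v \<noteq> 0 \<Longrightarrow>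
        Re (sform D Y v v) \<noteq> 0"
    and R0: "\<exists>c<D. \<exists>e<D. R c e \<noteq> 0"
    and X: "hermitian D X" "fixed_by d D B X" and v1: "0 < Re (sform D X v1 v1)"
  shows "\<exists>t::real. \<forall>c<D. \<forall>e<D. R c e = of_real t * X c e"
proof -
  define S where "S = {t::real. 0 \<le> t \<and> (\<forall>v. 0 \<le> Re (sform D R v v) - t * Re (sform D X v v))}"
  have S0: "0 \<in> S"
    using R by (simp add: S_def psd_def)
  \<comment> \<open>The vector \<open>v1\<close> with positive form bounds the admissible
    multiples.\<close>
  have bdd: "bdd_above S"
  proof (rule bdd_aboveI)
    fix t assume "t \<in> S"
    then have "t * Re (sform D X v1 v1) \<le> Re (sform D R v1 v1)"
      by (simp add: S_def)
    then show "t \<le> Re (sform D R v1 v1) / Re (sform D X v1 v1)"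
      using v1 by (simp add: pos_le_divide_eq)
  qed
  define t where "t = Sup S"
  have t0: "0 \<le> t"
    unfolding t_def by (rule cSup_upper[OF S0 bdd])
  \<comment> \<open>The supremum is attained. This is checked vector by vector: where the form of
    \<open>X\<close> is positive, every element of \<open>S\<close> is at most the quotient of the
    two forms.\<close>
  have tS: "0 \<le> Re (sform D R v v) - t * Re (sform D X v v)" for v
  proof (cases "Re (sform D X v v) \<le> 0")
    case True
    then have "t * Re (sform D X v v) \<le> 0"
      using t0 by (simp add: mult_nonneg_nonpos)
    moreover have "0 \<le> Re (sform D R v v)"
      using R(1) by (simp add: psd_def)
    ultimately show ?thesis by linarith
  next
    case False
    have "t \<le> Re (sform D R v v) / Re (sform D X v v)"
      unfolding t_def
    proof (rule cSup_least)
      fix s assume "s \<in> S"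
      then have "s * Re (sform D X v v) \<le> Re (sform D R v v)"
        by (simp add: S_def)
      then show "s \<le> Re (sform D R v v) / Re (sform D X v v)"
        using False by (simp add: pos_le_divide_eq)
    qed (use S0 in blast)
    then show ?thesis
      using False by (simp add: pos_le_divide_eq)
  qed
  define Y where "Y c e = R c e - of_real t * X c e" for c e
  have sY: "Re (sform D Y v v) = Re (sform D R v v) - t * Re (sform D X v v)" for v
    unfolding Y_def sform_sub_op by simp
  have "psd D Y"
    using R(1) X(1) tS unfolding psd_def sY by (simp add: hermitian_def Y_def)
  moreover have "fixed_by d D B Y"
    unfolding fixed_by_def
  proof (intro allI impI)
    fix a b assume ab: "a < D" "b < D"
    have "tmap d D B Y a b = tmap d D B R a b - of_real t * tmap d D B X a b"
      unfolding tmap_def Y_def by (simp add: algebra_simps sum_subtractf sum_distrib_left)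
    then show "tmap d D B Y a b = Y a b"
      using R(2) X(2) ab by (simp add: fixed_by_def Y_def)
  qed
  ultimately have def: "Re (sform D Y v v) \<noteq> 0" if "\<exists>c<D. \<exists>e<D. Y c e \<noteq> 0" "nsq D v \<noteq> 0" for v
    using definite that by blast
  \<comment> \<open>A nonzero \<open>Y\<close> would be strictly definite, and its slack \<delta>
    would allow the multiple to grow by \<delta> / K, where \<open>K\<close> bounds the form of
    \<open>X\<close>.\<close>
  have "\<forall>c<D. \<forall>e<D. Y c e = 0"
  proof (rule ccontr)
    assume "\<not> ?thesis"
    then have "0 < Re (sform D Y v v)" if "nsq D v \<noteq> 0" for v
      using def[OF _ that] tS[of v] sY[of v] by force
    then obtain \<delta> where \<delta>: "0 < \<delta>" "\<And>v. \<delta> * nsq D v \<le> Re (sform D Y v v)"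
      using pos_def_slack[of D Y] by blast
    define K where "K = (\<Sum>c<D. \<Sum>e<D. cmod (X c e)) + 1"
    have K: "0 < K" "\<And>v. Re (sform D X v v) \<le> K * nsq D v"
    proof -
      have "0 \<le> (\<Sum>c<D. \<Sum>e<D. cmod (X c e))"
        by (intro sum_nonneg) simp
      then show "0 < K" by (simp add: K_def)
      show "Re (sform D X v v) \<le> K * nsq D v" for v
        using Re_sform_le[of D X v] nsq_nonneg[of D v] unfolding K_def distrib_right by linarith
    qed
    have "t + \<delta> / K \<in> S"
    proof -
      have "\<delta> / K * Re (sform D X v v) \<le> \<delta> * nsq D v" for v
        using mult_left_mono[OF K(2)[of v], of "\<delta> / K"] K(1) \<delta>(1) by simp
      then have "0 \<le> Re (sform D R v v) - (t + \<delta> / K) * Re (sform D X v v)" for v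
        using \<delta>(2)[of v] unfolding sY distrib_right by (smt (verit))
      then show ?thesis
        using t0 \<delta>(1) K(1) by (simp add: S_def)
    qed
    then have "t + \<delta> / K \<le> t"
      unfolding t_def by (rule cSup_upper[OF _ bdd])
    then show False
      using divide_pos_pos[OF \<delta>(1) K(1)] by linarith
  qed
  then show ?thesis
    by (auto simp: Y_def)
qed

lemma tmap_add: "tmap d D B (\<lambda>c e. z * X c e + w * Y c e) a b = z * tmap d D B X a b + w * tmap d D B Y a b"
  unfolding tmap_def by (simp add: sum_distrib_left sum.distrib algebra_simps)

lemma tmap_adjoint: "tmap d D B (\<lambda>c e. cnj (X e c)) a b = cnj (tmap d D B X b a)"
  unfolding tmap_def cnj_sum complex_cnj_mult complex_cnj_cnj
  by (subst sum.swap) (simp add: mult.commute)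

text \<open>The map commutes with taking adjoints, so the hermitian and the antihermitian part of
  \<open>X\<close> are fixed as well. A hermitian fixed point has a positive value, or its negative
  has one, or its form vanishes identically and with it the operator.\<close>

lemma fixed_proportional:
  assumes R: "psd D R" "fixed_by d D B R"
    and definite: "\<And>Y v. psd D Y \<Longrightarrow> fixed_by d D B Y \<Longrightarrow> \<exists>c<D. \<exists>e<D. Y c e \<noteq> 0 \<Longrightarrow> nsq D v \<noteq> 0 \<Longrightarrow>
        Re (sform D Y v v) \<noteq> 0"
    and R0: "\<exists>c<D. \<exists>e<D. R c e \<noteq> 0"
    and X: "fixed_by d D B X"
  shows "\<exists>z. \<forall>c<D. \<forall>e<D. X c e = z * R c e"
proof -
  have herm: "\<exists>z. \<forall>c<D. \<forall>e<D. H c e = z * R c e" if H: "hermitian D H" "fixed_by d D B H" for H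
  proof -
    have pos: "\<exists>z. \<forall>c<D. \<forall>e<D. H c e = z * R c e"
      if H: "hermitian D H" "fixed_by d D B H" and v: "0 < Re (sform D H v v)" for H v
    proof -
      obtain t :: real where t: "\<And>c e. c < D \<Longrightarrow> e < D \<Longrightarrow> R c e = of_real t * H c e"
        using hermitian_fixed_proportional[OF R definite R0 H v] by blast
      have "t \<noteq> 0"
        using t R0 by auto
      then have "H c e = of_real (1 / t) * R c e" if "c < D" "e < D" for c e
        using t[OF that] by simp
      then show ?thesis by blast
    qed
    consider v where "0 < Re (sform D H v v)" | v where "Re (sform D H v v) < 0"
      | "\<And>v. Re (sform D H v v) = 0"
      by (meson linorder_neqE_linordered_idom)
    then show ?thesis
    proof cases
      case 1
      then show ?thesis by (rule pos[OF H])
    next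
      case (2 v)
      have "hermitian D (\<lambda>c e. - H c e)"
        using H(1) by (simp add: hermitian_def)
      moreover have "fixed_by d D B (\<lambda>c e. - H c e)"
        using H(2) by (simp add: fixed_by_def tmap_def sum_negf)
      moreover have "0 < Re (sform D (\<lambda>c e. - H c e) v v)"
        using 2 by (simp add: sform_def sum_negf)
      ultimately obtain z where "\<forall>c<D. \<forall>e<D. - H c e = z * R c e"
        using pos by blast
      then have "\<forall>c<D. \<forall>e<D. H c e = (- z) * R c e"
        by (metis minus_minus mult_minus_left)
      then show ?thesis by blast
    next
      case 3
      then have "psd D H"
        using H(1) by (simp add: psd_def)
      then have "\<forall>c<D. \<forall>e<D. H c e = 0 * R c e"
        using psd_null_imp_0[OF _ 3] by simp
      then show ?thesis by blast
    qed
  qed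
  define X' where "X' c e = cnj (X e c)" for c e
  have X': "fixed_by d D B X'"
    using X by (simp add: fixed_by_def X'_def[abs_def] tmap_adjoint)
  define H1 where "H1 c e = 1 * X c e + 1 * X' c e" for c e
  define H2 where "H2 c e = \<i> * X c e + (- \<i>) * X' c e" for c e
  have "hermitian D H1" "hermitian D H2"
    by (simp_all add: hermitian_def H1_def H2_def X'_def)
  moreover have "fixed_by d D B H1" "fixed_by d D B H2"
    using X X' unfolding fixed_by_def H1_def[abs_def] H2_def[abs_def] tmap_add by simp_all
  ultimately obtain z1 z2 where z: "\<forall>c<D. \<forall>e<D. H1 c e = z1 * R c e" "\<forall>c<D. \<forall>e<D. H2 c e = z2 * R c e"
    using herm[of H1] herm[of H2] by blast
  have "X c e = (z1 - \<i> * z2) / 2 * R c e" if "c < D" "e < D" for c e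
  proof -
    have "2 * X c e = H1 c e - \<i> * H2 c e"
      by (simp add: H1_def H2_def algebra_simps)
    then show ?thesis
      using z that by (simp add: field_simps)
  qed
  then show ?thesis by blast
qed

section \<open>Products of transfer matrices\<close>

lemma mat_mult_entry:
  assumes "A \<in> carrier_mat nr n" "B \<in> carrier_mat n nc" "i < nr" "j < nc"
  shows "(A * B) $$ (i, j) = (\<Sum>k<n. A $$ (i, k) * B $$ (k, j))"
  using assms by (simp add: scalar_prod_def lessThan_atLeast0)

lemma pair_index_less:
  assumes "a < D" "b < D"
  shows "a * D + b < D * (D::nat)"
proof -
  have "a * D + b < Suc a * D"
    using assms(2) by simp
  also have "\<dots> \<le> D * D"
    using assms(1) by (intro mult_le_mono1) simp
  finally show ?thesis .
qed

lemma sum_pair_index: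
  fixes f :: "nat \<Rightarrow> 'a::comm_monoid_add"
  shows "(\<Sum>r<D * D. f r) = (\<Sum>a<D. \<Sum>b<D. f (a * D + b))"
proof -
  have "(\<Sum>p\<in>{..<D} \<times> {..<D}. f (fst p * D + snd p)) = (\<Sum>r<D * D. f r)"
    by (rule sum.reindex_bij_witness[where i = "\<lambda>r. (r div D, r mod D)" and j = "\<lambda>p. fst p * D + snd p"])
      (auto simp: pair_index_less less_mult_imp_div_less intro!: mod_less_divisor gr0I)
  then show ?thesis
    by (simp add: sum.cartesian_product case_prod_beta)
qed

lemma sum_pair:
  "(\<Sum>a\<in>A. \<Sum>b\<in>B. h a b) = (\<Sum>p\<in>A \<times> B. h (fst p) (snd p))"
  by (simp add: sum.cartesian_product case_prod_beta)

lemma sum_swap_2_2: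
  "(\<Sum>a\<in>A. \<Sum>b\<in>B. \<Sum>f\<in>F. \<Sum>g\<in>G. h a b f g) = (\<Sum>f\<in>F. \<Sum>g\<in>G. \<Sum>a\<in>A. \<Sum>b\<in>B. h a b f g)"
proof -
  have "(\<Sum>a\<in>A. \<Sum>b\<in>B. \<Sum>f\<in>F. \<Sum>g\<in>G. h a b f g)
      = (\<Sum>a\<in>A. \<Sum>b\<in>B. \<Sum>q\<in>F \<times> G. h a b (fst q) (snd q))"
    by (intro sum.cong refl sum_pair)
  also have "\<dots> = (\<Sum>p\<in>A \<times> B. \<Sum>q\<in>F \<times> G. h (fst p) (snd p) (fst q) (snd q))"
    by (rule sum_pair)
  also have "\<dots> = (\<Sum>q\<in>F \<times> G. \<Sum>p\<in>A \<times> B. h (fst p) (snd p) (fst q) (snd q))"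
    by (rule sum.swap)
  also have "\<dots> = (\<Sum>f\<in>F. \<Sum>g\<in>G. \<Sum>p\<in>A \<times> B. h (fst p) (snd p) f g)"
    by (rule sum_pair[symmetric])
  also have "\<dots> = (\<Sum>f\<in>F. \<Sum>g\<in>G. \<Sum>a\<in>A. \<Sum>b\<in>B. h a b f g)"
    by (intro sum.cong refl sum_pair[symmetric])
  finally show ?thesis .
qed

text \<open>The transfer matrix with a one-site operator inserted between bra and ket:
  \<open>u i j\<close> couples the conjugated tensor at index \<open>i\<close> with the plain one at
  \<open>j\<close>. The insertion \<open>kdelta\<close> gives the ordinary transfer matrix.\<close>

definition smat :: "nat \<Rightarrow> nat \<Rightarrow> (nat \<Rightarrow> nat \<Rightarrow> nat \<Rightarrow> complex) \<Rightarrow> (nat \<Rightarrow> nat \<Rightarrow> complex) \<Rightarrow> complex mat" where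
  "smat d D B u = mat (D * D) (D * D) (\<lambda>(r, q). \<Sum>i<d. \<Sum>j<d.
     u i j * (cnj (B i (r div D) (q div D)) * B j (r mod D) (q mod D)))"

definition kdelta :: "nat \<Rightarrow> nat \<Rightarrow> complex" where
  "kdelta i j = (if i = j then 1 else 0)"

abbreviation tmat :: "nat \<Rightarrow> nat \<Rightarrow> (nat \<Rightarrow> nat \<Rightarrow> nat \<Rightarrow> complex) \<Rightarrow> complex mat" where
  "tmat d D B \<equiv> smat d D B kdelta"

primrec prodm :: "nat \<Rightarrow> (nat \<Rightarrow> complex mat) \<Rightarrow> nat \<Rightarrow> complex mat" where
  "prodm n F 0 = 1\<^sub>m n"
| "prodm n F (Suc N) = prodm n F N * F N"

text \<open>The entries of the word B (x 0) ... B (x (m - 1)); only indices below \<open>D\<close>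
  matter.\<close>

primrec wp :: "nat \<Rightarrow> (nat \<Rightarrow> nat \<Rightarrow> nat \<Rightarrow> complex) \<Rightarrow> (nat \<Rightarrow> nat) \<Rightarrow> nat \<Rightarrow> nat \<Rightarrow> nat \<Rightarrow> complex" where
  "wp D B x 0 = (\<lambda>a c. if a = c then 1 else 0)"
| "wp D B x (Suc m) = (\<lambda>a c. \<Sum>f<D. wp D B x m a f * B (x m) f c)"

lemma smat_carrier [simp]: "smat d D B u \<in> carrier_mat (D * D) (D * D)"
  by (simp add: smat_def)

lemma smat_entry:
  assumes "a < D" "b < D" "c < D" "e < D"
  shows "smat d D B u $$ (a * D + b, c * D + e) = (\<Sum>i<d. \<Sum>j<d. u i j * (cnj (B i a c) * B j b e))"
  using assms by (simp add: smat_def pair_index_less)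

lemma tmat_entry:
  assumes "a < D" "b < D" "c < D" "e < D"
  shows "tmat d D B $$ (a * D + b, c * D + e) = (\<Sum>i<d. cnj (B i a c) * B i b e)"
proof -
  have "(\<Sum>j<d. kdelta i j * (cnj (B i a c) * B j b e)) = cnj (B i a c) * B i b e" if "i < d" for i
  proof -
    have "(\<Sum>j<d. kdelta i j * (cnj (B i a c) * B j b e)) = (\<Sum>j<d. if i = j then cnj (B i a c) * B j b e else 0)"
      by (rule sum.cong) (simp_all add: kdelta_def)
    then show ?thesis using that by simp
  qed
  then show ?thesis
    unfolding smat_entry[OF assms] by simp
qed

lemma prodm_carrier [simp]:
  assumes "\<And>s. F s \<in> carrier_mat n n"
  shows "prodm n F N \<in> carrier_mat n n"
  using assms by (induction N) (auto intro: mult_carrier_mat)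

lemma prodm_cong: "(\<And>s. s < N \<Longrightarrow> F s = G s) \<Longrightarrow> prodm n F N = prodm n G N"
  by (induction N) auto

lemma prodm_const: "A \<in> carrier_mat n n \<Longrightarrow> prodm n (\<lambda>_. A) N = A ^\<^sub>m N"
  by (induction N) auto

lemma prodm_add:
  assumes F: "\<And>s. F s \<in> carrier_mat n n"
  shows "prodm n F (m + k) = prodm n F m * prodm n (\<lambda>s. F (m + s)) k"
proof (induction k)
  case 0
  then show ?case using F by (simp add: right_mult_one_mat[OF prodm_carrier[of F n]])
next
  case (Suc k)
  show ?case
    using assoc_mult_mat[OF prodm_carrier[of F n m] prodm_carrier[of "\<lambda>s. F (m + s)" n k] F[of "m + k"]] F
    by (simp add: Suc)
qed

lemma wp_cong: "(\<And>s. s < m \<Longrightarrow> x s = y s) \<Longrightarrow> wp D B x m = wp D B y m"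
  by (induction m) auto

text \<open>Unfolds the product into a double sum over bra and ket configurations. Norms,
  expectation values and Gram matrices of words are all read off from it.\<close>

lemma prodm_smat_entry:
  assumes "a < D" "b < D" "c < D" "e < D"
  shows "prodm (D * D) (\<lambda>s. smat d D B (u s)) N $$ (a * D + b, c * D + e)
    = (\<Sum>x\<in>cfgs d N. \<Sum>y\<in>cfgs d N. (\<Prod>s<N. u s (x s) (y s)) * (cnj (wp D B x N a c) * wp D B y N b e))"
  using assms
proof (induction N arbitrary: c e)
  case 0
  have "a * D + b = c * D + e \<longleftrightarrow> a = c \<and> b = e"
  proof
    assume "a * D + b = c * D + e"
    then have "(a * D + b) div D = (c * D + e) div D" "(a * D + b) mod D = (c * D + e) mod D"
      by simp_all
    then show "a = c \<and> b = e"
      using 0 by simp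
  qed simp
  then show ?case
    using 0 by (auto simp: cfgs_0 pair_index_less)
next
  case (Suc N)
  let ?P = "\<lambda>x y. \<Prod>s<N. u s (x s) (y s)"
  let ?h = "\<lambda>f g x y i j. ?P x y * u N i j * (cnj (wp D B x N a f * B i f c) * (wp D B y N b g * B j g e))"
  have "prodm (D * D) (\<lambda>s. smat d D B (u s)) (Suc N) $$ (a * D + b, c * D + e)
      = (\<Sum>f<D. \<Sum>g<D. prodm (D * D) (\<lambda>s. smat d D B (u s)) N $$ (a * D + b, f * D + g)
          * smat d D B (u N) $$ (f * D + g, c * D + e))"
    unfolding prodm.simps
    by (subst mat_mult_entry[where nr = "D * D" and n = "D * D" and nc = "D * D"]) (simp_all add: Suc.prems pair_index_less sum_pair_index)
  also have "\<dots> = (\<Sum>f<D. \<Sum>g<D. \<Sum>x\<in>cfgs d N. \<Sum>y\<in>cfgs d N. \<Sum>i<d. \<Sum>j<d. ?h f g x y i j)"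
  proof (intro sum.cong refl)
    fix f g assume "f \<in> {..<D}" "g \<in> {..<D}"
    then have f: "f < D" and g: "g < D"
      by simp_all
    show "prodm (D * D) (\<lambda>s. smat d D B (u s)) N $$ (a * D + b, f * D + g)
          * smat d D B (u N) $$ (f * D + g, c * D + e)
        = (\<Sum>x\<in>cfgs d N. \<Sum>y\<in>cfgs d N. \<Sum>i<d. \<Sum>j<d. ?h f g x y i j)"
      unfolding Suc.IH[OF Suc.prems(1,2) f g] smat_entry[OF f g Suc.prems(3,4)]
        sum_distrib_right unfolding sum_distrib_left
      by (intro sum.cong refl) (simp only: mult_ac complex_cnj_mult)
  qed
  also have "\<dots> = (\<Sum>x\<in>cfgs d N. \<Sum>y\<in>cfgs d N. \<Sum>f<D. \<Sum>g<D. \<Sum>i<d. \<Sum>j<d. ?h f g x y i j)"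
    by (rule sum_swap_2_2)
  also have "\<dots> = (\<Sum>x\<in>cfgs d N. \<Sum>y\<in>cfgs d N. \<Sum>i<d. \<Sum>j<d. \<Sum>f<D. \<Sum>g<D. ?h f g x y i j)"
    by (intro sum.cong refl sum_swap_2_2)
  also have "\<dots> = (\<Sum>x\<in>cfgs d N. \<Sum>i<d. \<Sum>y\<in>cfgs d N. \<Sum>j<d. \<Sum>f<D. \<Sum>g<D. ?h f g x y i j)"
    by (intro sum.cong refl sum.swap)
  also have "\<dots> = (\<Sum>x\<in>cfgs d (Suc N). \<Sum>y\<in>cfgs d (Suc N). (\<Prod>s<Suc N. u s (x s) (y s)) *
      (cnj (wp D B x (Suc N) a c) * wp D B y (Suc N) b e))"
    unfolding sum_cfgs_Suc
  proof (intro sum.cong refl)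
    fix x i y j
    have *: "wp D B (z(N := t)) N = wp D B z N" for z t
      by (rule wp_cong) simp
    have **: "(\<Prod>s<N. u s ((x(N := i)) s) ((y(N := j)) s)) = ?P x y"
      by (rule prod.cong) auto
    show "(\<Sum>f<D. \<Sum>g<D. ?h f g x y i j) = (\<Prod>s<Suc N. u s ((x(N := i)) s) ((y(N := j)) s)) *
        (cnj (wp D B (x(N := i)) (Suc N) a c) * wp D B (y(N := j)) (Suc N) b e)"
      unfolding prod.lessThan_Suc ** wp.simps * cnj_sum sum_product
      unfolding sum_distrib_left by simp
  qed
  finally show ?case .
qed

lemma prod_kdelta:
  assumes "x \<in> cfgs d N" "y \<in> cfgs d N"
  shows "(\<Prod>s<N. kdelta (x s) (y s)) = (if x = y then 1 else 0)"
proof (cases "x = y")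
  case False
  then obtain s where "x s \<noteq> y s" by (auto simp: fun_eq_iff)
  moreover from this have "s < N"
    using assms by (cases "s < N") (auto simp: cfgs_def)
  ultimately show ?thesis
    using False by (auto simp: kdelta_def intro!: prod_zero bexI[of _ s])
qed (simp add: kdelta_def)

lemma tmat_pow_entry:
  assumes "a < D" "b < D" "c < D" "e < D"
  shows "(tmat d D B ^\<^sub>m N) $$ (a * D + b, c * D + e) = (\<Sum>x\<in>cfgs d N. cnj (wp D B x N a c) * wp D B x N b e)"
proof -
  have "(tmat d D B ^\<^sub>m N) $$ (a * D + b, c * D + e) = (\<Sum>x\<in>cfgs d N. \<Sum>y\<in>cfgs d N.
      if x = y then cnj (wp D B x N a c) * wp D B y N b e else 0)"
    unfolding prodm_const[OF smat_carrier, symmetric] prodm_smat_entry[OF assms]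
    by (intro sum.cong refl) (simp add: prod_kdelta)
  then show ?thesis by simp
qed

section \<open>Growth of matrix powers\<close>

lemma smult_pow_mat:
  fixes c :: complex
  assumes A: "A \<in> carrier_mat n n"
  shows "(c \<cdot>\<^sub>m A) ^\<^sub>m m = c ^ m \<cdot>\<^sub>m (A ^\<^sub>m m)"
proof (induction m)
  case 0
  have "1 \<cdot>\<^sub>m 1\<^sub>m n = (1\<^sub>m n :: complex mat)" by (rule eq_matI) auto
  then show ?case using A by simp
next
  case (Suc m)
  have "(c \<cdot>\<^sub>m A) ^\<^sub>m Suc m = (c ^ m \<cdot>\<^sub>m (A ^\<^sub>m m)) * (c \<cdot>\<^sub>m A)"
    by (simp add: Suc)
  also have "\<dots> = c ^ m \<cdot>\<^sub>m (c \<cdot>\<^sub>m (A ^\<^sub>m m * A))"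
    using A by (simp add: mult_smult_assoc_mat[where nr = n and n = n and nc = n]
        mult_smult_distrib[where nr = n and n = n and nc = n]) (rule eq_matI, auto)
  finally show ?case
    by (rule trans) (rule eq_matI, auto)
qed

lemma pow_mat_Suc_left:
  assumes A: "A \<in> carrier_mat n n"
  shows "A ^\<^sub>m Suc m = A * A ^\<^sub>m m"
proof (induction m)
  case 0
  then show ?case using A by simp
next
  case (Suc m)
  have "A ^\<^sub>m Suc (Suc m) = (A * A ^\<^sub>m m) * A"
    using Suc by simp
  also have "\<dots> = A * A ^\<^sub>m Suc m"
    using assoc_mult_mat[OF A pow_carrier_mat[OF A, of m] A] by simp
  finally show ?case .
qed

text \<open>Rescaled by \<open>1 / r\<close>, the matrix has spectral radius below 1, and its powers
  are bounded by the Jordan normal form.\<close>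

lemma pow_mat_bound:
  assumes A: "A \<in> carrier_mat n n" and n: "0 < n" and r: "0 < r"
    and ev: "\<And>\<mu>. eigenvalue A \<mu> \<Longrightarrow> cmod \<mu> < r"
  shows "\<exists>C\<ge>0. \<forall>m. \<forall>i<n. \<forall>j<n. cmod ((A ^\<^sub>m m) $$ (i, j)) \<le> C * r ^ m"
proof -
  define A' where "A' = complex_of_real (1 / r) \<cdot>\<^sub>m A"
  have A': "A' \<in> carrier_mat n n"
    using A by (simp add: A'_def)
  have "spectral_radius A' < 1"
  proof -
    obtain \<mu> where \<mu>: "eigenvalue A' \<mu>" and eq: "spectral_radius A' = cmod \<mu>"
      using spectral_radius_mem_max(1)[OF A' n] by (auto simp: spectrum_def)
    obtain v where v: "v \<in> carrier_vec n" "v \<noteq> 0\<^sub>v n" "A' *\<^sub>v v = \<mu> \<cdot>\<^sub>v v"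
      using \<mu> A' unfolding eigenvalue_def eigenvector_def by auto
    have "A *\<^sub>v v = of_real r \<cdot>\<^sub>v (A' *\<^sub>v v)"
      using A v(1) r by (intro eq_vecI) (auto simp: A'_def)
    then have "A *\<^sub>v v = (of_real r * \<mu>) \<cdot>\<^sub>v v"
      using v by (simp add: smult_smult_assoc)
    then have "eigenvalue A (of_real r * \<mu>)"
      using A v unfolding eigenvalue_def eigenvector_def by auto
    then have "cmod (of_real r * \<mu>) < r"
      by (rule ev)
    then have "r * cmod \<mu> < r * 1"
      using r by (simp add: norm_mult)
    then show ?thesis
      using r eq by simp
  qed
  then obtain c where c: "\<And>k. norm_bound (A' ^\<^sub>m k) c"
    using spectral_radius_jnf_norm_bound_less_1_upper_triangular[OF A'] by blast
  have "cmod ((A ^\<^sub>m m) $$ (i, j)) \<le> max c 0 * r ^ m" if "i < n" "j < n" for m i j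
  proof -
    have "(A' ^\<^sub>m m) $$ (i, j) = of_real (1 / r) ^ m * (A ^\<^sub>m m) $$ (i, j)"
      unfolding A'_def smult_pow_mat[OF A] using A that by simp
    moreover have "cmod ((A' ^\<^sub>m m) $$ (i, j)) \<le> c"
      using c[of m] A' that unfolding norm_bound_def by simp
    ultimately have "cmod ((A ^\<^sub>m m) $$ (i, j)) / r ^ m \<le> c"
      using r by (simp add: norm_mult norm_power norm_divide power_one_over)
    then have "cmod ((A ^\<^sub>m m) $$ (i, j)) \<le> c * r ^ m"
      using r by (simp add: pos_divide_le_eq)
    also have "\<dots> \<le> max c 0 * r ^ m"
      using r by (intro mult_right_mono) auto
    finally show ?thesis .
  qed
  then show ?thesis
    by (intro exI[of _ "max c 0"]) auto
qed

text \<open>If every late term exceeded the fraction \<open>e\<close> of the preceding partial sum,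
  the partial sums would grow by the factor \<open>1 + e\<close> in each step and the terms
  exponentially. This makes Cesaro means nearly invariant at suitable times although the orbit may
  still grow polynomially.\<close>

lemma subexponential_partial_sums:
  fixes a :: "nat \<Rightarrow> real"
  assumes \<delta>: "0 < \<delta>" "\<And>m. \<delta> \<le> a m"
    and sub: "\<And>s. 1 < s \<Longrightarrow> \<exists>C. \<forall>m. a m \<le> C * s ^ m"
    and e: "0 < e"
  shows "\<exists>m. 1 \<le> e * (\<Sum>j<m. a j) \<and> a m \<le> e * (\<Sum>j<m. a j)"
proof (rule ccontr)
  assume neg: "\<not> ?thesis"
  define S where "S m = (\<Sum>j<m. a j)" for m
  obtain m0 :: nat where m0: "1 / (e * \<delta>) \<le> real m0"
    using real_arch_simple by blast
  have S_ge: "1 \<le> e * S m" if "m0 \<le> m" for m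
  proof -
    have "real m * \<delta> \<le> S m"
      unfolding S_def using sum_mono[of "{..<m}" "\<lambda>_. \<delta>" a] \<delta>(2) by simp
    moreover have "1 / (e * \<delta>) \<le> real m"
      using m0 that by linarith
    then have "1 \<le> real m * (e * \<delta>)"
      using e \<delta>(1) by (simp add: pos_divide_le_eq)
    ultimately have "1 \<le> e * (real m * \<delta>)" "e * (real m * \<delta>) \<le> e * S m"
      using e by (simp_all add: mult_ac)
    then show ?thesis by linarith
  qed
  have big: "e * S m < a m" if "m0 \<le> m" for m
    using neg S_ge[OF that] unfolding S_def by force
  have grow: "(1 + e) ^ j \<le> e * S (m0 + j)" for j
  proof (induction j)
    case 0
    then show ?case using S_ge by simp
  next
    case (Suc j)
    have "(1 + e) ^ Suc j \<le> (1 + e) * (e * S (m0 + j))"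
      using Suc e by simp
    also have "\<dots> = e * (S (m0 + j) + e * S (m0 + j))"
      by (simp add: algebra_simps)
    also have "\<dots> \<le> e * (S (m0 + j) + a (m0 + j))"
      using big[of "m0 + j"] e by simp
    finally show ?case
      by (simp add: S_def)
  qed
  define s where "s = 1 + e / 2"
  have s: "1 < s" "s < 1 + e"
    using e by (simp_all add: s_def)
  obtain C where C: "\<And>m. a m \<le> C * s ^ m"
    using sub[OF s(1)] by blast
  have "((1 + e) / s) ^ j \<le> C * s ^ m0" for j
  proof -
    have "(1 + e) ^ j \<le> C * s ^ (m0 + j)"
      using grow[of j] big[of "m0 + j"] C[of "m0 + j"] by simp
    then show ?thesis
      using s(1) by (simp add: power_divide pos_divide_le_eq power_add mult_ac)
  qed
  moreover obtain j where "C * s ^ m0 < ((1 + e) / s) ^ j"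
    using real_arch_pow[of "(1 + e) / s"] s by auto
  ultimately show False
    by (meson not_le)
qed

section \<open>The orbit of the identity under the transfer map\<close>

definition wsum :: "nat \<Rightarrow> nat \<Rightarrow> (nat \<Rightarrow> nat \<Rightarrow> nat \<Rightarrow> complex) \<Rightarrow> nat \<Rightarrow> nat \<Rightarrow> nat \<Rightarrow> complex" where
  "wsum d D B m a b = (\<Sum>x\<in>cfgs d m. \<Sum>c<D. cnj (wp D B x m a c) * wp D B x m b c)"

text \<open>The trace of \<open>wsum\<close>, which is the m-th iterate of the identity. By
  Cauchy-Schwarz it dominates every entry of the m-th power of the transfer matrix, hence its use as
  normalisation.\<close>

definition wnorm :: "nat \<Rightarrow> nat \<Rightarrow> (nat \<Rightarrow> nat \<Rightarrow> nat \<Rightarrow> complex) \<Rightarrow> nat \<Rightarrow> real" where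
  "wnorm d D B m = (\<Sum>x\<in>cfgs d m. \<Sum>c<D. \<Sum>a<D. (cmod (wp D B x m a c))\<^sup>2)"

lemma wsum_tmat_pow:
  assumes "a < D" "b < D"
  shows "wsum d D B m a b = (\<Sum>c<D. (tmat d D B ^\<^sub>m m) $$ (a * D + b, c * D + c))"
  unfolding wsum_def using assms by (subst sum.swap) (simp add: tmat_pow_entry)

lemma wsum_Suc:
  assumes ab: "a < D" "b < D"
  shows "wsum d D B (Suc m) a b = tmap d D B (wsum d D B m) a b"
proof -
  have "(tmat d D B ^\<^sub>m Suc m) $$ (a * D + b, c * D + c) =
      (\<Sum>f<D. \<Sum>g<D. (\<Sum>i<d. cnj (B i a f) * B i b g) * (tmat d D B ^\<^sub>m m) $$ (f * D + g, c * D + c))"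
    if "c < D" for c
    unfolding pow_mat_Suc_left[OF smat_carrier] using ab that
    by (subst mat_mult_entry[where nr = "D * D" and n = "D * D" and nc = "D * D"])
      (simp_all add: pair_index_less sum_pair_index tmat_entry)
  then have "wsum d D B (Suc m) a b = (\<Sum>c<D. \<Sum>f<D. \<Sum>g<D. (\<Sum>i<d. cnj (B i a f) * B i b g) *
      (tmat d D B ^\<^sub>m m) $$ (f * D + g, c * D + c))"
    unfolding wsum_tmat_pow[OF ab] by (intro sum.cong refl) simp
  also have "\<dots> = (\<Sum>f<D. \<Sum>c<D. \<Sum>g<D. (\<Sum>i<d. cnj (B i a f) * B i b g) *
      (tmat d D B ^\<^sub>m m) $$ (f * D + g, c * D + c))"
    by (rule sum.swap)
  also have "\<dots> = (\<Sum>f<D. \<Sum>g<D. \<Sum>c<D. (\<Sum>i<d. cnj (B i a f) * B i b g) *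
      (tmat d D B ^\<^sub>m m) $$ (f * D + g, c * D + c))"
    by (intro sum.cong refl sum.swap)
  also have "\<dots> = tmap d D B (wsum d D B m) a b"
    unfolding tmap_def by (intro sum.cong refl) (simp add: wsum_tmat_pow sum_distrib_left)
  finally show ?thesis .
qed

lemma wnorm_nonneg: "0 \<le> wnorm d D B m"
  unfolding wnorm_def by (intro sum_nonneg) simp

lemma column_sum_le_wnorm:
  assumes "a < D" "c < D"
  shows "(\<Sum>x\<in>cfgs d m. (cmod (wp D B x m a c))\<^sup>2) \<le> wnorm d D B m"
  unfolding wnorm_def
proof (rule sum_mono)
  fix x
  have "(cmod (wp D B x m a c))\<^sup>2 \<le> (\<Sum>a<D. (cmod (wp D B x m a c))\<^sup>2)"
    by (rule member_le_sum) (use assms in auto)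
  also have "\<dots> \<le> (\<Sum>c<D. \<Sum>a<D. (cmod (wp D B x m a c))\<^sup>2)"
    by (rule member_le_sum[where f = "\<lambda>c. \<Sum>a<D. (cmod (wp D B x m a c))\<^sup>2"])
      (use assms in \<open>auto intro: sum_nonneg\<close>)
  finally show "(cmod (wp D B x m a c))\<^sup>2 \<le> (\<Sum>c<D. \<Sum>a<D. (cmod (wp D B x m a c))\<^sup>2)" .
qed

lemma tmat_pow_le_wnorm:
  assumes "a < D" "b < D" "c < D" "e < D"
  shows "cmod ((tmat d D B ^\<^sub>m m) $$ (a * D + b, c * D + e)) \<le> wnorm d D B m"
proof -
  have "cmod ((tmat d D B ^\<^sub>m m) $$ (a * D + b, c * D + e))
      \<le> (\<Sum>x\<in>cfgs d m. cmod (wp D B x m a c) * cmod (wp D B x m b e))"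
    unfolding tmat_pow_entry[OF assms] by (rule order_trans[OF norm_sum]) (simp add: norm_mult)
  also have "\<dots> \<le> (\<Sum>x\<in>cfgs d m. ((cmod (wp D B x m a c))\<^sup>2 + (cmod (wp D B x m b e))\<^sup>2) / 2)"
  proof (rule sum_mono)
    fix x
    show "cmod (wp D B x m a c) * cmod (wp D B x m b e) \<le> ((cmod (wp D B x m a c))\<^sup>2 + (cmod (wp D B x m b e))\<^sup>2) / 2"
      using sum_squares_bound[of "cmod (wp D B x m a c)" "cmod (wp D B x m b e)"] by simp
  qed
  also have "\<dots> \<le> wnorm d D B m"
    using column_sum_le_wnorm[where d = d and B = B and m = m, OF assms(1,3)]
      column_sum_le_wnorm[where d = d and B = B and m = m, OF assms(2,4)]
    by (simp add: sum_divide_distrib[symmetric] sum.distrib)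
  finally show ?thesis .
qed

lemma wsum_le_wnorm:
  assumes "a < D" "b < D"
  shows "cmod (wsum d D B m a b) \<le> real D * wnorm d D B m"
proof -
  have "cmod (wsum d D B m a b) \<le> (\<Sum>c<D. wnorm d D B m)"
    unfolding wsum_tmat_pow[OF assms]
    by (rule order_trans[OF norm_sum]) (intro sum_mono tmat_pow_le_wnorm, use assms in auto)
  then show ?thesis by simp
qed

lemma wnorm_eq: "complex_of_real (wnorm d D B m) = (\<Sum>a<D. \<Sum>c<D. (tmat d D B ^\<^sub>m m) $$ (a * D + a, c * D + c))"
proof -
  have "(\<Sum>a<D. \<Sum>c<D. (tmat d D B ^\<^sub>m m) $$ (a * D + a, c * D + c))
      = (\<Sum>a<D. \<Sum>x\<in>cfgs d m. \<Sum>c<D. complex_of_real ((cmod (wp D B x m a c))\<^sup>2))"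
  proof (rule sum.cong[OF refl])
    fix a assume "a \<in> {..<D}"
    then have "(\<Sum>c<D. (tmat d D B ^\<^sub>m m) $$ (a * D + a, c * D + c)) = wsum d D B m a a"
      by (simp add: wsum_tmat_pow)
    also have "\<dots> = (\<Sum>x\<in>cfgs d m. \<Sum>c<D. complex_of_real ((cmod (wp D B x m a c))\<^sup>2))"
      unfolding wsum_def by (intro sum.cong refl) (simp only: complex_norm_square mult.commute)
    finally show "(\<Sum>c<D. (tmat d D B ^\<^sub>m m) $$ (a * D + a, c * D + c))
        = (\<Sum>x\<in>cfgs d m. \<Sum>c<D. complex_of_real ((cmod (wp D B x m a c))\<^sup>2))" .
  qed
  also have "\<dots> = (\<Sum>x\<in>cfgs d m. \<Sum>a<D. \<Sum>c<D. complex_of_real ((cmod (wp D B x m a c))\<^sup>2))"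
    by (rule sum.swap)
  also have "\<dots> = (\<Sum>x\<in>cfgs d m. \<Sum>c<D. \<Sum>a<D. complex_of_real ((cmod (wp D B x m a c))\<^sup>2))"
    by (intro sum.cong refl sum.swap)
  finally show ?thesis
    by (simp add: wnorm_def)
qed

lemma wnorm_subexponential:
  assumes D: "0 < D" and ev: "\<And>\<mu>. eigenvalue (tmat d D B) \<mu> \<Longrightarrow> cmod \<mu> \<le> 1" and s: "1 < s"
  shows "\<exists>C. \<forall>m. wnorm d D B m \<le> C * s ^ m"
proof -
  have "\<exists>C\<ge>0. \<forall>m. \<forall>i<D * D. \<forall>j<D * D. cmod ((tmat d D B ^\<^sub>m m) $$ (i, j)) \<le> C * s ^ m"
  proof (rule pow_mat_bound[OF smat_carrier])
    show "cmod \<mu> < s" if "eigenvalue (tmat d D B) \<mu>" for \<mu>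
      using ev[OF that] s by linarith
  qed (use D s in auto)
  then obtain C where C: "\<And>m i j. i < D * D \<Longrightarrow> j < D * D \<Longrightarrow> cmod ((tmat d D B ^\<^sub>m m) $$ (i, j)) \<le> C * s ^ m"
    by blast
  have "wnorm d D B m \<le> (real D * real D * C) * s ^ m" for m
  proof -
    have "wnorm d D B m = cmod (complex_of_real (wnorm d D B m))"
      by (simp add: wnorm_nonneg)
    also have "\<dots> \<le> (\<Sum>a<D. \<Sum>c<D. C * s ^ m)"
      unfolding wnorm_eq by (intro sum_norm_le C) (auto simp: pair_index_less)
    finally show ?thesis
      by (simp add: mult_ac)
  qed
  then show ?thesis by blast
qed

lemma pow_mat_eigenvector:
  assumes A: "A \<in> carrier_mat n n" and v: "v \<in> carrier_vec n" "A *\<^sub>v v = z \<cdot>\<^sub>v v"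
  shows "A ^\<^sub>m m *\<^sub>v v = (z :: complex) ^ m \<cdot>\<^sub>v v"
proof (induction m)
  case 0
  then show ?case using A v(1) by simp
next
  case (Suc m)
  have "A ^\<^sub>m Suc m *\<^sub>v v = A ^\<^sub>m m *\<^sub>v (A *\<^sub>v v)"
    using assoc_mult_mat_vec[OF pow_carrier_mat[OF A, of m] A v(1)] by simp
  also have "\<dots> = z \<cdot>\<^sub>v (A ^\<^sub>m m *\<^sub>v v)"
    unfolding v(2) using mult_mat_vec[OF pow_carrier_mat[OF A, of m] v(1)] by simp
  finally show ?case
    by (simp add: Suc smult_smult_assoc)
qed

lemma mat_vec_entry:
  assumes "A \<in> carrier_mat nr n" "v \<in> carrier_vec n" "i < nr"
  shows "(A *\<^sub>v v) $ i = (\<Sum>k<n. A $$ (i, k) * v $ k)"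
  using assms by (simp add: scalar_prod_def lessThan_atLeast0)

text \<open>An eigenvector for 1 is reproduced by all powers, so their entries, all bounded by
  \<open>wnorm\<close>, cannot become arbitrarily small simultaneously.\<close>

lemma wnorm_lower:
  assumes "eigenvalue (tmat d D B) 1"
  shows "\<exists>\<delta>>0. \<forall>m. \<delta> \<le> wnorm d D B m"
proof -
  let ?T = "tmat d D B"
  obtain v where v: "v \<in> carrier_vec (D * D)" "v \<noteq> 0\<^sub>v (D * D)" "?T *\<^sub>v v = 1 \<cdot>\<^sub>v v"
    using assms smat_carrier[of d D B kdelta] unfolding eigenvalue_def eigenvector_def by auto
  obtain r where r: "r < D * D" "v $ r \<noteq> 0"
  proof -
    have "\<exists>r<D * D. v $ r \<noteq> 0"
    proof (rule ccontr)
      assume "\<not> ?thesis"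
      then have "v = 0\<^sub>v (D * D)"
        using v(1) by (intro eq_vecI) auto
      then show False using v(2) by simp
    qed
    then show ?thesis using that by blast
  qed
  define K where "K = (\<Sum>q<D * D. cmod (v $ q))"
  have "cmod (v $ r) \<le> wnorm d D B m * K" for m
  proof -
    have "?T ^\<^sub>m m *\<^sub>v v = v"
      using pow_mat_eigenvector[OF smat_carrier v(1,3), of m] v(1) by simp
    then have "v $ r = (\<Sum>q<D * D. (?T ^\<^sub>m m) $$ (r, q) * v $ q)"
      using mat_vec_entry[OF pow_carrier_mat[OF smat_carrier] v(1) r(1), of d B kdelta m] by simp
    also have "cmod \<dots> \<le> (\<Sum>q<D * D. wnorm d D B m * cmod (v $ q))"
    proof (rule sum_norm_le)
      fix q assume "q \<in> {..<D * D}"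
      then have q: "q < D * D" by simp
      then have D: "0 < D" by (auto intro: gr0I)
      have "cmod ((?T ^\<^sub>m m) $$ ((r div D) * D + r mod D, (q div D) * D + q mod D)) \<le> wnorm d D B m"
        by (rule tmat_pow_le_wnorm) (use r(1) q D in \<open>auto simp: less_mult_imp_div_less\<close>)
      then show "cmod ((?T ^\<^sub>m m) $$ (r, q) * v $ q) \<le> wnorm d D B m * cmod (v $ q)"
        by (simp add: norm_mult mult_right_mono)
    qed
    finally show ?thesis
      by (simp add: K_def sum_distrib_left)
  qed
  moreover have K: "0 < K"
  proof -
    have "cmod (v $ r) \<le> K"
      unfolding K_def by (rule member_le_sum) (use r in auto)
    moreover have "0 < cmod (v $ r)"
      using r(2) by simp
    ultimately show ?thesis by linarith
  qed
  ultimately have "cmod (v $ r) / K \<le> wnorm d D B m" for m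
    by (simp add: pos_divide_le_eq)
  moreover have "0 < cmod (v $ r) / K"
    using K r(2) by simp
  ultimately show ?thesis by blast
qed

text \<open>The pairing is a sum of forms of \<open>L\<close> at the conjugated columns of all
  words, to each of which the hypothesis applies. The bound passes to limits and yields positivity
  and non-vanishing of the fixed point.\<close>

lemma wsum_pairing:
  assumes "\<And>v. \<delta> * nsq D v \<le> Re (sform D L v v)"
  shows "\<delta> * wnorm d D B m \<le> Re (\<Sum>a<D. \<Sum>b<D. L a b * wsum d D B m a b)"
proof -
  have "\<delta> * wnorm d D B m = (\<Sum>x\<in>cfgs d m. \<Sum>c<D. \<delta> * nsq D (\<lambda>a. cnj (wp D B x m a c)))"
    by (simp add: wnorm_def nsq_def sum_distrib_left)
  also have "\<dots> \<le> (\<Sum>x\<in>cfgs d m. \<Sum>c<D. Re (sform D L (\<lambda>a. cnj (wp D B x m a c)) (\<lambda>a. cnj (wp D B x m a c))))"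
    by (intro sum_mono assms)
  also have "\<dots> = Re (\<Sum>x\<in>cfgs d m. \<Sum>c<D. \<Sum>a<D. \<Sum>b<D. L a b * (cnj (wp D B x m a c) * wp D B x m b c))"
    by (simp add: sform_def mult_ac)
  also have "(\<Sum>x\<in>cfgs d m. \<Sum>c<D. \<Sum>a<D. \<Sum>b<D. L a b * (cnj (wp D B x m a c) * wp D B x m b c))
      = (\<Sum>a<D. \<Sum>b<D. L a b * wsum d D B m a b)"
    by (subst sum_swap_2_2) (simp add: wsum_def sum_distrib_left)
  finally show ?thesis .
qed

text \<open>The fixed point is a limit point of the normalised Cesaro sums of the orbit of the identity.\<close>

lemma fixed_psd_exists:
  assumes D: "0 < D" and ev1: "eigenvalue (tmat d D B) 1"
    and ev: "\<And>\<mu>. eigenvalue (tmat d D B) \<mu> \<Longrightarrow> cmod \<mu> \<le> 1"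
  shows "\<exists>R. psd D R \<and> fixed_by d D B R \<and> (\<exists>c<D. \<exists>e<D. R c e \<noteq> 0) \<and>
    (\<forall>L \<delta>. (\<forall>v. \<delta> * nsq D v \<le> Re (sform D L v v)) \<longrightarrow> \<delta> \<le> Re (\<Sum>a<D. \<Sum>b<D. L a b * R a b))"
proof -
  let ?a = "wnorm d D B" and ?X = "wsum d D B"
  define S where "S m = (\<Sum>j<m. ?a j)" for m
  obtain \<delta>0 where \<delta>0: "0 < \<delta>0" "\<And>m. \<delta>0 \<le> ?a m"
    using wnorm_lower[OF ev1] by blast
  \<comment> \<open>Times at which the last term and the constant 1 are both at most the fraction
    1/(k+1) of the sum; they control the two boundary terms that remain after telescoping.\<close>
  have "\<exists>m. 1 \<le> 1 / real (Suc k) * S m \<and> ?a m \<le> 1 / real (Suc k) * S m" for k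
    unfolding S_def
    by (rule subexponential_partial_sums[OF \<delta>0]) (use wnorm_subexponential[OF D ev] in auto)
  then obtain m where m1: "\<And>k. 1 \<le> 1 / real (Suc k) * S (m k)"
    and m2: "\<And>k. ?a (m k) \<le> 1 / real (Suc k) * S (m k)"
    by metis
  have Spos: "0 < S (m k)" for k
  proof (rule ccontr)
    assume "\<not> 0 < S (m k)"
    then have "1 / real (Suc k) * S (m k) \<le> 0"
      by (intro mult_nonneg_nonpos) auto
    then show False using m1[of k] by linarith
  qed
  \<comment> \<open>Divided by the accumulated traces and not by the number of terms, because the
    orbit is not known to be bounded at this point.\<close>
  define Y where "Y k a b = (\<Sum>j<m k. ?X j a b) / of_real (S (m k))" for k a b
  have Ybound: "cmod (Y k (fst p) (snd p)) \<le> real D" if "p \<in> {..<D} \<times> {..<D}" for k p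
  proof -
    have "cmod (\<Sum>j<m k. ?X j (fst p) (snd p)) \<le> (\<Sum>j<m k. real D * ?a j)"
      by (intro sum_norm_le wsum_le_wnorm) (use that in auto)
    also have "\<dots> = real D * S (m k)"
      by (simp add: S_def sum_distrib_left)
    finally show ?thesis
      using Spos[of k] by (simp add: Y_def norm_divide pos_divide_le_eq)
  qed
  have "\<exists>r l. strict_mono (r :: nat \<Rightarrow> nat) \<and>
      (\<forall>p\<in>{..<D} \<times> {..<D}. (\<lambda>n. Y (r n) (fst p) (snd p)) \<longlonglongrightarrow> l p)"
    by (rule bounded_family_convergent_subseq[OF _ Ybound]) auto
  then obtain r l where r: "strict_mono (r :: nat \<Rightarrow> nat)"
    and l: "\<And>p. p \<in> {..<D} \<times> {..<D} \<Longrightarrow> (\<lambda>n. Y (r n) (fst p) (snd p)) \<longlonglongrightarrow> l p"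
    by blast
  define R where "R a b = l (a, b)" for a b
  have lim: "(\<lambda>n. Y (r n) a b) \<longlonglongrightarrow> R a b" if "a < D" "b < D" for a b
    using l[of "(a, b)"] that by (simp add: R_def)
  have diff: "cmod (tmap d D B (Y k) a b - Y k a b) \<le> real D * (1 + ?a 0) * (1 / real (Suc k))"
    if ab: "a < D" "b < D" for k a b
  proof -
    have "tmap d D B (Y k) a b = (\<Sum>j<m k. tmap d D B (?X j) a b) / of_real (S (m k))"
    proof -
      have "(\<Sum>j<m k. tmap d D B (?X j) a b)
          = (\<Sum>c<D. \<Sum>e<D. \<Sum>j<m k. (\<Sum>i<d. cnj (B i a c) * B i b e) * ?X j c e)"
        unfolding tmap_def by (subst sum.swap) (intro sum.cong refl sum.swap)
      then show ?thesis
        unfolding tmap_def Y_def by (simp add: sum_distrib_left sum_divide_distrib)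
    qed
    also have "\<dots> = (\<Sum>j<m k. ?X (Suc j) a b) / of_real (S (m k))"
      by (simp add: wsum_Suc[OF ab])
    finally have "tmap d D B (Y k) a b - Y k a b
        = ((\<Sum>j<m k. ?X (Suc j) a b) - (\<Sum>j<m k. ?X j a b)) / of_real (S (m k))"
      unfolding diff_divide_distrib by (simp only: Y_def)
    also have "(\<Sum>j<m k. ?X (Suc j) a b) - (\<Sum>j<m k. ?X j a b) = ?X (m k) a b - ?X 0 a b"
      unfolding sum_subtractf[symmetric] by (rule sum_lessThan_telescope)
    finally have "cmod (tmap d D B (Y k) a b - Y k a b) = cmod (?X (m k) a b - ?X 0 a b) / S (m k)"
      using Spos[of k] by (simp add: norm_divide)
    also have "\<dots> \<le> (real D * ?a (m k) + real D * ?a 0) / S (m k)"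
    proof (rule divide_right_mono)
      show "cmod (?X (m k) a b - ?X 0 a b) \<le> real D * ?a (m k) + real D * ?a 0"
        using wsum_le_wnorm[where d = d and B = B and m = "m k", OF ab] wsum_le_wnorm[where d = d and B = B and m = 0, OF ab]
          norm_triangle_ineq4[of "?X (m k) a b" "?X 0 a b"] by linarith
    qed (use Spos[of k] in simp)
    also have "\<dots> \<le> (real D * (1 / real (Suc k) * S (m k)) + real D * ?a 0 * (1 / real (Suc k) * S (m k))) / S (m k)"
    proof (intro divide_right_mono add_mono)
      show "real D * ?a (m k) \<le> real D * (1 / real (Suc k) * S (m k))"
        by (intro mult_left_mono m2) simp
      have "real D * ?a 0 * 1 \<le> real D * ?a 0 * (1 / real (Suc k) * S (m k))"
        by (intro mult_left_mono m1) (simp add: wnorm_nonneg)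
      then show "real D * ?a 0 \<le> real D * ?a 0 * (1 / real (Suc k) * S (m k))"
        by simp
    qed (use Spos[of k] in simp)
    also have "\<dots> = real D * (1 + ?a 0) * (1 / real (Suc k)) * S (m k) / S (m k)"
      by (simp only: ring_distribs mult.assoc mult_1_right mult_1_left)
    also have "\<dots> = real D * (1 + ?a 0) * (1 / real (Suc k))"
      using Spos[of k] by (intro nonzero_mult_div_cancel_right) simp
    finally show ?thesis .
  qed
  have inv0: "(\<lambda>n. 1 / real (Suc (r n))) \<longlonglongrightarrow> 0"
    using LIMSEQ_subseq_LIMSEQ[OF LIMSEQ_Suc[OF lim_1_over_n] r] by (simp add: o_def)
  have fixed: "fixed_by d D B R"
    unfolding fixed_by_def
  proof (intro allI impI)
    fix a b assume ab: "a < D" "b < D"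
    have "(\<lambda>n. tmap d D B (Y (r n)) a b - Y (r n) a b) \<longlonglongrightarrow> tmap d D B R a b - R a b"
      unfolding tmap_def by (intro tendsto_intros lim ab) auto
    moreover have "(\<lambda>n. tmap d D B (Y (r n)) a b - Y (r n) a b) \<longlonglongrightarrow> 0"
    proof (rule tendsto_0_le[OF inv0], rule always_eventually, rule allI)
      fix n
      show "norm (tmap d D B (Y (r n)) a b - Y (r n) a b) \<le> norm (1 / real (Suc (r n))) * (real D * (1 + ?a 0))"
        using diff[OF ab, of "r n"] by (simp add: mult.commute del: of_nat_Suc)
    qed
    ultimately have "tmap d D B R a b - R a b = 0"
      by (rule LIMSEQ_unique)
    then show "tmap d D B R a b = R a b" by simp
  qed
  have pairing: "\<delta> \<le> Re (\<Sum>a<D. \<Sum>b<D. L a b * R a b)"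
    if L: "\<And>v. \<delta> * nsq D v \<le> Re (sform D L v v)" for L \<delta>
  proof (rule LIMSEQ_le_const)
    show "(\<lambda>n. Re (\<Sum>a<D. \<Sum>b<D. L a b * Y (r n) a b)) \<longlonglongrightarrow> Re (\<Sum>a<D. \<Sum>b<D. L a b * R a b)"
      by (intro tendsto_intros lim) auto
    have "\<delta> \<le> Re (\<Sum>a<D. \<Sum>b<D. L a b * Y k a b)" for k
    proof -
      have "\<delta> * S (m k) \<le> (\<Sum>j<m k. Re (\<Sum>a<D. \<Sum>b<D. L a b * ?X j a b))"
        unfolding S_def sum_distrib_left by (intro sum_mono wsum_pairing L)
      also have "\<dots> = Re (\<Sum>j<m k. \<Sum>a<D. \<Sum>b<D. L a b * ?X j a b)"
        by simp
      also have "(\<Sum>j<m k. \<Sum>a<D. \<Sum>b<D. L a b * ?X j a b) = (\<Sum>a<D. \<Sum>b<D. \<Sum>j<m k. L a b * ?X j a b)"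
        by (subst sum.swap) (intro sum.cong refl sum.swap)
      also have "\<dots> = of_real (S (m k)) * (\<Sum>a<D. \<Sum>b<D. L a b * Y k a b)"
      proof -
        have "(\<Sum>j<m k. L a b * ?X j a b) = of_real (S (m k)) * (L a b * Y k a b)" for a b
          unfolding sum_distrib_left[symmetric] using Spos[of k] by (simp add: Y_def)
        then show ?thesis
          by (simp only: sum_distrib_left)
      qed
      finally have "S (m k) * \<delta> \<le> S (m k) * Re (\<Sum>a<D. \<Sum>b<D. L a b * Y k a b)"
        by (simp add: mult.commute)
      then show ?thesis
        using Spos[of k] by simp
    qed
    then show "\<exists>N. \<forall>n\<ge>N. \<delta> \<le> Re (\<Sum>a<D. \<Sum>b<D. L a b * Y (r n) a b)"
      by blast
  qed
  have "hermitian D R"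
    unfolding hermitian_def
  proof (intro allI impI)
    fix c e assume ce: "c < D" "e < D"
    have "cnj (Y k c e) = Y k e c" for k
      by (simp add: Y_def wsum_def mult.commute)
    then have "(\<lambda>n. Y (r n) e c) \<longlonglongrightarrow> cnj (R c e)"
      using tendsto_cnj[OF lim[OF ce]] by simp
    then show "cnj (R c e) = R e c"
      using lim[OF ce(2,1)] LIMSEQ_unique by blast
  qed
  \<comment> \<open>The form at \<open>u\<close> is the pairing with a positive rank-one operator,
    so \<open>pairing\<close> applies with \<delta> = 0.\<close>
  moreover have "0 \<le> Re (sform D R u u)" for u
  proof -
    have "0 \<le> Re (\<Sum>a<D. \<Sum>b<D. (u a * cnj (u b)) * R a b)"
    proof (rule pairing)
      fix v
      have "sform D (\<lambda>a b. u a * cnj (u b)) v v = (\<Sum>a<D. u a * v a) * cnj (\<Sum>a<D. u a * v a)"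
        unfolding sform_def cnj_sum sum_product by (simp add: mult_ac)
      also have "\<dots> = of_real ((cmod (\<Sum>a<D. u a * v a))\<^sup>2)"
        by (rule complex_norm_square[symmetric])
      finally show "0 * nsq D v \<le> Re (sform D (\<lambda>a b. u a * cnj (u b)) v v)"
        by simp
    qed
    then show ?thesis
      by (simp add: sform_def)
  qed
  moreover have "\<exists>c<D. \<exists>e<D. R c e \<noteq> 0"
  proof (rule ccontr)
    assume "\<not> ?thesis"
    \<comment> \<open>Pairing with the identity is the trace, which the normalisation keeps away
      from 0.\<close>
    moreover have "1 \<le> Re (\<Sum>a<D. \<Sum>b<D. kdelta a b * R a b)"
    proof (rule pairing)
      fix v
      have "sform D kdelta v v = (\<Sum>a<D. v a * cnj (v a))"
        unfolding sform_def kdelta_def by (simp add: if_distrib[where f = "\<lambda>t. _ * t"] cong: if_cong)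
      also have "\<dots> = of_real (nsq D v)"
        unfolding nsq_def of_real_sum by (intro sum.cong refl complex_norm_square[symmetric])
      finally show "1 * nsq D v \<le> Re (sform D kdelta v v)"
        by simp
    qed
    ultimately show False by simp
  qed
  ultimately show ?thesis
    using fixed pairing unfolding psd_def by blast
qed

section \<open>Normal tensors\<close>

definition coeffs_of :: "(nat \<Rightarrow> complex mat) \<Rightarrow> nat \<Rightarrow> nat \<Rightarrow> nat \<Rightarrow> complex" where
  "coeffs_of A i a c = A i $$ (a, c)"

text \<open>Its transfer matrix is the transpose, so its fixed points are the left eigenvectors of
  the original one.\<close>

definition transposed :: "(nat \<Rightarrow> nat \<Rightarrow> nat \<Rightarrow> complex) \<Rightarrow> nat \<Rightarrow> nat \<Rightarrow> nat \<Rightarrow> complex" where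
  "transposed B i a c = B i c a"

lemma index_decompose:
  assumes "r < D * (D::nat)"
  obtains a b where "a < D" "b < D" "r = a * D + b"
proof -
  have "0 < D" using assms by (auto intro: gr0I)
  then show ?thesis
    using that[of "r div D" "r mod D"] assms by (simp add: less_mult_imp_div_less)
qed

lemma dim_smat [simp]: "dim_row (smat d D B u) = D * D" "dim_col (smat d D B u) = D * D"
  by (simp_all add: smat_def)

lemma transfer_matrix_eq_tmat: "transfer_matrix d D A = tmat d D (coeffs_of A)"
proof (rule eq_matI)
  fix r s assume "r < dim_row (tmat d D (coeffs_of A))" "s < dim_col (tmat d D (coeffs_of A))"
  then have "r < D * D" "s < D * D" by (simp_all add: smat_def)
  then obtain a b c e where "a < D" "b < D" "r = a * D + b" "c < D" "e < D" "s = c * D + e"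
    by (metis index_decompose)
  then show "transfer_matrix d D A $$ (r, s) = tmat d D (coeffs_of A) $$ (r, s)"
    by (simp add: tmat_entry transfer_matrix_def pair_index_less coeffs_of_def)
qed (simp_all add: transfer_matrix_def smat_def)

lemma tmat_transposed: "tmat d D (transposed B) = transpose_mat (tmat d D B)"
proof (rule eq_matI)
  fix r s assume "r < dim_row (transpose_mat (tmat d D B))" "s < dim_col (transpose_mat (tmat d D B))"
  then have "r < D * D" "s < D * D" by (simp_all add: smat_def)
  then obtain a b c e where *: "a < D" "b < D" "r = a * D + b" "c < D" "e < D" "s = c * D + e"
    by (metis index_decompose)
  then have "transpose_mat (tmat d D B) $$ (r, s) = tmat d D B $$ (s, r)"
    by (intro index_transpose_mat(1)) (simp_all add: pair_index_less)
  then show "tmat d D (transposed B) $$ (r, s) = transpose_mat (tmat d D B) $$ (r, s)"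
    using * by (simp add: tmat_entry transposed_def)
qed (simp_all add: smat_def)

lemma eigenvalue_tmat_transposed: "eigenvalue (tmat d D (transposed B)) \<mu> = eigenvalue (tmat d D B) \<mu>"
proof -
  have "char_poly (transpose_mat (tmat d D B)) = char_poly (tmat d D B)"
    by (rule char_poly_transpose_mat[OF smat_carrier])
  then show ?thesis
    unfolding tmat_transposed
      eigenvalue_root_char_poly[OF smat_carrier]
      eigenvalue_root_char_poly[OF transpose_carrier_mat[THEN iffD2, OF smat_carrier]] by simp
qed

lemma psd_null_iff:
  assumes "psd D Y"
  shows "Re (sform D Y u u) = 0 \<longleftrightarrow> (\<forall>e<D. mapply D Y u e = 0)"
proof
  assume "Re (sform D Y u u) = 0"
  then show "\<forall>e<D. mapply D Y u e = 0"
    using psd_null_vector[OF assms] by blast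
qed (simp add: sform_mapply)

definition irreducible_tensor :: "nat \<Rightarrow> nat \<Rightarrow> (nat \<Rightarrow> complex mat) \<Rightarrow> bool" where
  "irreducible_tensor d D A \<longleftrightarrow> tensor d D A \<and>
    (\<forall>V. common_invariant_subspace d D A V \<longrightarrow> V = {0\<^sub>v D} \<or> V = carrier_vec D)"

text \<open>The orthogonal complement of the kernel of a fixed point is an invariant subspace of \<open>A\<close>.\<close>

lemma fixed_psd_definite:
  assumes irr: "irreducible_tensor d D A"
    and Y: "psd D Y" "fixed_by d D (coeffs_of A) Y" "\<exists>c<D. \<exists>e<D. Y c e \<noteq> 0" and v: "nsq D v \<noteq> 0"
  shows "Re (sform D Y v v) \<noteq> 0"
proof
  assume null: "Re (sform D Y v v) = 0"
  define V where "V = {w \<in> carrier_vec D. \<forall>u. Re (sform D Y u u) = 0 \<longrightarrow> (\<Sum>a<D. cnj (u a) * w $ a) = 0}"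
  have A: "A i \<in> carrier_mat D D" if "i < d" for i
    using irr that by (simp add: irreducible_tensor_def tensor_def)
  have "complex_subspace D V"
    unfolding complex_subspace_def V_def
    by (auto simp: distrib_left sum.distrib mult.left_commute[of "cnj _"] sum_distrib_left[symmetric])
  moreover have "A i *\<^sub>v w \<in> V" if i: "i < d" and w: "w \<in> V" for i w
  proof -
    have wc: "w \<in> carrier_vec D"
      using w by (simp add: V_def)
    have "(\<Sum>a<D. cnj (u a) * (A i *\<^sub>v w) $ a) = 0" if u: "Re (sform D Y u u) = 0" for u
    proof -
      have "(\<Sum>a<D. cnj (u a) * (A i *\<^sub>v w) $ a) = (\<Sum>a<D. \<Sum>e<D. cnj (u a) * (A i $$ (a, e) * w $ e))"
        by (intro sum.cong refl) (simp add: mat_vec_entry[OF A[OF i] wc] sum_distrib_left)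
      also have "\<dots> = (\<Sum>e<D. \<Sum>a<D. cnj (u a) * (A i $$ (a, e) * w $ e))"
        by (rule sum.swap)
      also have "\<dots> = (\<Sum>e<D. cnj (\<Sum>a<D. cnj (coeffs_of A i a e) * u a) * w $ e)"
        by (simp add: sum_distrib_right sum_distrib_left coeffs_of_def mult_ac)
      also have "\<dots> = 0"
        using w fixed_psd_null_invariant[OF Y(1,2) u i] unfolding V_def by blast
      finally show ?thesis .
    qed
    then show ?thesis
      using mult_mat_vec_carrier[OF A[OF i] wc] by (simp add: V_def)
  qed
  ultimately have "common_invariant_subspace d D A V"
    by (simp add: common_invariant_subspace_def)
  moreover have "V \<noteq> {0\<^sub>v D}"
  proof -
    obtain c0 e0 where ce: "c0 < D" "e0 < D" "Y c0 e0 \<noteq> 0"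
      using Y(3) by blast
    \<comment> \<open>A nonzero row of the hermitian \<open>Y\<close> is orthogonal to every null
      vector.\<close>
    define w where "w = vec D (Y c0)"
    have "(\<Sum>a<D. cnj (u a) * w $ a) = 0" if "Re (sform D Y u u) = 0" for u
    proof -
      have "(\<Sum>a<D. cnj (u a) * w $ a) = cnj (mapply D Y u c0)"
        unfolding mapply_def cnj_sum w_def
        using Y(1) ce(1) by (intro sum.cong refl) (simp add: psd_def hermitian_def mult.commute)
      then show ?thesis
        using psd_null_iff[OF Y(1)] that ce(1) by simp
    qed
    then have "w \<in> V"
      by (simp add: V_def w_def)
    moreover have "w $ e0 \<noteq> 0\<^sub>v D $ e0"
      using ce by (simp add: w_def)
    ultimately show ?thesis by auto
  qed
  moreover have "V \<noteq> carrier_vec D"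
  proof
    assume "V = carrier_vec D"
    \<comment> \<open>The null vector \<open>v\<close> is nonzero and hence not orthogonal to
      itself.\<close>
    then have "vec D v \<in> V" by simp
    then have "(\<Sum>a<D. cnj (v a) * vec D v $ a) = 0"
      using null by (simp add: V_def)
    then have "(\<Sum>a<D. complex_of_real ((cmod (v a))\<^sup>2)) = 0"
      by (simp only: complex_norm_square) (simp add: mult.commute)
    then have "complex_of_real (nsq D v) = 0"
      by (simp add: nsq_def)
    then show False
      using v by simp
  qed
  ultimately show False
    using irr by (auto simp: irreducible_tensor_def)
qed

text \<open>The adjoint of the transpose is the entrywise conjugate. Here the kernel itself, after
  conjugation, is the invariant subspace of \<open>A\<close>, and not its orthogonal
  complement.\<close>

lemma fixed_psd_definite_transposed:
  assumes irr: "irreducible_tensor d D A"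
    and Y: "psd D Y" "fixed_by d D (transposed (coeffs_of A)) Y" "\<exists>c<D. \<exists>e<D. Y c e \<noteq> 0" and v: "nsq D v \<noteq> 0"
  shows "Re (sform D Y v v) \<noteq> 0"
proof
  assume null: "Re (sform D Y v v) = 0"
  define V where "V = {w \<in> carrier_vec D. \<forall>e<D. mapply D Y (\<lambda>c. cnj (w $ c)) e = 0}"
  have A: "A i \<in> carrier_mat D D" if "i < d" for i
    using irr that by (simp add: irreducible_tensor_def tensor_def)
  have "complex_subspace D V"
    unfolding complex_subspace_def V_def mapply_def
    by (auto simp: distrib_left sum.distrib mult.left_commute[of "Y _ _"] sum_distrib_left[symmetric])
  moreover have "A i *\<^sub>v w \<in> V" if i: "i < d" and w: "w \<in> V" for i w
  proof -
    have wc: "w \<in> carrier_vec D"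
      using w by (simp add: V_def)
    have "Re (sform D Y (\<lambda>c. cnj (w $ c)) (\<lambda>c. cnj (w $ c))) = 0"
      using w psd_null_iff[OF Y(1)] by (simp add: V_def)
    from fixed_psd_null_invariant[OF Y(1,2) this i]
    have *: "\<forall>e<D. mapply D Y (\<lambda>c. \<Sum>a<D. cnj (transposed (coeffs_of A) i a c) * cnj (w $ a)) e = 0"
      using psd_null_iff[OF Y(1)] by blast
    have "mapply D Y (\<lambda>c. cnj ((A i *\<^sub>v w) $ c)) e
        = mapply D Y (\<lambda>c. \<Sum>a<D. cnj (transposed (coeffs_of A) i a c) * cnj (w $ a)) e" for e
      unfolding mapply_def
      by (intro sum.cong refl) (simp add: mat_vec_entry[OF A[OF i] wc] transposed_def coeffs_of_def)
    then show ?thesis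
      using * mult_mat_vec_carrier[OF A[OF i] wc] by (simp add: V_def)
  qed
  ultimately have "common_invariant_subspace d D A V"
    by (simp add: common_invariant_subspace_def)
  moreover have "V \<noteq> {0\<^sub>v D}"
  proof -
    define w where "w = vec D (\<lambda>a. cnj (v a))"
    have "mapply D Y (\<lambda>c. cnj (w $ c)) e = mapply D Y v e" for e
      unfolding mapply_def w_def by (intro sum.cong refl) simp
    then have "w \<in> V"
      using null psd_null_iff[OF Y(1)] by (simp add: V_def w_def)
    moreover obtain a where "a < D" "v a \<noteq> 0"
      using v by (auto simp: nsq_eq_0_iff)
    then have "w $ a \<noteq> 0\<^sub>v D $ a"
      by (simp add: w_def)
    ultimately show ?thesis by auto
  qed
  moreover have "V \<noteq> carrier_vec D"
  proof
    assume V: "V = carrier_vec D"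
    obtain c0 e0 where ce: "c0 < D" "e0 < D" "Y c0 e0 \<noteq> 0"
      using Y(3) by blast
    have "unit_vec D c0 \<in> V"
      unfolding V by simp
    then have "mapply D Y (\<lambda>c. cnj (unit_vec D c0 $ c)) e0 = 0"
      using ce(2) by (simp add: V_def)
    moreover have "mapply D Y (\<lambda>c. cnj (unit_vec D c0 $ c)) e0 = (\<Sum>c<D. if c = c0 then Y c e0 else 0)"
      unfolding mapply_def using ce(1) by (intro sum.cong refl) (simp add: unit_vec_def)
    ultimately show False
      using ce by simp
  qed
  ultimately show False
    using irr by (auto simp: irreducible_tensor_def)
qed

section \<open>The Perron projection of a normal tensor\<close>

definition nondegenerate :: "nat \<Rightarrow> (nat \<Rightarrow> nat \<Rightarrow> complex) \<Rightarrow> bool" where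
  "nondegenerate D X \<longleftrightarrow> (\<forall>v. (\<forall>e<D. mapply D X v e = 0) \<longrightarrow> (\<forall>c<D. v c = 0))"

lemma nondegenerate_definite:
  assumes "\<And>v. nsq D v \<noteq> 0 \<Longrightarrow> Re (sform D X v v) \<noteq> 0"
  shows "nondegenerate D X"
  unfolding nondegenerate_def
proof (intro allI impI)
  fix v c assume v: "\<forall>e<D. mapply D X v e = 0" and c: "c < D"
  then have "Re (sform D X v v) = 0"
    by (simp add: sform_mapply)
  then have "nsq D v = 0"
    using assms by blast
  then show "v c = 0"
    using c by (simp add: nsq_eq_0_iff)
qed

text \<open>\<open>Q\<close> is idempotent and absorbs \<open>E\<close> on both sides, so the cross
  terms collapse. The exponent is \<open>Suc m\<close> because the power with exponent 0 is the
  identity, from which no \<open>Q\<close> is subtracted.\<close>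

lemma minus_power_projection:
  fixes E Q :: "complex mat"
  assumes E: "E \<in> carrier_mat n n" and Q: "Q \<in> carrier_mat n n"
    and EQ: "E * Q = Q" and QE: "Q * E = Q" and QQ: "Q * Q = Q"
  shows "(E - Q) ^\<^sub>m Suc m = E ^\<^sub>m Suc m - Q" "Q * (E - Q) = 0\<^sub>m n n"
proof -
  have F: "E - Q \<in> carrier_mat n n"
    using Q by (rule minus_carrier_mat)
  show "Q * (E - Q) = 0\<^sub>m n n"
    using mult_minus_distrib_mat[OF Q E Q] Q by (simp add: QE QQ)
  have FQ: "(E - Q) * Q = 0\<^sub>m n n"
    using minus_mult_distrib_mat[OF E Q Q] Q by (simp add: EQ QQ)
  show "(E - Q) ^\<^sub>m Suc m = E ^\<^sub>m Suc m - Q"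
  proof (induction m)
    case 0
    then show ?case using E Q F by simp
  next
    case (Suc m)
    have Em: "E ^\<^sub>m Suc m \<in> carrier_mat n n"
      using E by (rule pow_carrier_mat)
    have EmQ: "E ^\<^sub>m Suc m * Q = Q"
    proof (induction m)
      case 0
      then show ?case using E EQ by simp
    next
      case (Suc m)
      have "E ^\<^sub>m Suc (Suc m) * Q = E ^\<^sub>m Suc m * (E * Q)"
        unfolding pow_mat.simps(2)[of E "Suc m"] by (rule assoc_mult_mat[OF pow_carrier_mat[OF E] E Q])
      then show ?case using Suc EQ by simp
    qed
    have "(E - Q) ^\<^sub>m Suc (Suc m) = (E ^\<^sub>m Suc m - Q) * (E - Q)"
      unfolding pow_mat.simps(2)[of "E - Q" "Suc m"] Suc ..
    also have "\<dots> = E ^\<^sub>m Suc m * (E - Q) - Q * (E - Q)"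
      by (rule minus_mult_distrib_mat[OF Em Q F])
    also have "\<dots> = E ^\<^sub>m Suc m * E - E ^\<^sub>m Suc m * Q - 0\<^sub>m n n"
      using mult_minus_distrib_mat[OF Em E Q] mult_minus_distrib_mat[OF Q E Q] Q by (simp add: QE QQ)
    also have "\<dots> = E ^\<^sub>m Suc (Suc m) - Q"
      unfolding EmQ pow_mat.simps(2)[of E "Suc m", symmetric]
      using pow_carrier_mat[OF E, of "Suc (Suc m)"] Q by (intro eq_matI) auto
    finally show ?case .
  qed
qed

text \<open>Once the remainder \<open>F = E - Q\<close> has only eigenvalues inside the unit disc,
  its powers decay exponentially. This covers possible Jordan blocks of \<open>E\<close> at 1
  without a separate argument. The rate \<open>q\<close> lies halfway between the spectral radius of
  \<open>F\<close> and 1.\<close>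

lemma normal_tensor_limit:
  assumes normal: "normal_tensor d D A"
  shows "\<exists>R L C q. 0 < D \<and> nondegenerate D R \<and> nondegenerate D L \<and>
    (\<Sum>a<D. \<Sum>b<D. L a b * R a b) = 1 \<and>
    fixed_by d D (transposed (coeffs_of A)) L \<and>
    0 \<le> C \<and> 0 < q \<and> q < (1::real) \<and>
    (\<forall>m. \<forall>a<D. \<forall>b<D. \<forall>c<D. \<forall>e<D.
      cmod ((tmat d D (coeffs_of A) ^\<^sub>m Suc m) $$ (a * D + b, c * D + e) - R a b * L c e) \<le> C * q ^ Suc m)"
proof -
  let ?B = "coeffs_of A" and ?n = "D * D"
  define E where "E = tmat d D ?B"
  have E: "E \<in> carrier_mat ?n ?n"
    by (simp add: E_def)
  have irr: "irreducible_tensor d D A"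
    using normal unfolding normal_tensor_def irreducible_tensor_def by blast
  have ev1: "eigenvalue E 1" and ev: "\<And>\<mu>. eigenvalue E \<mu> \<Longrightarrow> \<mu> \<noteq> 1 \<Longrightarrow> cmod \<mu> < 1"
    using normal unfolding normal_tensor_def transfer_matrix_eq_tmat E_def by blast+
  have le1: "cmod \<mu> \<le> 1" if "eigenvalue E \<mu>" for \<mu>
    using ev[OF that] by (cases "\<mu> = 1") auto
  have D: "0 < D"
    using eigenvalue_imp_nonzero_dim[OF E ev1] by simp
  obtain R where R: "psd D R" "fixed_by d D ?B R" "\<exists>c<D. \<exists>e<D. R c e \<noteq> 0"
    and pairing: "\<And>L \<delta>. (\<forall>v. \<delta> * nsq D v \<le> Re (sform D L v v)) \<Longrightarrow> \<delta> \<le> Re (\<Sum>a<D. \<Sum>b<D. L a b * R a b)"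
    using fixed_psd_exists[OF D ev1[unfolded E_def] le1[unfolded E_def]] by blast
  have ev1': "eigenvalue (tmat d D (transposed ?B)) 1"
    and le1': "\<And>\<mu>. eigenvalue (tmat d D (transposed ?B)) \<mu> \<Longrightarrow> cmod \<mu> \<le> 1"
    using ev1 le1 unfolding eigenvalue_tmat_transposed E_def by auto
  obtain L' where L': "psd D L'" "fixed_by d D (transposed ?B) L'" "\<exists>c<D. \<exists>e<D. L' c e \<noteq> 0"
    using fixed_psd_exists[OF D ev1' le1'] by blast
  define z where "z = (\<Sum>a<D. \<Sum>b<D. L' a b * R a b)"
  \<comment> \<open>\<open>L'\<close> is positive definite, so the lower bound on pairings that
    comes with \<open>R\<close> makes its pairing with \<open>R\<close> strictly positive. Dividing
    by \<open>z\<close> turns \<open>Q\<close> into a projection.\<close>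
  have "z \<noteq> 0"
  proof -
    have "0 < Re (sform D L' v v)" if "nsq D v \<noteq> 0" for v
      using fixed_psd_definite_transposed[OF irr L' that] L'(1) unfolding psd_def
      by (metis less_eq_real_def)
    then obtain \<delta> where \<delta>: "0 < \<delta>" "\<forall>v. \<delta> * nsq D v \<le> Re (sform D L' v v)"
      using pos_def_slack by blast
    have "0 < Re z"
      using pairing[OF \<delta>(2)] \<delta>(1) unfolding z_def by (rule less_le_trans[rotated])
    then show ?thesis by auto
  qed
  define L where "L a b = L' a b / z" for a b
  have ndR: "nondegenerate D R"
    by (rule nondegenerate_definite) (rule fixed_psd_definite[OF irr R])
  have "nondegenerate D L'"
    by (rule nondegenerate_definite) (rule fixed_psd_definite_transposed[OF irr L'])
  moreover have "mapply D L' v e = z * mapply D L v e" for v e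
    using \<open>z \<noteq> 0\<close> by (simp add: mapply_def L_def sum_distrib_left)
  ultimately have ndL: "nondegenerate D L"
    by (simp add: nondegenerate_def)
  have LR: "(\<Sum>a<D. \<Sum>b<D. L a b * R a b) = 1"
  proof -
    have "z / z = (\<Sum>a<D. \<Sum>b<D. L' a b * R a b) / z"
      by (simp only: z_def)
    also have "\<dots> = (\<Sum>a<D. \<Sum>b<D. L a b * R a b)"
      by (simp add: L_def sum_divide_distrib)
    finally have "(\<Sum>a<D. \<Sum>b<D. L a b * R a b) = z / z" ..
    then show ?thesis
      using \<open>z \<noteq> 0\<close> by simp
  qed
  have fixL: "fixed_by d D (transposed ?B) L"
    unfolding fixed_by_def
  proof (intro allI impI)
    fix a b assume "a < D" "b < D"
    then show "tmap d D (transposed ?B) L a b = L a b"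
      using L'(2) tmap_add[of d D "transposed ?B" "1 / z" L' 0 L' a b]
      by (simp add: fixed_by_def L_def[abs_def])
  qed
  define \<rho> where "\<rho> r = R (r div D) (r mod D)" for r
  define \<sigma> where "\<sigma> r = L (r div D) (r mod D)" for r
  define Q where "Q = mat ?n ?n (\<lambda>(r, s). \<rho> r * \<sigma> s)"
  have Q: "Q \<in> carrier_mat ?n ?n"
    by (simp add: Q_def)
  have \<sigma>\<rho>: "(\<Sum>r<?n. \<sigma> r * \<rho> r) = 1"
    unfolding sum_pair_index using LR by (simp add: \<sigma>_def \<rho>_def)
  have E\<rho>: "(\<Sum>s<?n. E $$ (r, s) * \<rho> s) = \<rho> r" if r: "r < ?n" for r
  proof -
    obtain a b where ab: "a < D" "b < D" "r = a * D + b"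
      using index_decompose[OF r] .
    have "(\<Sum>s<?n. E $$ (r, s) * \<rho> s) = tmap d D ?B R a b"
      unfolding sum_pair_index tmap_def by (intro sum.cong refl) (simp add: ab E_def tmat_entry \<rho>_def)
    then show ?thesis
      using R(2) ab by (simp add: fixed_by_def \<rho>_def)
  qed
  have \<sigma>E: "(\<Sum>s<?n. \<sigma> s * E $$ (s, r)) = \<sigma> r" if r: "r < ?n" for r
  proof -
    obtain a b where ab: "a < D" "b < D" "r = a * D + b"
      using index_decompose[OF r] .
    have "(\<Sum>s<?n. \<sigma> s * E $$ (s, r)) = tmap d D (transposed ?B) L a b"
      unfolding sum_pair_index tmap_def
      by (intro sum.cong refl) (simp add: ab E_def tmat_entry \<sigma>_def transposed_def)
    then show ?thesis
      using fixL ab by (simp add: fixed_by_def \<sigma>_def)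
  qed
  have EQ: "E * Q = Q"
  proof (rule eq_matI)
    fix i j assume "i < dim_row Q" "j < dim_col Q"
    then have ij: "i < ?n" "j < ?n" using Q by auto
    have "(E * Q) $$ (i, j) = (\<Sum>k<?n. E $$ (i, k) * \<rho> k) * \<sigma> j"
      unfolding mat_mult_entry[OF E Q ij] sum_distrib_right using ij
      by (intro sum.cong refl) (simp add: Q_def)
    then show "(E * Q) $$ (i, j) = Q $$ (i, j)"
      using ij by (simp add: E\<rho> Q_def)
  qed (use E Q in auto)
  have QE: "Q * E = Q"
  proof (rule eq_matI)
    fix i j assume "i < dim_row Q" "j < dim_col Q"
    then have ij: "i < ?n" "j < ?n" using Q by auto
    have "(Q * E) $$ (i, j) = \<rho> i * (\<Sum>k<?n. \<sigma> k * E $$ (k, j))"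
      unfolding mat_mult_entry[OF Q E ij] sum_distrib_left using ij
      by (intro sum.cong refl) (simp add: Q_def)
    then show "(Q * E) $$ (i, j) = Q $$ (i, j)"
      using ij by (simp add: \<sigma>E Q_def)
  qed (use E Q in auto)
  have QQ: "Q * Q = Q"
  proof (rule eq_matI)
    fix i j assume "i < dim_row Q" "j < dim_col Q"
    then have ij: "i < ?n" "j < ?n" using Q by auto
    have "(Q * Q) $$ (i, j) = \<rho> i * (\<Sum>k<?n. \<sigma> k * \<rho> k) * \<sigma> j"
      unfolding mat_mult_entry[OF Q Q ij] sum_distrib_left sum_distrib_right using ij
      by (intro sum.cong refl) (simp add: Q_def)
    then show "(Q * Q) $$ (i, j) = Q $$ (i, j)"
      using ij by (simp add: \<sigma>\<rho> Q_def)
  qed (use Q in auto)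
  define F where "F = E - Q"
  have F: "F \<in> carrier_mat ?n ?n"
    unfolding F_def using Q by (rule minus_carrier_mat)
  \<comment> \<open>An eigenvector of \<open>F\<close> for an eigenvalue outside the open disc is
    annihilated by \<open>Q\<close>, hence it is one of \<open>E\<close>; by normality the
    eigenvalue is 1, and the vector is a multiple of \<open>R\<close>. But \<open>Q\<close> fixes
    \<open>R\<close>, so the multiple is zero.\<close>
  have evF: "cmod \<mu> < 1" if ev\<mu>: "eigenvalue F \<mu>" for \<mu>
  proof (rule ccontr)
    assume big: "\<not> cmod \<mu> < 1"
    obtain v where v: "v \<in> carrier_vec ?n" "v \<noteq> 0\<^sub>v ?n" "F *\<^sub>v v = \<mu> \<cdot>\<^sub>v v"
      using ev\<mu> F unfolding eigenvalue_def eigenvector_def by auto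
    have Qv: "Q *\<^sub>v v = 0\<^sub>v ?n"
    proof -
      have "\<mu> \<cdot>\<^sub>v (Q *\<^sub>v v) = Q *\<^sub>v (F *\<^sub>v v)"
        unfolding v(3) using mult_mat_vec[OF Q v(1)] by simp
      also have "\<dots> = (Q * F) *\<^sub>v v"
        by (rule assoc_mult_mat_vec[OF Q F v(1), symmetric])
      also have "\<dots> = 0\<^sub>v ?n"
        unfolding F_def minus_power_projection(2)[OF E Q EQ QE QQ] using v(1) by (intro eq_vecI) auto
      finally have *: "\<mu> \<cdot>\<^sub>v (Q *\<^sub>v v) = 0\<^sub>v ?n" .
      have "\<mu> \<noteq> 0" using big by auto
      show ?thesis
      proof (rule eq_vecI)
        fix i assume i: "i < dim_vec (0\<^sub>v ?n :: complex vec)"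
        have "(\<mu> \<cdot>\<^sub>v (Q *\<^sub>v v)) $ i = 0"
          using * i by simp
        then show "(Q *\<^sub>v v) $ i = 0\<^sub>v ?n $ i"
          using i Q \<open>\<mu> \<noteq> 0\<close> by simp
      qed (use Q in simp)
    qed
    have "E *\<^sub>v v = F *\<^sub>v v + Q *\<^sub>v v"
    proof -
      have "E = F + Q"
        using E Q by (intro eq_matI) (auto simp: F_def)
      then show ?thesis
        using add_mult_distrib_mat_vec[OF F Q v(1)] by simp
    qed
    then have Ev: "E *\<^sub>v v = \<mu> \<cdot>\<^sub>v v"
      unfolding Qv v(3) using v(1) by simp
    then have "eigenvalue E \<mu>"
      using E v unfolding eigenvalue_def eigenvector_def by auto
    then have "\<mu> = 1"
      using ev big by blast
    define X where "X a b = v $ (a * D + b)" for a b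
    have "fixed_by d D ?B X"
      unfolding fixed_by_def
    proof (intro allI impI)
      fix a b assume ab: "a < D" "b < D"
      have "tmap d D ?B X a b = (\<Sum>s<?n. E $$ (a * D + b, s) * v $ s)"
        unfolding sum_pair_index tmap_def by (intro sum.cong refl) (simp add: ab E_def tmat_entry X_def)
      also have "\<dots> = (E *\<^sub>v v) $ (a * D + b)"
        by (rule mat_vec_entry[OF E v(1), symmetric]) (simp add: ab pair_index_less)
      also have "\<dots> = X a b"
        unfolding Ev \<open>\<mu> = 1\<close> using v(1) ab by (simp add: X_def pair_index_less)
      finally show "tmap d D ?B X a b = X a b" .
    qed
    from fixed_proportional[OF R(1,2) fixed_psd_definite[OF irr] R(3) this]
    obtain t where t: "\<And>c e. c < D \<Longrightarrow> e < D \<Longrightarrow> X c e = t * R c e"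
      by blast
    have vt: "v $ s = t * \<rho> s" if s: "s < ?n" for s
    proof -
      obtain a b where "a < D" "b < D" "s = a * D + b"
        using index_decompose[OF s] .
      then show ?thesis
        using t[of a b] by (simp add: X_def \<rho>_def)
    qed
    have "t * \<rho> r = 0" if r: "r < ?n" for r
    proof -
      have "0 = (\<Sum>s<?n. Q $$ (r, s) * v $ s)"
        using mat_vec_entry[OF Q v(1) r] Qv r by simp
      also have "\<dots> = t * \<rho> r * (\<Sum>s<?n. \<sigma> s * \<rho> s)"
        unfolding sum_distrib_left using r by (intro sum.cong refl) (simp add: Q_def vt)
      finally show ?thesis
        by (simp add: \<sigma>\<rho>)
    qed
    then have "v = 0\<^sub>v ?n"
      using v(1) vt by (intro eq_vecI) auto
    then show False
      using v(2) by simp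
  qed
  obtain q where q: "0 < q" "q < 1" "\<And>\<mu>. eigenvalue F \<mu> \<Longrightarrow> cmod \<mu> < q"
  proof -
    have n: "0 < ?n" using D by simp
    obtain \<mu> where "eigenvalue F \<mu>" "spectral_radius F = cmod \<mu>"
      using spectral_radius_mem_max(1)[OF F n] by (auto simp: spectrum_def)
    then have sr: "0 \<le> spectral_radius F" "spectral_radius F < 1"
      using evF by auto
    show ?thesis
    proof (rule that[of "(spectral_radius F + 1) / 2"])
      fix \<mu> assume "eigenvalue F \<mu>"
      then have "cmod \<mu> \<le> spectral_radius F"
        by (intro spectral_radius_mem_max(2)[OF F n]) (simp add: spectrum_def)
      then show "cmod \<mu> < (spectral_radius F + 1) / 2"
        using sr by (simp add: less_divide_eq)
    qed (use sr in auto)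
  qed
  have "\<exists>C\<ge>0. \<forall>m. \<forall>i<?n. \<forall>j<?n. cmod ((F ^\<^sub>m m) $$ (i, j)) \<le> C * q ^ m"
    by (rule pow_mat_bound[OF F]) (use D q in auto)
  then obtain C where C: "0 \<le> C" "\<And>m i j. i < ?n \<Longrightarrow> j < ?n \<Longrightarrow> cmod ((F ^\<^sub>m m) $$ (i, j)) \<le> C * q ^ m"
    by blast
  have "cmod ((E ^\<^sub>m Suc m) $$ (a * D + b, c * D + e) - R a b * L c e) \<le> C * q ^ Suc m"
    if "a < D" "b < D" "c < D" "e < D" for m a b c e
  proof -
    have "(F ^\<^sub>m Suc m) $$ (a * D + b, c * D + e) = (E ^\<^sub>m Suc m) $$ (a * D + b, c * D + e) - R a b * L c e"
      unfolding F_def minus_power_projection(1)[OF E Q EQ QE QQ]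
      using that Q by (simp add: pair_index_less Q_def \<rho>_def \<sigma>_def)
    then show ?thesis
      using C(2)[of "a * D + b" "c * D + e" "Suc m"] that by (simp add: pair_index_less del: power_Suc pow_mat.simps)
  qed
  then have bound: "\<forall>m. \<forall>a<D. \<forall>b<D. \<forall>c<D. \<forall>e<D.
      cmod ((tmat d D ?B ^\<^sub>m Suc m) $$ (a * D + b, c * D + e) - R a b * L c e) \<le> C * q ^ Suc m"
    unfolding E_def by (intro allI impI)
  show ?thesis
    by (intro exI[of _ R] exI[of _ L] exI[of _ C] exI[of _ q] conjI D ndR ndL LR fixL C(1) q(1,2) bound)
qed

section \<open>Expectation values in matrix product states\<close>

lemma wp_mat_mult:
  assumes A: "A (x N) \<in> carrier_mat D D"
  shows "mat D D (\<lambda>(a, c). wp D (coeffs_of A) x N a c) * A (x N)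
    = mat D D (\<lambda>(a, c). wp D (coeffs_of A) x (Suc N) a c)"
proof (rule eq_matI)
  let ?W = "mat D D (\<lambda>(a, c). wp D (coeffs_of A) x N a c)"
  fix i j assume "i < dim_row (mat D D (\<lambda>(a, c). wp D (coeffs_of A) x (Suc N) a c))"
    "j < dim_col (mat D D (\<lambda>(a, c). wp D (coeffs_of A) x (Suc N) a c))"
  then have ij: "i < D" "j < D" by simp_all
  have W: "?W \<in> carrier_mat D D" by simp
  show "(?W * A (x N)) $$ (i, j) = mat D D (\<lambda>(a, c). wp D (coeffs_of A) x (Suc N) a c) $$ (i, j)"
    unfolding mat_mult_entry[OF W A ij] using ij by (simp add: coeffs_of_def)
qed (use A in auto)

text \<open>Generalised to an accumulator \<open>Z\<close>, because \<open>foldr\<close> multiplies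
  the last letter into it first while \<open>wp\<close> appends letters on the right.\<close>

lemma foldr_mult_eq_wp:
  assumes A: "\<And>i. i < d \<Longrightarrow> A i \<in> carrier_mat D D"
    and x: "\<And>i. i < N \<Longrightarrow> x i < d" and Z: "Z \<in> carrier_mat D D"
  shows "foldr (\<lambda>M P. M * P) (map (\<lambda>i. A (x i)) [0..<N]) Z = mat D D (\<lambda>(a, c). wp D (coeffs_of A) x N a c) * Z"
  using x Z
proof (induction N arbitrary: Z)
  case 0
  have "mat D D (\<lambda>(a, c). wp D (coeffs_of A) x 0 a c) = 1\<^sub>m D"
    by (rule eq_matI) auto
  then show ?case
    using 0 by (simp del: wp.simps)
next
  case (Suc N)
  let ?W = "\<lambda>N. mat D D (\<lambda>(a, c). wp D (coeffs_of A) x N a c)"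
  have AN: "A (x N) \<in> carrier_mat D D"
    using A Suc.prems(1) by simp
  have "foldr (\<lambda>M P. M * P) (map (\<lambda>i. A (x i)) [0..<Suc N]) Z
      = foldr (\<lambda>M P. M * P) (map (\<lambda>i. A (x i)) [0..<N]) (A (x N) * Z)"
    by simp
  also have "\<dots> = ?W N * (A (x N) * Z)"
    using Suc.prems AN by (intro Suc.IH) auto
  also have "\<dots> = (?W N * A (x N)) * Z"
    by (rule assoc_mult_mat[symmetric, of _ D D _ D _ D]) (use AN Suc.prems in auto)
  finally show ?case
    unfolding wp_mat_mult[of A x N D, OF AN] .
qed

lemma mps_amp_eq:
  assumes A: "tensor d D A" and x: "x \<in> cfgs d N"
  shows "mps_amp D A N x = (\<Sum>a<D. wp D (coeffs_of A) x N a a)"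
proof -
  have "foldr (\<lambda>M P. M * P) (map (\<lambda>i. A (x i)) [0..<N]) (1\<^sub>m D)
      = mat D D (\<lambda>(a, c). wp D (coeffs_of A) x N a c) * 1\<^sub>m D"
    by (rule foldr_mult_eq_wp[where d = d]) (use A x in \<open>auto simp: tensor_def cfgs_def\<close>)
  also have "\<dots> = mat D D (\<lambda>(a, c). wp D (coeffs_of A) x N a c)"
    by (rule right_mult_one_mat[where nr = D]) simp
  finally show ?thesis
    unfolding mps_amp_def mat_trace_def by simp
qed

definition mtr :: "nat \<Rightarrow> complex mat \<Rightarrow> complex" where
  "mtr n M = (\<Sum>r<n. M $$ (r, r))"

lemma mtr_mult_commute:
  assumes "A \<in> carrier_mat n n" "B \<in> carrier_mat n n"
  shows "mtr n (A * B) = mtr n (B * A)"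
proof -
  have "mtr n (A * B) = (\<Sum>r<n. \<Sum>k<n. A $$ (r, k) * B $$ (k, r))"
    unfolding mtr_def by (intro sum.cong refl mat_mult_entry[OF assms]) auto
  also have "\<dots> = (\<Sum>k<n. \<Sum>r<n. A $$ (r, k) * B $$ (k, r))"
    by (rule sum.swap)
  also have "\<dots> = mtr n (B * A)"
    unfolding mtr_def
    by (intro sum.cong refl) (simp add: mat_mult_entry[OF assms(2,1)] mult.commute del: index_mult_mat)
  finally show ?thesis .
qed

definition site_op :: "nat set \<Rightarrow> (nat \<Rightarrow> nat) \<Rightarrow> (nat \<Rightarrow> nat) \<Rightarrow> nat \<Rightarrow> nat \<Rightarrow> nat \<Rightarrow> complex" where
  "site_op W i j s p q = (if s \<in> W then (if p = i s \<and> q = j s then 1 else 0) else kdelta p q)"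

lemma unit_op_eq_prod:
  assumes W: "W \<subseteq> {..<N}" and xy: "x \<in> cfgs d N" "y \<in> cfgs d N"
  shows "unit_op W i j x y = (\<Prod>s<N. site_op W i j s (x s) (y s))"
proof (cases "(\<forall>s\<in>W. x s = i s \<and> y s = j s) \<and> (\<forall>s. s \<notin> W \<longrightarrow> x s = y s)")
  case True
  then have "(\<Prod>s<N. site_op W i j s (x s) (y s)) = 1"
    by (intro prod.neutral) (auto simp: site_op_def kdelta_def)
  then show ?thesis
    using True by (simp add: unit_op_def)
next
  case False
  have "\<exists>s<N. site_op W i j s (x s) (y s) = 0"
  proof (cases "\<forall>s\<in>W. x s = i s \<and> y s = j s")
    case True
    then obtain s where s: "s \<notin> W" "x s \<noteq> y s"
      using False by blast
    then have "s < N"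
      using xy by (cases "s < N") (auto simp: cfgs_def)
    moreover have "site_op W i j s (x s) (y s) = 0"
      using s by (simp add: site_op_def kdelta_def)
    ultimately show ?thesis by blast
  next
    case False
    then obtain s where s: "s \<in> W" "\<not> (x s = i s \<and> y s = j s)"
      by blast
    then have "site_op W i j s (x s) (y s) = 0"
      by (simp add: site_op_def)
    then show ?thesis
      using s(1) W by blast
  qed
  then have "(\<Prod>s<N. site_op W i j s (x s) (y s)) = 0"
    by (auto intro: prod_zero)
  then show ?thesis
    using False by (auto simp: unit_op_def)
qed

text \<open>The traces of the bra and of the ket combine into one trace over the doubled bond space,
  in which each site contributes its transfer matrix with the one-site factor of the operator
  inserted.\<close>

lemma inner_mps_amp_unit_op:
  assumes A: "tensor d D A" and W: "W \<subseteq> {..<N}"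
  shows "inner d N (mps_amp D A N) (apply_op d N (unit_op W i j) (mps_amp D A N))
    = mtr (D * D) (prodm (D * D) (\<lambda>s. smat d D (coeffs_of A) (site_op W i j s)) N)"
proof -
  let ?w = "\<lambda>x a. wp D (coeffs_of A) x N a a"
  let ?p = "\<lambda>x y. \<Prod>s<N. site_op W i j s (x s) (y s)"
  have "inner d N (mps_amp D A N) (apply_op d N (unit_op W i j) (mps_amp D A N))
      = (\<Sum>x\<in>cfgs d N. \<Sum>y\<in>cfgs d N. cnj (\<Sum>a<D. ?w x a) * (?p x y * (\<Sum>b<D. ?w y b)))"
    unfolding inner_def apply_op_def sum_distrib_left
    by (intro sum.cong refl) (simp add: mps_amp_eq[OF A] unit_op_eq_prod[OF W] sum_distrib_left)
  also have "\<dots> = (\<Sum>x\<in>cfgs d N. \<Sum>y\<in>cfgs d N. \<Sum>a<D. \<Sum>b<D. ?p x y * (cnj (?w x a) * ?w y b))"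
  proof (intro sum.cong refl)
    fix x y
    have h: "cnj (\<Sum>a<D. ?w x a) * (?p x y * (\<Sum>b<D. ?w y b)) = ?p x y * ((\<Sum>a<D. cnj (?w x a)) * (\<Sum>b<D. ?w y b))"
      by (simp only: cnj_sum mult_ac)
    show "cnj (\<Sum>a<D. ?w x a) * (?p x y * (\<Sum>b<D. ?w y b)) = (\<Sum>a<D. \<Sum>b<D. ?p x y * (cnj (?w x a) * ?w y b))"
      unfolding h sum_product unfolding sum_distrib_left ..
  qed
  also have "\<dots> = (\<Sum>a<D. \<Sum>b<D. \<Sum>x\<in>cfgs d N. \<Sum>y\<in>cfgs d N. ?p x y * (cnj (?w x a) * ?w y b))"
    by (rule sum_swap_2_2)
  also have "\<dots> = mtr (D * D) (prodm (D * D) (\<lambda>s. smat d D (coeffs_of A) (site_op W i j s)) N)"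
    unfolding mtr_def sum_pair_index by (intro sum.cong refl prodm_smat_entry[symmetric]) auto
  finally show ?thesis .
qed

section \<open>Transfer matrices of stretches of the chain\<close>

lemma pow_mat_add:
  fixes A :: "complex mat"
  assumes "A \<in> carrier_mat n n"
  shows "A ^\<^sub>m (m + k) = A ^\<^sub>m m * A ^\<^sub>m k"
  using prodm_add[of "\<lambda>_. A" n m k] assms by (simp add: prodm_const)

lemma smat_site_op_notin: "s \<notin> W \<Longrightarrow> smat d D B (site_op W i j s) = tmat d D B"
  by (simp add: site_op_def[abs_def])

lemma prodm_window:
  assumes "W \<inter> {m..<m + g} = {}"
  shows "prodm (D * D) (\<lambda>s. smat d D B (site_op W i j s)) (m + g)
    = prodm (D * D) (\<lambda>s. smat d D B (site_op W i j s)) m * tmat d D B ^\<^sub>m g"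
proof -
  have "prodm (D * D) (\<lambda>s. smat d D B (site_op W i j (m + s))) g = prodm (D * D) (\<lambda>_. tmat d D B) g"
    by (rule prodm_cong, rule smat_site_op_notin) (use assms in auto)
  then show ?thesis
    using prodm_add[of "\<lambda>s. smat d D B (site_op W i j s)" "D * D" m g] by (simp add: prodm_const)
qed

text \<open>Sites are counted from the start of the stretch, so all translates of an operator share
  the same block.\<close>

definition block :: "nat \<Rightarrow> nat \<Rightarrow> (nat \<Rightarrow> nat \<Rightarrow> nat \<Rightarrow> complex) \<Rightarrow> nat set \<Rightarrow> (nat \<Rightarrow> nat) \<Rightarrow> (nat \<Rightarrow> nat) \<Rightarrow> nat \<Rightarrow> complex mat" where
  "block d D B W i j len = prodm (D * D) (\<lambda>t. smat d D B (site_op W i j t)) len"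

lemma block_carrier [simp]: "block d D B W i j len \<in> carrier_mat (D * D) (D * D)"
  by (simp add: block_def)

lemma prodm_block:
  assumes W: "\<And>t. t < len \<Longrightarrow> p + t \<in> W \<longleftrightarrow> t \<in> V"
    and ij: "\<And>t. t \<in> V \<Longrightarrow> t < len \<Longrightarrow> i (p + t) = i' t \<and> j (p + t) = j' t"
  shows "prodm (D * D) (\<lambda>s. smat d D B (site_op W i j s)) (p + len)
    = prodm (D * D) (\<lambda>s. smat d D B (site_op W i j s)) p * block d D B V i' j' len"
proof -
  have "prodm (D * D) (\<lambda>s. smat d D B (site_op W i j (p + s))) len = block d D B V i' j' len"
    unfolding block_def
  proof (rule prodm_cong)
    fix t assume t: "t < len"
    have "site_op W i j (p + t) = site_op V i' j' t"
      using W[OF t] ij[OF _ t] by (auto simp: site_op_def fun_eq_iff)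
    then show "smat d D B (site_op W i j (p + t)) = smat d D B (site_op V i' j' t)" by simp
  qed
  then show ?thesis
    using prodm_add[of "\<lambda>s. smat d D B (site_op W i j s)" "D * D" p len] by simp
qed

lemma prodm_site_op_prefix:
  assumes "W \<inter> {..<p} = {}"
  shows "prodm (D * D) (\<lambda>s. smat d D B (site_op W i j s)) p = tmat d D B ^\<^sub>m p"
  using prodm_window[where W = W and m = 0 and g = p and d = d and D = D and B = B and i = i and j = j] assms
  by (simp add: lessThan_atLeast0)

text \<open>Cyclicity of the trace merges the empty stretches before and after the block into one
  power. The result does not depend on \<open>p\<close>: translation invariance of the
  state.\<close>

lemma mtr_single_block:
  assumes W: "W = (\<lambda>t. p + t) ` V" and V: "V \<subseteq> {..<len}" and N: "p + len \<le> N"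
    and ij: "\<And>t. t \<in> V \<Longrightarrow> i (p + t) = i' t \<and> j (p + t) = j' t"
  shows "mtr (D * D) (prodm (D * D) (\<lambda>s. smat d D B (site_op W i j s)) N)
    = mtr (D * D) (block d D B V i' j' len * tmat d D B ^\<^sub>m (N - len))"
proof -
  let ?n = "D * D" and ?E = "tmat d D B" and ?P = "block d D B V i' j' len"
  let ?F = "prodm (D * D) (\<lambda>s. smat d D B (site_op W i j s))"
  note pc = pow_carrier_mat[OF smat_carrier[of d D B kdelta]]
  have "?F N = ?F (p + len) * ?E ^\<^sub>m (N - (p + len))"
    using prodm_window[where W = W and m = "p + len" and g = "N - (p + len)" and d = d and D = D and B = B and i = i and j = j] N V by (force simp: W)
  also have "?F (p + len) = ?F p * ?P"
    by (rule prodm_block) (use V ij in \<open>auto simp: W\<close>)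
  also have "?F p = ?E ^\<^sub>m p"
    by (rule prodm_site_op_prefix) (auto simp: W)
  finally have "?F N = ?E ^\<^sub>m p * ?P * ?E ^\<^sub>m (N - (p + len))" .
  also have "\<dots> = ?E ^\<^sub>m p * (?P * ?E ^\<^sub>m (N - (p + len)))"
    by (rule assoc_mult_mat[OF pc block_carrier pc])
  finally have "mtr ?n (?F N) = mtr ?n ((?P * ?E ^\<^sub>m (N - (p + len))) * ?E ^\<^sub>m p)"
    by (simp add: mtr_mult_commute[OF pc mult_carrier_mat[OF block_carrier pc]])
  also have "(?P * ?E ^\<^sub>m (N - (p + len))) * ?E ^\<^sub>m p = ?P * (?E ^\<^sub>m (N - (p + len)) * ?E ^\<^sub>m p)"
    by (rule assoc_mult_mat[OF block_carrier pc pc])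
  also have "?E ^\<^sub>m (N - (p + len)) * ?E ^\<^sub>m p = ?E ^\<^sub>m (N - len)"
    using N by (simp add: pow_mat_add[OF smat_carrier, symmetric])
  finally show ?thesis .
qed

lemma mtr_two_blocks:
  assumes W: "W = (\<lambda>t. p1 + t) ` V1 \<union> (\<lambda>t. p2 + t) ` V2"
    and V: "V1 \<subseteq> {..<len1}" "V2 \<subseteq> {..<len2}" and N: "p1 + len1 + g = p2" "p2 + len2 \<le> N"
    and ij1: "\<And>t. t \<in> V1 \<Longrightarrow> i (p1 + t) = i1 t \<and> j (p1 + t) = j1 t"
    and ij2: "\<And>t. t \<in> V2 \<Longrightarrow> i (p2 + t) = i2 t \<and> j (p2 + t) = j2 t"
  shows "mtr (D * D) (prodm (D * D) (\<lambda>s. smat d D B (site_op W i j s)) N)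
    = mtr (D * D) (block d D B V1 i1 j1 len1 * (tmat d D B ^\<^sub>m g *
        (block d D B V2 i2 j2 len2 * tmat d D B ^\<^sub>m (N - (len1 + g + len2)))))"
proof -
  let ?n = "D * D" and ?E = "tmat d D B"
  let ?P1 = "block d D B V1 i1 j1 len1" and ?P2 = "block d D B V2 i2 j2 len2"
  let ?F = "prodm (D * D) (\<lambda>s. smat d D B (site_op W i j s))"
  note pc = pow_carrier_mat[OF smat_carrier[of d D B kdelta]]
  let ?h = "N - (p2 + len2)"
  have "?F N = ?F (p2 + len2) * ?E ^\<^sub>m ?h"
    using prodm_window[where W = W and m = "p2 + len2" and g = ?h and d = d and D = D and B = B and i = i and j = j] N V by (force simp: W)
  also have "?F (p2 + len2) = ?F p2 * ?P2"
    by (rule prodm_block) (use V ij2 N(1) in \<open>auto simp: W\<close>)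
  also have "?F p2 = ?F (p1 + len1) * ?E ^\<^sub>m g"
    using prodm_window[where W = W and m = "p1 + len1" and g = g and d = d and D = D and B = B and i = i and j = j] N V by (force simp: W)
  also have "?F (p1 + len1) = ?F p1 * ?P1"
    by (rule prodm_block) (use V ij1 N(1) in \<open>auto simp: W\<close>)
  also have "?F p1 = ?E ^\<^sub>m p1"
    by (rule prodm_site_op_prefix) (use N(1) in \<open>auto simp: W\<close>)
  finally have "?F N = ?E ^\<^sub>m p1 * ?P1 * ?E ^\<^sub>m g * ?P2 * ?E ^\<^sub>m ?h" .
  also have "\<dots> = ?E ^\<^sub>m p1 * (?P1 * (?E ^\<^sub>m g * (?P2 * ?E ^\<^sub>m ?h)))"
    by (simp add: assoc_mult_mat[where n\<^sub>1 = ?n and n\<^sub>2 = ?n and n\<^sub>3 = ?n and n\<^sub>4 = ?n]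
        mult_carrier_mat[where nr = ?n and n = ?n and nc = ?n] pc)
  finally have "mtr ?n (?F N) = mtr ?n ((?P1 * (?E ^\<^sub>m g * (?P2 * ?E ^\<^sub>m ?h))) * ?E ^\<^sub>m p1)"
    by (simp add: mtr_mult_commute[OF pc mult_carrier_mat[OF block_carrier mult_carrier_mat[OF pc mult_carrier_mat[OF block_carrier pc]]]])
  also have "(?P1 * (?E ^\<^sub>m g * (?P2 * ?E ^\<^sub>m ?h))) * ?E ^\<^sub>m p1
      = ?P1 * (?E ^\<^sub>m g * (?P2 * (?E ^\<^sub>m ?h * ?E ^\<^sub>m p1)))"
    by (simp add: assoc_mult_mat[where n\<^sub>1 = ?n and n\<^sub>2 = ?n and n\<^sub>3 = ?n and n\<^sub>4 = ?n]
        mult_carrier_mat[where nr = ?n and n = ?n and nc = ?n] pc)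
  also have "?E ^\<^sub>m ?h * ?E ^\<^sub>m p1 = ?E ^\<^sub>m (N - (len1 + g + len2))"
    unfolding pow_mat_add[OF smat_carrier, symmetric] using N by (intro arg_cong[where f = "(^\<^sub>m) ?E"]) linarith
  finally show ?thesis .
qed

text \<open>Traces of products of two and of four matrices, written on entry functions so that
  powers of the transfer matrix can be replaced by their limit entry by entry and blocks expanded
  linearly.\<close>

definition tr2 :: "nat \<Rightarrow> (nat \<Rightarrow> nat \<Rightarrow> complex) \<Rightarrow> (nat \<Rightarrow> nat \<Rightarrow> complex) \<Rightarrow> complex" where
  "tr2 n b x = (\<Sum>r<n. \<Sum>s<n. b r s * x s r)"

definition tr4 :: "nat \<Rightarrow> (nat \<Rightarrow> nat \<Rightarrow> complex) \<Rightarrow> (nat \<Rightarrow> nat \<Rightarrow> complex) \<Rightarrow>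
    (nat \<Rightarrow> nat \<Rightarrow> complex) \<Rightarrow> (nat \<Rightarrow> nat \<Rightarrow> complex) \<Rightarrow> complex" where
  "tr4 n b1 x b2 y = (\<Sum>r<n. \<Sum>s<n. \<Sum>t<n. \<Sum>u<n. b1 r s * x s t * b2 t u * y u r)"

definition ent :: "complex mat \<Rightarrow> nat \<Rightarrow> nat \<Rightarrow> complex" where
  "ent M r s = M $$ (r, s)"

lemma mtr_mult_eq_tr2:
  assumes "A \<in> carrier_mat n n" "B \<in> carrier_mat n n"
  shows "mtr n (A * B) = tr2 n (ent A) (ent B)"
  unfolding mtr_def tr2_def ent_def by (intro sum.cong refl mat_mult_entry[OF assms]) auto

lemma mtr_mult_eq_tr4:
  assumes c: "A \<in> carrier_mat n n" "X \<in> carrier_mat n n" "B \<in> carrier_mat n n" "Y \<in> carrier_mat n n"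
  shows "mtr n (A * (X * (B * Y))) = tr4 n (ent A) (ent X) (ent B) (ent Y)"
proof -
  have "(A * (X * (B * Y))) $$ (r, r) = (\<Sum>s<n. \<Sum>t<n. \<Sum>u<n. ent A r s * ent X s t * ent B t u * ent Y u r)"
    if r: "r < n" for r
  proof -
    have "(A * (X * (B * Y))) $$ (r, r) = (\<Sum>s<n. A $$ (r, s) * (\<Sum>t<n. X $$ (s, t) * (\<Sum>u<n. B $$ (t, u) * Y $$ (u, r))))"
      using c r by (simp add: mat_mult_entry[where nr = n and n = n and nc = n] mult_carrier_mat[where nr = n and n = n and nc = n] del: index_mult_mat)
    then show ?thesis
      by (simp only: sum_distrib_left ent_def mult.assoc)
  qed
  then show ?thesis
    by (simp add: mtr_def tr4_def)
qed

section \<open>Decay and non-vanishing of correlations\<close>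

lemma norm_mult_diff_le:
  fixes a b c e :: complex
  assumes "cmod (a - c) \<le> \<eta>" "cmod (b - e) \<le> \<eta>" "cmod b \<le> K" "cmod c \<le> K" "0 \<le> \<eta>" "0 \<le> K"
  shows "cmod (a * b - c * e) \<le> 2 * K * \<eta>"
proof -
  have "a * b - c * e = (a - c) * b + c * (b - e)"
    by (simp add: algebra_simps)
  also have "cmod \<dots> \<le> cmod (a - c) * cmod b + cmod c * cmod (b - e)"
    by (rule order_trans[OF norm_triangle_ineq]) (simp add: norm_mult)
  also have "\<dots> \<le> \<eta> * K + K * \<eta>"
    using assms by (intro add_mono mult_mono) auto
  finally show ?thesis by simp
qed

lemma tr2_close:
  assumes b: "\<And>r s. r < n \<Longrightarrow> s < n \<Longrightarrow> cmod (b r s) \<le> \<beta>"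
    and x: "\<And>r s. r < n \<Longrightarrow> s < n \<Longrightarrow> cmod (x r s - x' r s) \<le> \<eta>" and \<beta>: "0 \<le> \<beta>"
  shows "cmod (tr2 n b x - tr2 n b x') \<le> (real n)\<^sup>2 * (\<beta> * \<eta>)"
proof -
  have "tr2 n b x - tr2 n b x' = (\<Sum>r<n. \<Sum>s<n. b r s * (x s r - x' s r))"
    by (simp add: tr2_def sum_subtractf right_diff_distrib)
  also have "cmod \<dots> \<le> (\<Sum>r<n. \<Sum>s<n. \<beta> * \<eta>)"
    using b x \<beta> by (intro sum_norm_le) (auto simp: norm_mult intro!: mult_mono)
  finally show ?thesis
    by (simp add: power2_eq_square mult.assoc)
qed

lemma tr2_bound:
  assumes b: "\<And>r s. r < n \<Longrightarrow> s < n \<Longrightarrow> cmod (b r s) \<le> \<beta>"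
    and x: "\<And>r s. r < n \<Longrightarrow> s < n \<Longrightarrow> cmod (x r s) \<le> K" and \<beta>: "0 \<le> \<beta>"
  shows "cmod (tr2 n b x) \<le> (real n)\<^sup>2 * (\<beta> * K)"
  using tr2_close[of n b \<beta> x "\<lambda>_ _. 0" K] assms by (simp add: tr2_def)

lemma tr4_close:
  assumes b1: "\<And>r s. r < n \<Longrightarrow> s < n \<Longrightarrow> cmod (b1 r s) \<le> \<beta>"
    and b2: "\<And>r s. r < n \<Longrightarrow> s < n \<Longrightarrow> cmod (b2 r s) \<le> \<beta>"
    and x: "\<And>r s. r < n \<Longrightarrow> s < n \<Longrightarrow> cmod (x r s - x' r s) \<le> \<eta>"
    and y: "\<And>r s. r < n \<Longrightarrow> s < n \<Longrightarrow> cmod (y r s - y' r s) \<le> \<eta>"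
    and K: "\<And>r s. r < n \<Longrightarrow> s < n \<Longrightarrow> cmod (y r s) \<le> K" "\<And>r s. r < n \<Longrightarrow> s < n \<Longrightarrow> cmod (x' r s) \<le> K"
    and nn: "0 \<le> \<beta>" "0 \<le> \<eta>" "0 \<le> K"
  shows "cmod (tr4 n b1 x b2 y - tr4 n b1 x' b2 y') \<le> (real n) ^ 4 * (\<beta> * \<beta> * (2 * K * \<eta>))"
proof -
  have "tr4 n b1 x b2 y - tr4 n b1 x' b2 y'
      = (\<Sum>r<n. \<Sum>s<n. \<Sum>t<n. \<Sum>u<n. b1 r s * b2 t u * (x s t * y u r - x' s t * y' u r))"
    unfolding tr4_def sum_subtractf[symmetric]
    by (intro sum.cong refl) (simp add: right_diff_distrib mult_ac)
  also have "cmod \<dots> \<le> (\<Sum>r<n. \<Sum>s<n. \<Sum>t<n. \<Sum>u<n. \<beta> * \<beta> * (2 * K * \<eta>))"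
  proof (intro sum_norm_le)
    fix r s t u assume "r \<in> {..<n}" "s \<in> {..<n}" "t \<in> {..<n}" "u \<in> {..<n}"
    then have "cmod (b1 r s) * cmod (b2 t u) * cmod (x s t * y u r - x' s t * y' u r) \<le> \<beta> * \<beta> * (2 * K * \<eta>)"
      using b1 b2 nn by (intro mult_mono norm_mult_diff_le x y K) auto
    then show "cmod (b1 r s * b2 t u * (x s t * y u r - x' s t * y' u r)) \<le> \<beta> * \<beta> * (2 * K * \<eta>)"
      by (simp add: norm_mult)
  qed
  also have "\<dots> = (real n) ^ 4 * (\<beta> * \<beta> * (2 * K * \<eta>))"
    by (simp add: numeral_eq_Suc mult.assoc)
  finally show ?thesis .
qed

lemma tr4_bound:
  assumes b1: "\<And>r s. r < n \<Longrightarrow> s < n \<Longrightarrow> cmod (b1 r s) \<le> \<beta>"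
    and b2: "\<And>r s. r < n \<Longrightarrow> s < n \<Longrightarrow> cmod (b2 r s) \<le> \<beta>"
    and x: "\<And>r s. r < n \<Longrightarrow> s < n \<Longrightarrow> cmod (x r s) \<le> K"
    and y: "\<And>r s. r < n \<Longrightarrow> s < n \<Longrightarrow> cmod (y r s) \<le> K"
    and nn: "0 \<le> \<beta>" "0 \<le> K"
  shows "cmod (tr4 n b1 x b2 y) \<le> ((real n)\<^sup>2 * (\<beta> * K))\<^sup>2"
proof -
  have "cmod (tr4 n b1 x b2 y) \<le> (\<Sum>r<n. \<Sum>s<n. \<Sum>t<n. \<Sum>u<n. \<beta> * K * \<beta> * K)"
    unfolding tr4_def using assms by (intro sum_norm_le) (auto simp: norm_mult intro!: mult_mono)
  also have "\<dots> = ((real n)\<^sup>2 * (\<beta> * K))\<^sup>2"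
    by (simp add: power2_eq_square mult_ac)
  finally show ?thesis .
qed

text \<open>A rank-one matrix on both connecting stretches cuts the ring into two independent
  traces: at infinite distance all covariances vanish.\<close>

lemma tr4_rank_one:
  assumes "\<And>r s. r < n \<Longrightarrow> s < n \<Longrightarrow> Q r s = \<rho> r * \<sigma> s"
  shows "tr4 n b1 Q b2 Q = tr2 n b1 Q * tr2 n b2 Q"
proof -
  have "tr2 n b1 Q * tr2 n b2 Q = (\<Sum>r<n. \<Sum>s<n. \<Sum>t<n. \<Sum>u<n. (b1 r s * Q s r) * (b2 t u * Q u t))"
    unfolding tr2_def sum_distrib_right unfolding sum_distrib_left ..
  also have "\<dots> = tr4 n b1 Q b2 Q"
    unfolding tr4_def by (intro sum.cong refl) (simp add: assms)
  finally show ?thesis ..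
qed

text \<open>\<open>Z\<close> is the squared norm of the unnormalised state, which tends to \<open>1\<close>.\<close>

lemma normalised_covariance_close:
  fixes Z t12 t1 t2 T \<tau>1 \<tau>2 :: complex
  assumes T: "cmod (t12 - T) \<le> \<eta>" "cmod T \<le> \<kappa>\<^sup>2"
    and t1: "cmod (t1 - \<tau>1) \<le> \<eta>" "cmod \<tau>1 \<le> \<kappa>" and t2: "cmod (t2 - \<tau>2) \<le> \<eta>" "cmod \<tau>2 \<le> \<kappa>"
    and Z: "cmod (Z - 1) \<le> \<eta>" and \<eta>: "\<eta> \<le> 1 / 2" and \<kappa>: "1 \<le> \<kappa>"
  shows "cmod ((t12 / Z - t1 / Z * (t2 / Z)) - (T - \<tau>1 * \<tau>2)) \<le> 20 * \<kappa>\<^sup>2 * \<eta>"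
proof -
  have \<eta>0: "0 \<le> \<eta>"
    using Z norm_ge_zero[of "Z - 1"] by linarith
  have Zge: "1 / 2 \<le> cmod Z"
    using norm_triangle_ineq2[of 1 "1 - Z"] Z \<eta> by (simp add: norm_minus_commute)
  then have Z0: "Z \<noteq> 0" by auto
  have ratio: "cmod (t / Z - \<tau>) \<le> 2 * \<eta> * (1 + k)" if "cmod (t - \<tau>) \<le> \<eta>" "cmod \<tau> \<le> k" for t \<tau> k
  proof -
    have k: "0 \<le> k"
      using that(2) norm_ge_zero order_trans by blast
    have "t / Z - \<tau> = ((t - \<tau>) + \<tau> * (1 - Z)) / Z"
      using Z0 by (simp add: field_simps)
    then have "cmod (t / Z - \<tau>) = cmod ((t - \<tau>) + \<tau> * (1 - Z)) / cmod Z"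
      by (simp add: norm_divide)
    also have "\<dots> \<le> (\<eta> + k * \<eta>) / (1 / 2)"
    proof (rule frac_le)
      have "cmod ((t - \<tau>) + \<tau> * (1 - Z)) \<le> cmod (t - \<tau>) + cmod \<tau> * cmod (1 - Z)"
        by (rule order_trans[OF norm_triangle_ineq]) (simp add: norm_mult)
      also have "\<dots> \<le> \<eta> + k * \<eta>"
        using that Z \<eta>0 k by (intro add_mono mult_mono) (auto simp: norm_minus_commute)
      finally show "cmod ((t - \<tau>) + \<tau> * (1 - Z)) \<le> \<eta> + k * \<eta>" .
    qed (use \<eta>0 k Zge in auto)
    finally show ?thesis
      by (simp add: algebra_simps)
  qed
  have k1: "1 \<le> \<kappa>\<^sup>2" "\<kappa> \<le> \<kappa>\<^sup>2"
    using \<kappa> mult_mono[of 1 \<kappa> 1 \<kappa>] by (simp_all add: power2_eq_square)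
  have A: "cmod (t12 / Z - T) \<le> 4 * \<kappa>\<^sup>2 * \<eta>"
  proof -
    have "cmod (t12 / Z - T) \<le> 2 * \<eta> * (1 + \<kappa>\<^sup>2)"
      by (rule ratio[OF T])
    also have "\<dots> \<le> 2 * \<eta> * (2 * \<kappa>\<^sup>2)"
      using k1 \<eta>0 by (intro mult_left_mono) auto
    finally show ?thesis by (simp add: mult_ac)
  qed
  have R: "cmod (t / Z - \<tau>) \<le> 4 * \<kappa> * \<eta>" if "cmod (t - \<tau>) \<le> \<eta>" "cmod \<tau> \<le> \<kappa>" for t \<tau>
  proof -
    have "cmod (t / Z - \<tau>) \<le> 2 * \<eta> * (1 + \<kappa>)"
      by (rule ratio[OF that])
    also have "\<dots> \<le> 2 * \<eta> * (2 * \<kappa>)"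
      using \<kappa> \<eta>0 by (intro mult_left_mono) auto
    finally show ?thesis by (simp add: mult_ac)
  qed
  have b2: "cmod (t2 / Z) \<le> 3 * \<kappa>"
  proof -
    have "4 * \<kappa> * \<eta> \<le> 4 * \<kappa> * (1 / 2)"
      using \<eta> \<kappa> by (intro mult_left_mono) auto
    then show ?thesis
      using R[OF t2] t2(2) norm_triangle_ineq2[of "t2 / Z" \<tau>2] by linarith
  qed
  \<comment> \<open>The first factor contributes 4 * 3 and the second one 4, so the product costs
    16; with the 4 from \<open>A\<close> this makes the 20 of the statement.\<close>
  have B: "cmod (t1 / Z * (t2 / Z) - \<tau>1 * \<tau>2) \<le> 16 * \<kappa>\<^sup>2 * \<eta>"
  proof -
    have "t1 / Z * (t2 / Z) - \<tau>1 * \<tau>2 = (t1 / Z - \<tau>1) * (t2 / Z) + \<tau>1 * (t2 / Z - \<tau>2)"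
      by (simp add: algebra_simps)
    also have "cmod \<dots> \<le> cmod (t1 / Z - \<tau>1) * cmod (t2 / Z) + cmod \<tau>1 * cmod (t2 / Z - \<tau>2)"
      by (rule order_trans[OF norm_triangle_ineq]) (simp only: norm_mult order_refl)
    also have "\<dots> \<le> (4 * \<kappa> * \<eta>) * (3 * \<kappa>) + \<kappa> * (4 * \<kappa> * \<eta>)"
      by (intro add_mono mult_mono R t1 t2 b2) (use \<kappa> \<eta>0 in auto)
    finally show ?thesis
      by (simp add: power2_eq_square algebra_simps)
  qed
  have "(t12 / Z - t1 / Z * (t2 / Z)) - (T - \<tau>1 * \<tau>2) = (t12 / Z - T) - (t1 / Z * (t2 / Z) - \<tau>1 * \<tau>2)"
    by simp
  also have "cmod \<dots> \<le> cmod (t12 / Z - T) + cmod (t1 / Z * (t2 / Z) - \<tau>1 * \<tau>2)"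
    by (rule norm_triangle_ineq4)
  finally show ?thesis
    using A B by linarith
qed

lemma tr4_sum_left:
  "tr4 n (\<lambda>r s. \<Sum>k\<in>J. c k * b k r s) x b2 y = (\<Sum>k\<in>J. c k * tr4 n (b k) x b2 y)"
proof -
  have "tr4 n (\<lambda>r s. \<Sum>k\<in>J. c k * b k r s) x b2 y
      = (\<Sum>r<n. \<Sum>s<n. \<Sum>k\<in>J. \<Sum>t<n. \<Sum>u<n. c k * (b k r s * x s t * b2 t u * y u r))"
    unfolding tr4_def
  proof (intro sum.cong refl)
    fix r s
    have "(\<Sum>t<n. \<Sum>u<n. (\<Sum>k\<in>J. c k * b k r s) * x s t * b2 t u * y u r)
        = (\<Sum>t<n. \<Sum>u<n. \<Sum>k\<in>J. c k * (b k r s * x s t * b2 t u * y u r))"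
      by (simp add: sum_distrib_right mult.assoc)
    also have "\<dots> = (\<Sum>t<n. \<Sum>k\<in>J. \<Sum>u<n. c k * (b k r s * x s t * b2 t u * y u r))"
      by (intro sum.cong refl sum.swap)
    also have "\<dots> = (\<Sum>k\<in>J. \<Sum>t<n. \<Sum>u<n. c k * (b k r s * x s t * b2 t u * y u r))"
      by (rule sum.swap)
    finally show "(\<Sum>t<n. \<Sum>u<n. (\<Sum>k\<in>J. c k * b k r s) * x s t * b2 t u * y u r)
        = (\<Sum>k\<in>J. \<Sum>t<n. \<Sum>u<n. c k * (b k r s * x s t * b2 t u * y u r))" .
  qed
  also have "\<dots> = (\<Sum>r<n. \<Sum>k\<in>J. \<Sum>s<n. \<Sum>t<n. \<Sum>u<n. c k * (b k r s * x s t * b2 t u * y u r))"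
    by (intro sum.cong refl sum.swap)
  also have "\<dots> = (\<Sum>k\<in>J. \<Sum>r<n. \<Sum>s<n. \<Sum>t<n. \<Sum>u<n. c k * (b k r s * x s t * b2 t u * y u r))"
    by (rule sum.swap)
  finally show ?thesis
    by (simp add: tr4_def sum_distrib_left)
qed

lemma tr4_cyclic: "tr4 n b1 x b2 y = tr4 n b2 y b1 x"
proof -
  have "tr4 n b1 x b2 y = (\<Sum>t<n. \<Sum>u<n. \<Sum>r<n. \<Sum>s<n. b1 r s * x s t * b2 t u * y u r)"
    unfolding tr4_def by (rule sum_swap_2_2)
  then show ?thesis
    by (simp add: tr4_def mult_ac)
qed

lemma tr4_sum_right:
  "tr4 n b1 x (\<lambda>r s. \<Sum>k\<in>J. c k * b k r s) y = (\<Sum>k\<in>J. c k * tr4 n b1 x (b k) y)"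
  unfolding tr4_cyclic[of n b1 x] by (rule tr4_sum_left)

lemma tr4_cong:
  assumes "\<And>r s. r < n \<Longrightarrow> s < n \<Longrightarrow> b1 r s = b1' r s" "\<And>r s. r < n \<Longrightarrow> s < n \<Longrightarrow> b2 r s = b2' r s"
    "\<And>r s. r < n \<Longrightarrow> s < n \<Longrightarrow> x r s = x' r s" "\<And>r s. r < n \<Longrightarrow> s < n \<Longrightarrow> y r s = y' r s"
  shows "tr4 n b1 x b2 y = tr4 n b1' x' b2' y'"
  unfolding tr4_def by (intro sum.cong refl) (simp add: assms)

lemma tr4_diff: "tr4 n b1 (\<lambda>r s. x r s - x' r s) b2 y = tr4 n b1 x b2 y - tr4 n b1 x' b2 y"
  unfolding tr4_def sum_subtractf[symmetric] by (intro sum.cong refl) (simp add: algebra_simps)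

text \<open>Matrix units in the places of the blocks isolate a single entry of \<open>f\<close>, up
  to an entry of \<open>y\<close> that closes the ring.\<close>

lemma tr4_units:
  assumes "r < n" "s < n" "r0 < n" "s0 < n"
  shows "tr4 n (\<lambda>a b. if a = s0 \<and> b = r then 1 else 0) f (\<lambda>a b. if a = s \<and> b = r0 then 1 else 0) y = f r s * y r0 s0"
proof -
  have "tr4 n (\<lambda>a b. if a = s0 \<and> b = r then 1 else 0) f (\<lambda>a b. if a = s \<and> b = r0 then 1 else 0) y
      = (\<Sum>a<n. \<Sum>b<n. \<Sum>c<n. \<Sum>e<n. if a = s0 then if b = r then if c = s then if e = r0 then f r s * y r0 s0
          else 0 else 0 else 0 else 0)"
    unfolding tr4_def by (intro sum.cong refl) auto
  also have "\<dots> = f r s * y r0 s0"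
  proof -
    have "(\<Sum>e<n. if a = s0 then if b = r then if c = s then if e = r0 then f r s * y r0 s0
          else 0 else 0 else 0 else 0) = (if a = s0 then if b = r then if c = s then f r s * y r0 s0
          else 0 else 0 else 0)" for a b c
      using assms by auto
    moreover have "(\<Sum>c<n. if a = s0 then if b = r then if c = s then f r s * y r0 s0
          else 0 else 0 else 0) = (if a = s0 then if b = r then f r s * y r0 s0 else 0 else 0)" for a b
      using assms by auto
    moreover have "(\<Sum>b<n. if a = s0 then if b = r then f r s * y r0 s0 else 0 else 0)
        = (if a = s0 then f r s * y r0 s0 else 0)" for a
      using assms by auto
    ultimately show ?thesis
      using assms by simp
  qed
  finally show ?thesis .
qed

lemma cfgs_eqI:
  assumes "x \<in> cfgs d m" "y \<in> cfgs d m" "\<And>s. s < m \<Longrightarrow> x s = y s"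
  shows "x = y"
proof
  fix s show "x s = y s"
    using assms by (cases "s < m") (auto simp: cfgs_def)
qed

text \<open>An operator that fills the whole stretch leaves no sum over configurations, so the block
  is the Kronecker product of a conjugated word and a word. If words span all matrices, blocks
  therefore span all matrices on the doubled space.\<close>

lemma block_entry:
  assumes "a < D" "b < D" "c < D" "e < D" and i: "i \<in> cfgs d m" and j: "j \<in> cfgs d m"
  shows "block d D B {..<m} i j m $$ (a * D + b, c * D + e) = cnj (wp D B i m a c) * wp D B j m b e"
proof -
  have P: "(\<Prod>s<m. site_op {..<m} i j s (x s) (y s)) = (if x = i then if y = j then 1 else 0 else 0)"
    if "x \<in> cfgs d m" "y \<in> cfgs d m" for x y
  proof -
    have "unit_op {..<m} i j x y = (if x = i then if y = j then 1 else 0 else 0)"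
    proof -
      have "(\<forall>s\<in>{..<m}. x s = i s \<and> y s = j s) \<and> (\<forall>s. s \<notin> {..<m} \<longrightarrow> x s = y s) \<longleftrightarrow> x = i \<and> y = j"
      proof
        assume "(\<forall>s\<in>{..<m}. x s = i s \<and> y s = j s) \<and> (\<forall>s. s \<notin> {..<m} \<longrightarrow> x s = y s)"
        then show "x = i \<and> y = j"
          using cfgs_eqI[OF that(1) i] cfgs_eqI[OF that(2) j] by simp
      next
        assume "x = i \<and> y = j"
        then show "(\<forall>s\<in>{..<m}. x s = i s \<and> y s = j s) \<and> (\<forall>s. s \<notin> {..<m} \<longrightarrow> x s = y s)"
          using i j by (simp add: cfgs_def)
      qed
      then show ?thesis
        by (simp add: unit_op_def)
    qed
    then show ?thesis
      using unit_op_eq_prod[of "{..<m}" m x d y i j] that by simp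
  qed
  have "block d D B {..<m} i j m $$ (a * D + b, c * D + e)
      = (\<Sum>x\<in>cfgs d m. \<Sum>y\<in>cfgs d m. if x = i then if y = j then cnj (wp D B x m a c) * wp D B y m b e else 0 else 0)"
    unfolding block_def prodm_smat_entry[OF assms(1-4)] by (intro sum.cong refl) (simp add: P)
  also have "\<dots> = (\<Sum>x\<in>cfgs d m. if x = i then cnj (wp D B x m a c) * wp D B j m b e else 0)"
    using j by (intro sum.cong refl) auto
  also have "\<dots> = cnj (wp D B i m a c) * wp D B j m b e"
    using i by simp
  finally show ?thesis .
qed

section \<open>Words, eigenvectors and non-vanishing covariances\<close>

locale mps_limit =
  fixes d D :: nat and B :: "nat \<Rightarrow> nat \<Rightarrow> nat \<Rightarrow> complex" and R L :: "nat \<Rightarrow> nat \<Rightarrow> complex" and C q :: real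
  assumes D: "0 < D" and ndR: "nondegenerate D R" and ndL: "nondegenerate D L"
    and LR: "(\<Sum>a<D. \<Sum>b<D. L a b * R a b) = 1"
    and fixL: "fixed_by d D (transposed B) L"
    and C: "0 \<le> C" and q: "0 < q" "q < 1"
    and decay: "\<And>m a b c e. a < D \<Longrightarrow> b < D \<Longrightarrow> c < D \<Longrightarrow> e < D \<Longrightarrow>
      cmod ((tmat d D B ^\<^sub>m Suc m) $$ (a * D + b, c * D + e) - R a b * L c e) \<le> C * q ^ Suc m"
begin

abbreviation n :: nat where "n \<equiv> D * D"
abbreviation E :: "complex mat" where "E \<equiv> tmat d D B"

definition \<rho> :: "nat \<Rightarrow> complex" where "\<rho> r = R (r div D) (r mod D)"
definition \<sigma> :: "nat \<Rightarrow> complex" where "\<sigma> r = L (r div D) (r mod D)"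
definition Q :: "nat \<Rightarrow> nat \<Rightarrow> complex" where "Q r s = \<rho> r * \<sigma> s"

lemma \<sigma>\<rho>: "(\<Sum>r<n. \<sigma> r * \<rho> r) = 1"
  unfolding sum_pair_index using LR by (simp add: \<sigma>_def \<rho>_def)

lemma \<sigma>E:
  assumes r: "r < n"
  shows "(\<Sum>s<n. \<sigma> s * E $$ (s, r)) = \<sigma> r"
proof -
  obtain a b where ab: "a < D" "b < D" "r = a * D + b"
    using index_decompose[OF r] .
  have "(\<Sum>s<n. \<sigma> s * E $$ (s, r)) = tmap d D (transposed B) L a b"
    unfolding sum_pair_index tmap_def
    by (intro sum.cong refl) (simp add: ab tmat_entry \<sigma>_def transposed_def)
  then show ?thesis
    using fixL ab by (simp add: fixed_by_def \<sigma>_def)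
qed

lemma E_pow_close:
  assumes "1 \<le> m" "r < n" "s < n"
  shows "cmod (ent (E ^\<^sub>m m) r s - Q r s) \<le> C * q ^ m"
proof -
  obtain a b where ab: "a < D" "b < D" "r = a * D + b"
    using index_decompose[OF assms(2)] .
  obtain c e where ce: "c < D" "e < D" "s = c * D + e"
    using index_decompose[OF assms(3)] .
  obtain m' where m': "m = Suc m'"
    using assms(1) by (cases m) auto
  show ?thesis
    using decay[OF ab(1,2) ce(1,2), of m'] ab ce unfolding m' by (simp add: ent_def Q_def \<rho>_def \<sigma>_def del: power_Suc pow_mat.simps)
qed

text \<open>One bound for the entries of \<open>Q\<close> and of all powers of \<open>E\<close>: the
  summand 1 covers exponent 0, the other two the powers within \<open>C\<close> of
  \<open>Q\<close>.\<close>

definition Kb :: real where "Kb = 1 + C + (\<Sum>r<n. \<Sum>s<n. cmod (Q r s))"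

lemma Kb_ge1: "1 \<le> Kb"
  unfolding Kb_def using C by (simp add: sum_nonneg)

lemma Q_bound:
  assumes "r < n" "s < n"
  shows "cmod (Q r s) + C \<le> Kb"
proof -
  have "cmod (Q r s) \<le> (\<Sum>s<n. cmod (Q r s))"
    by (rule member_le_sum) (use assms in auto)
  also have "\<dots> \<le> (\<Sum>r<n. \<Sum>s<n. cmod (Q r s))"
    by (rule member_le_sum[where f = "\<lambda>r. \<Sum>s<n. cmod (Q r s)"]) (use assms in \<open>auto intro: sum_nonneg\<close>)
  finally show ?thesis
    by (simp add: Kb_def)
qed

lemma E_pow_bound:
  assumes "r < n" "s < n"
  shows "cmod (ent (E ^\<^sub>m m) r s) \<le> Kb"
proof (cases "m = 0")
  case True
  then have "cmod (ent (E ^\<^sub>m m) r s) \<le> 1"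
    using assms by (simp add: ent_def)
  then show ?thesis
    using Kb_ge1 by linarith
next
  case False
  have "C * q ^ m \<le> C * 1"
    using C q by (intro mult_left_mono power_le_one) auto
  then show ?thesis
    using E_pow_close[of m r s] False assms Q_bound[OF assms]
      norm_triangle_ineq2[of "ent (E ^\<^sub>m m) r s" "Q r s"] by simp
qed

end

context mps_limit
begin

lemma E_pow_tendsto:
  assumes "r < n" "s < n"
  shows "(\<lambda>m. (E ^\<^sub>m Suc m) $$ (r, s)) \<longlonglongrightarrow> Q r s"
proof -
  have "(\<lambda>m. q ^ Suc m) \<longlonglongrightarrow> 0"
    using q by (intro LIMSEQ_Suc LIMSEQ_realpow_zero) auto
  then have "(\<lambda>m. (E ^\<^sub>m Suc m) $$ (r, s) - Q r s) \<longlonglongrightarrow> 0"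
  proof (rule tendsto_0_le, intro always_eventually allI)
    fix m
    show "norm ((E ^\<^sub>m Suc m) $$ (r, s) - Q r s) \<le> norm (q ^ Suc m) * C"
      using E_pow_close[of "Suc m" r s] assms q
      by (simp add: ent_def mult.commute abs_of_nonneg del: power_Suc pow_mat.simps)
  qed
  then show ?thesis
    by (simp only: LIM_zero_iff)
qed

text \<open>The Gram matrix of the words of length \<open>m\<close> is a reshuffling of \<open>E ^ m\<close>, so it converges to
  \<open>R \<otimes> L\<close>, which is invertible; hence long words span all matrices.\<close>

lemma words_span:
  "\<exists>b\<ge>1. \<exists>coef. \<forall>p<D. \<forall>p'<D. \<forall>a<D. \<forall>c<D.
    (\<Sum>x\<in>cfgs d b. coef p p' x * wp D B x b a c) = (if a = p \<and> c = p' then 1 else 0)"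
proof -
  define H where "H m = mat n n (\<lambda>(r, s). \<Sum>x\<in>cfgs d m.
      cnj (wp D B x m (s div D) (s mod D)) * wp D B x m (r div D) (r mod D))" for m
  define H' where "H' = mat n n (\<lambda>(r, s). R (s div D) (r div D) * L (s mod D) (r mod D))"
  have Hc: "H m \<in> carrier_mat n n" for m
    by (simp add: H_def)
  have Hc': "H' \<in> carrier_mat n n"
    by (simp add: H'_def)
  have lim: "(\<lambda>m. H (Suc m) $$ (r, s)) \<longlonglongrightarrow> H' $$ (r, s)" if rs: "r < n" "s < n" for r s
  proof -
    obtain a c where ac: "a < D" "c < D" "r = a * D + c"
      using index_decompose[OF rs(1)] .
    obtain a' c' where ac': "a' < D" "c' < D" "s = a' * D + c'"
      using index_decompose[OF rs(2)] .
    have "H m $$ (r, s) = (E ^\<^sub>m m) $$ (a' * D + a, c' * D + c)" for m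
      unfolding tmat_pow_entry[OF ac'(1) ac(1) ac'(2) ac(2)] using ac ac' rs by (simp add: H_def)
    moreover have "H' $$ (r, s) = Q (a' * D + a) (c' * D + c)"
      using ac ac' rs by (simp add: H'_def Q_def \<rho>_def \<sigma>_def)
    ultimately show ?thesis
      using E_pow_tendsto[of "a' * D + a" "c' * D + c"] ac ac' by (simp add: pair_index_less del: pow_mat.simps)
  qed
  \<comment> \<open>The two tensor factors are removed one after the other: nondegeneracy of
    \<open>R\<close> acts on the first index of \<open>v\<close>, then that of \<open>L\<close> on
    the second.\<close>
  have "det H' \<noteq> 0"
  proof
    assume "det H' = 0"
    then obtain v where v: "v \<in> carrier_vec n" "v \<noteq> 0\<^sub>v n" "H' *\<^sub>v v = 0\<^sub>v n"
      using det_0_iff_vec_prod_zero_field[OF Hc'] by blast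
    have eq: "(\<Sum>a'<D. R a' a * (\<Sum>c'<D. L c' c * v $ (a' * D + c'))) = 0" if ac: "a < D" "c < D" for a c
    proof -
      have "0 = (H' *\<^sub>v v) $ (a * D + c)"
        using v(3) ac by (simp add: pair_index_less)
      also have "\<dots> = (\<Sum>s<n. H' $$ (a * D + c, s) * v $ s)"
        by (rule mat_vec_entry[OF Hc' v(1)]) (use ac in \<open>simp add: pair_index_less\<close>)
      also have "\<dots> = (\<Sum>a'<D. \<Sum>c'<D. R a' a * (L c' c * v $ (a' * D + c')))"
        unfolding sum_pair_index using ac by (intro sum.cong refl) (simp add: H'_def pair_index_less)
      finally show ?thesis
        by (simp only: sum_distrib_left)
    qed
    have "v $ s = 0" if s: "s < n" for s
    proof -
      obtain a' c' where ac': "a' < D" "c' < D" "s = a' * D + c'"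
        using index_decompose[OF s] .
      have "(\<Sum>c'<D. L c' c * v $ (a' * D + c')) = 0" if c: "c < D" for c
      proof -
        have "\<forall>a<D. mapply D R (\<lambda>a'. \<Sum>c'<D. L c' c * v $ (a' * D + c')) a = 0"
          unfolding mapply_def using eq c by simp
        then show ?thesis
          using ndR ac'(1) unfolding nondegenerate_def by blast
      qed
      then have "\<forall>c<D. mapply D L (\<lambda>c'. v $ (a' * D + c')) c = 0"
        unfolding mapply_def by simp
      then have "\<forall>c'<D. v $ (a' * D + c') = 0"
        using ndL unfolding nondegenerate_def by blast
      then show ?thesis
        using ac' by simp
    qed
    then have "v = 0\<^sub>v n"
      using v(1) by (intro eq_vecI) auto
    then show False
      using v(2) by simp
  qed
  \<comment> \<open>The determinant is a polynomial in the entries, so it converges and is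
    eventually nonzero; any such length serves as \<open>b\<close>.\<close>
  moreover have "(\<lambda>m. det (H (Suc m))) \<longlonglongrightarrow> det H'"
    unfolding det_def'[OF Hc] det_def'[OF Hc']
  proof (intro tendsto_sum tendsto_mult tendsto_const tendsto_prod)
    fix p i assume "p \<in> {p. p permutes {0..<n}}" "i \<in> {0..<n}"
    then show "(\<lambda>m. H (Suc m) $$ (i, p i)) \<longlonglongrightarrow> H' $$ (i, p i)"
      using permutes_in_image[of p "{0..<n}" i] by (intro lim) auto
  qed
  ultimately have "\<forall>\<^sub>F m in sequentially. det (H (Suc m)) \<noteq> 0"
    by (intro tendsto_imp_eventually_ne)
  then obtain m where m: "det (H (Suc m)) \<noteq> 0"
    by (auto simp: eventually_sequentially)
  define b where "b = Suc m"
  obtain G where G: "G \<in> carrier_mat n n" "H b * G = 1\<^sub>m n"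
    using det_non_zero_imp_unit[OF Hc m, of "()"] unfolding b_def Units_def ring_mat_def by auto
  \<comment> \<open>Columns of the inverse Gram matrix, applied to the conjugated words, form the
    dual family.\<close>
  define coef where "coef p p' x = (\<Sum>s<n. cnj (wp D B x b (s div D) (s mod D)) * G $$ (s, p * D + p'))" for p p' x
  have "(\<Sum>x\<in>cfgs d b. coef p p' x * wp D B x b a c) = (if a = p \<and> c = p' then 1 else 0)"
    if pac: "p < D" "p' < D" "a < D" "c < D" for p p' a c
  proof -
    have "(\<Sum>x\<in>cfgs d b. coef p p' x * wp D B x b a c) = (\<Sum>s<n. \<Sum>x\<in>cfgs d b.
        cnj (wp D B x b (s div D) (s mod D)) * wp D B x b a c * G $$ (s, p * D + p'))"
      unfolding coef_def sum_distrib_right by (subst sum.swap) (simp add: mult_ac)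
    also have "\<dots> = (\<Sum>s<n. H b $$ (a * D + c, s) * G $$ (s, p * D + p'))"
      using pac by (intro sum.cong refl) (simp add: H_def pair_index_less sum_distrib_right)
    also have "\<dots> = (H b * G) $$ (a * D + c, p * D + p')"
      by (rule mat_mult_entry[OF Hc G(1), symmetric]) (use pac in \<open>simp_all add: pair_index_less\<close>)
    also have "\<dots> = (if a * D + c = p * D + p' then 1 else 0)"
      unfolding G(2) using pac by (simp add: pair_index_less)
    also have "a * D + c = p * D + p' \<longleftrightarrow> a = p \<and> c = p'"
    proof
      assume "a * D + c = p * D + p'"
      then have "(a * D + c) div D = (p * D + p') div D" "(a * D + c) mod D = (p * D + p') mod D"
        by simp_all
      then show "a = p \<and> c = p'"
        using pac by simp
    qed simp
    finally show ?thesis .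
  qed
  then show ?thesis
    by (intro exI[of _ b] conjI exI[of _ coef]) (auto simp: b_def)
qed

text \<open>The left fixed vector \<sigma> is orthogonal to an eigenvector \<open>v\<close> for
  \<mu> \<noteq> 1, so \<open>Q\<close> annihilates \<open>v\<close> and the m-th power of
  \<open>E\<close> minus \<open>Q\<close> multiplies it by \<mu>^m. In the row of a largest
  coordinate of \<open>v\<close>, some entry must then reach the fraction 1/n of |\<mu>|^m.\<close>

lemma E_pow_entry_large:
  assumes ev: "eigenvalue E \<mu>" "\<mu> \<noteq> 1"
  shows "\<exists>r<n. \<exists>s<n. cmod \<mu> ^ m \<le> real n * cmod (ent (E ^\<^sub>m m) r s - Q r s)"
proof -
  obtain v where v: "v \<in> carrier_vec n" "v \<noteq> 0\<^sub>v n" "E *\<^sub>v v = \<mu> \<cdot>\<^sub>v v"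
    using ev(1) smat_carrier[of d D B kdelta] unfolding eigenvalue_def eigenvector_def by auto
  have \<sigma>v: "(\<Sum>s<n. \<sigma> s * v $ s) = 0"
  proof -
    have "\<mu> * (\<Sum>s<n. \<sigma> s * v $ s) = (\<Sum>s<n. \<sigma> s * (E *\<^sub>v v) $ s)"
      unfolding v(3) sum_distrib_left using v(1) by (intro sum.cong refl) simp
    also have "\<dots> = (\<Sum>s<n. \<Sum>t<n. \<sigma> s * E $$ (s, t) * v $ t)"
      by (intro sum.cong refl) (simp add: mat_vec_entry[OF smat_carrier v(1)] sum_distrib_left mult.assoc del: index_mult_mat_vec)
    also have "\<dots> = (\<Sum>t<n. \<Sum>s<n. \<sigma> s * E $$ (s, t) * v $ t)"
      by (rule sum.swap)
    also have "\<dots> = (\<Sum>t<n. \<sigma> t * v $ t)"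
      unfolding sum_distrib_right[symmetric] by (intro sum.cong refl) (simp add: \<sigma>E)
    finally show ?thesis
      using ev(2) by simp
  qed
  define M where "M = Max ((\<lambda>s. cmod (v $ s)) ` {..<n})"
  have n0: "{..<n} \<noteq> {}"
    using D by (simp add: lessThan_empty_iff)
  have M: "cmod (v $ s) \<le> M" if "s < n" for s
    unfolding M_def using that by (intro Max_ge) auto
  obtain r where r: "r < n" "cmod (v $ r) = M"
  proof -
    have "M \<in> (\<lambda>s. cmod (v $ s)) ` {..<n}"
      unfolding M_def using n0 by (intro Max_in) auto
    then show ?thesis using that by auto
  qed
  have M0: "0 < M"
  proof (rule ccontr)
    assume "\<not> 0 < M"
    then have "v $ s = 0" if "s < n" for s
      using M[OF that] by (metis norm_le_zero_iff not_less order_trans)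
    then have "v = 0\<^sub>v n"
      using v(1) by (intro eq_vecI) auto
    then show False using v(2) by simp
  qed
  show ?thesis
  proof (rule ccontr)
    assume neg: "\<not> ?thesis"
    have small: "real n * cmod (ent (E ^\<^sub>m m) r s - Q r s) < cmod \<mu> ^ m" if "s < n" for s
      using neg r(1) that by (meson not_le)
    have "\<mu> ^ m * v $ r = (E ^\<^sub>m m *\<^sub>v v) $ r"
      unfolding pow_mat_eigenvector[OF smat_carrier v(1,3)] using v(1) r(1) by simp
    also have "\<dots> = (\<Sum>s<n. (E ^\<^sub>m m) $$ (r, s) * v $ s)"
      by (rule mat_vec_entry[OF pow_carrier_mat[OF smat_carrier] v(1) r(1)])
    also have "\<dots> = (\<Sum>s<n. (ent (E ^\<^sub>m m) r s - Q r s) * v $ s) + \<rho> r * (\<Sum>s<n. \<sigma> s * v $ s)"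
      unfolding sum_distrib_left sum.distrib[symmetric]
      by (intro sum.cong refl) (simp add: ent_def Q_def algebra_simps)
    finally have "\<mu> ^ m * v $ r = (\<Sum>s<n. (ent (E ^\<^sub>m m) r s - Q r s) * v $ s)"
      using \<sigma>v by simp
    then have "cmod \<mu> ^ m * M = cmod (\<Sum>s<n. (ent (E ^\<^sub>m m) r s - Q r s) * v $ s)"
      using r(2) by (metis norm_mult norm_power)
    also have "\<dots> \<le> (\<Sum>s<n. cmod (ent (E ^\<^sub>m m) r s - Q r s) * M)"
      by (intro sum_norm_le) (auto simp: norm_mult intro!: mult_left_mono M)
    also have "\<dots> = (\<Sum>s<n. cmod (ent (E ^\<^sub>m m) r s - Q r s)) * M"
      by (simp add: sum_distrib_right)
    finally have le: "cmod \<mu> ^ m \<le> (\<Sum>s<n. cmod (ent (E ^\<^sub>m m) r s - Q r s))"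
      using M0 by simp
    have "real n * (\<Sum>s<n. cmod (ent (E ^\<^sub>m m) r s - Q r s)) < (\<Sum>s<n. cmod \<mu> ^ m)"
      unfolding sum_distrib_left by (rule sum_strict_mono) (use small n0 in auto)
    also have "\<dots> = real n * cmod \<mu> ^ m"
      by simp
    finally show False
      using le D by (simp add: mult_less_cancel_left)
  qed
qed

text \<open>Matrix units on the doubled space are combinations of blocks, hence the large entry of
  \<open>E_pow_entry_large\<close> is a combination of covariances and one of these is comparably
  large. \<open>K\<close> depends on the coefficients and on one entry of \<open>Q\<close>, but not
  on \<mu> or \<open>m\<close>.\<close>

lemma correlations_bounded_below:
  assumes b: "\<And>p p' a c. p < D \<Longrightarrow> p' < D \<Longrightarrow> a < D \<Longrightarrow> c < D \<Longrightarrow>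
      (\<Sum>x\<in>cfgs d b. coef p p' x * wp D B x b a c) = (if a = p \<and> c = p' then 1 else 0)"
  shows "\<exists>K>0. \<forall>\<mu> m. eigenvalue E \<mu> \<longrightarrow> \<mu> \<noteq> 1 \<longrightarrow> (\<exists>i\<in>cfgs d b. \<exists>j\<in>cfgs d b. \<exists>i'\<in>cfgs d b. \<exists>j'\<in>cfgs d b.
    cmod \<mu> ^ m \<le> K * cmod (tr4 n (ent (block d D B {..<b} i j b)) (\<lambda>r s. ent (E ^\<^sub>m m) r s - Q r s)
      (ent (block d D B {..<b} i' j' b)) Q))"
proof -
  let ?W = "cfgs d b \<times> cfgs d b"
  let ?bl = "\<lambda>w. ent (block d D B {..<b} (fst w) (snd w) b)"
  \<comment> \<open>Blocks are Kronecker products, so their coefficients multiply, with a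
    conjugation on the bra side.\<close>
  define cf where "cf r s w = cnj (coef (r div D) (s div D) (fst w)) * coef (r mod D) (s mod D) (snd w)" for r s w
  have unit: "(\<Sum>w\<in>?W. cf r s w * ?bl w x y) = (if x = r \<and> y = s then 1 else 0)"
    if rs: "r < n" "s < n" and xy: "x < n" "y < n" for r s x y
  proof -
    obtain p p' where p: "p < D" "p' < D" "r = p * D + p'" using index_decompose[OF rs(1)] .
    obtain t t' where t: "t < D" "t' < D" "s = t * D + t'" using index_decompose[OF rs(2)] .
    obtain a a' where a: "a < D" "a' < D" "x = a * D + a'" using index_decompose[OF xy(1)] .
    obtain c c' where c: "c < D" "c' < D" "y = c * D + c'" using index_decompose[OF xy(2)] .
    have "(\<Sum>w\<in>?W. cf r s w * ?bl w x y) = (\<Sum>i\<in>cfgs d b. \<Sum>j\<in>cfgs d b.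
        (cnj (coef p t i) * coef p' t' j) * (cnj (wp D B i b a c) * wp D B j b a' c'))"
      unfolding sum_pair[symmetric, of "\<lambda>i j. cf r s (i, j) * ?bl (i, j) x y", simplified]
      using p t a c by (intro sum.cong refl) (simp add: cf_def ent_def block_entry)
    also have "\<dots> = cnj (\<Sum>i\<in>cfgs d b. coef p t i * wp D B i b a c) * (\<Sum>j\<in>cfgs d b. coef p' t' j * wp D B j b a' c')"
      unfolding cnj_sum sum_product by (simp add: mult_ac)
    also have "\<dots> = (if (a = p \<and> c = t) \<and> (a' = p' \<and> c' = t') then 1 else 0)"
      using b p t a c by simp
    also have "(a = p \<and> c = t) \<and> (a' = p' \<and> c' = t') \<longleftrightarrow> x = r \<and> y = s"
    proof
      assume "x = r \<and> y = s"
      then have "x div D = r div D" "x mod D = r mod D" "y div D = s div D" "y mod D = s mod D"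
        by simp_all
      then show "(a = p \<and> c = t) \<and> (a' = p' \<and> c' = t')"
        using p t a c by simp
    qed (use p t a c in simp)
    finally show ?thesis .
  qed
  \<comment> \<open>Closes the ring through the second connection \<open>Q\<close>; a nonzero
    diagonal entry exists because \<open>Q\<close> has trace 1.\<close>
  obtain r0 where r0: "r0 < n" "Q r0 r0 \<noteq> 0"
  proof -
    have "\<exists>r<n. \<sigma> r * \<rho> r \<noteq> 0"
    proof (rule ccontr)
      assume "\<not> ?thesis"
      then have "(\<Sum>r<n. \<sigma> r * \<rho> r) = 0" by (intro sum.neutral) auto
      then show False using \<sigma>\<rho> by simp
    qed
    then show ?thesis using that by (auto simp: Q_def)
  qed
  define S where "S = (\<Sum>r<n. \<Sum>s<n. \<Sum>w\<in>?W. cmod (cf r s w)) + 1"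
  have S_le: "(\<Sum>w\<in>?W. cmod (cf r s w)) \<le> S" if "r < n" "s < n" for r s
  proof -
    have "(\<Sum>w\<in>?W. cmod (cf r s w)) \<le> (\<Sum>s<n. \<Sum>w\<in>?W. cmod (cf r s w))"
      by (rule member_le_sum[where f = "\<lambda>s. \<Sum>w\<in>?W. cmod (cf r s w)"]) (use that in \<open>auto intro!: sum_nonneg\<close>)
    also have "\<dots> \<le> (\<Sum>r<n. \<Sum>s<n. \<Sum>w\<in>?W. cmod (cf r s w))"
      by (rule member_le_sum[where f = "\<lambda>r. \<Sum>s<n. \<Sum>w\<in>?W. cmod (cf r s w)"]) (use that in \<open>auto intro!: sum_nonneg\<close>)
    finally show ?thesis by (simp add: S_def)
  qed
  have S0: "1 \<le> S"
    unfolding S_def by (simp add: sum_nonneg)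
  \<comment> \<open>Summation only gives weak inequalities. With \<open>real n + 1\<close> in place
    of \<open>real n\<close> they lead to (n+1) |f r s| \<le> |\<mu>|^m \<le> n |f r s|, hence to
    \<open>f r s = 0\<close>.\<close>
  define K where "K = (real n + 1) * (S * S) / cmod (Q r0 r0)"
  have K0: "0 < K"
    unfolding K_def using r0 S0 by (intro divide_pos_pos mult_pos_pos) (auto intro: add_nonneg_pos)
  have main: "\<exists>i\<in>cfgs d b. \<exists>j\<in>cfgs d b. \<exists>i'\<in>cfgs d b. \<exists>j'\<in>cfgs d b.
      cmod \<mu> ^ m \<le> K * cmod (tr4 n (ent (block d D B {..<b} i j b)) (\<lambda>r s. ent (E ^\<^sub>m m) r s - Q r s)
      (ent (block d D B {..<b} i' j' b)) Q)" if \<mu>: "eigenvalue E \<mu>" "\<mu> \<noteq> 1" for \<mu> m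
  proof (rule ccontr)
    assume neg: "\<not> ?thesis"
    define f where "f = (\<lambda>r s. ent (E ^\<^sub>m m) r s - Q r s)"
    have small: "K * cmod (tr4 n (?bl w) f (?bl w') Q) < cmod \<mu> ^ m" if "w \<in> ?W" "w' \<in> ?W" for w w'
    proof (rule ccontr)
      assume "\<not> ?thesis"
      then have "cmod \<mu> ^ m \<le> K * cmod (tr4 n (?bl w) f (?bl w') Q)"
        by simp
      moreover have "fst w \<in> cfgs d b" "snd w \<in> cfgs d b" "fst w' \<in> cfgs d b" "snd w' \<in> cfgs d b"
        using that by auto
      ultimately show False
        using neg unfolding f_def by blast
    qed
    obtain r s where rs: "r < n" "s < n" "cmod \<mu> ^ m \<le> real n * cmod (f r s)"
      using E_pow_entry_large[OF \<mu>] unfolding f_def by blast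
    have "f r s * Q r0 r0 = tr4 n (\<lambda>x y. if x = r0 \<and> y = r then 1 else 0) f (\<lambda>x y. if x = s \<and> y = r0 then 1 else 0) Q"
      by (rule tr4_units[symmetric]) (use rs r0 in auto)
    also have "\<dots> = tr4 n (\<lambda>x y. \<Sum>w\<in>?W. cf r0 r w * ?bl w x y) f (\<lambda>x y. \<Sum>w\<in>?W. cf s r0 w * ?bl w x y) Q"
      by (rule tr4_cong) (use rs r0 in \<open>simp_all add: unit\<close>)
    also have "\<dots> = (\<Sum>w\<in>?W. cf r0 r w * (\<Sum>w'\<in>?W. cf s r0 w' * tr4 n (?bl w) f (?bl w') Q))"
      unfolding tr4_sum_left tr4_sum_right ..
    finally have "cmod (f r s) * cmod (Q r0 r0)
        = cmod (\<Sum>w\<in>?W. cf r0 r w * (\<Sum>w'\<in>?W. cf s r0 w' * tr4 n (?bl w) f (?bl w') Q))"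
      by (metis norm_mult)
    also have "\<dots> \<le> (\<Sum>w\<in>?W. cmod (cf r0 r w) * (S * (cmod \<mu> ^ m / K)))"
    proof (rule sum_norm_le)
      fix w assume w: "w \<in> ?W"
      have "cmod (\<Sum>w'\<in>?W. cf s r0 w' * tr4 n (?bl w) f (?bl w') Q) \<le> (\<Sum>w'\<in>?W. cmod (cf s r0 w') * (cmod \<mu> ^ m / K))"
      proof (rule sum_norm_le)
        fix w' assume "w' \<in> ?W"
        then have "cmod (tr4 n (?bl w) f (?bl w') Q) \<le> cmod \<mu> ^ m / K"
          using small[OF w, of w'] K0 by (simp add: pos_le_divide_eq mult.commute)
        then show "cmod (cf s r0 w' * tr4 n (?bl w) f (?bl w') Q) \<le> cmod (cf s r0 w') * (cmod \<mu> ^ m / K)"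
          unfolding norm_mult by (rule mult_left_mono) simp
      qed
      also have "\<dots> = (\<Sum>w'\<in>?W. cmod (cf s r0 w')) * (cmod \<mu> ^ m / K)"
        by (rule sum_distrib_right[symmetric])
      also have "\<dots> \<le> S * (cmod \<mu> ^ m / K)"
        using K0 by (intro mult_right_mono S_le rs r0) auto
      finally show "cmod (cf r0 r w * (\<Sum>w'\<in>?W. cf s r0 w' * tr4 n (?bl w) f (?bl w') Q))
          \<le> cmod (cf r0 r w) * (S * (cmod \<mu> ^ m / K))"
        unfolding norm_mult by (rule mult_left_mono) simp
    qed
    also have "\<dots> = (\<Sum>w\<in>?W. cmod (cf r0 r w)) * (S * (cmod \<mu> ^ m / K))"
      by (rule sum_distrib_right[symmetric])
    also have "\<dots> \<le> S * (S * (cmod \<mu> ^ m / K))"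
      using K0 S0 by (intro mult_right_mono S_le rs r0) auto
    also have "\<dots> = cmod \<mu> ^ m * cmod (Q r0 r0) / (real n + 1)"
      using S0 r0(2) by (simp add: K_def)
    finally have "cmod (f r s) * cmod (Q r0 r0) \<le> cmod \<mu> ^ m / (real n + 1) * cmod (Q r0 r0)"
      by simp
    then have "cmod (f r s) \<le> cmod \<mu> ^ m / (real n + 1)"
      using r0(2) by (simp only: mult_le_cancel_right) auto
    then have le: "cmod (f r s) * (real n + 1) \<le> cmod \<mu> ^ m"
      by (rule iffD1[OF pos_le_divide_eq, rotated]) (auto intro: add_nonneg_pos)
    moreover have "cmod (f r s) * (real n + 1) = real n * cmod (f r s) + cmod (f r s)"
      by (simp only: distrib_left mult_1_right mult.commute)
    ultimately have "cmod (f r s) \<le> 0"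
      using rs(3) by linarith
    then have fz: "f r s = 0"
      by simp
    have "cmod \<mu> ^ m \<le> 0"
      using rs(3) fz by simp
    \<comment> \<open>Since \<mu> = 0 is possible, the contradiction with |\<mu>|^m \<le> 0 comes
      from the strict inequality \<open>small\<close>, which needs at least one pair of
      words.\<close>
    moreover have "?W \<noteq> {}"
    proof
      assume "?W = {}"
      then have "cfgs d b = {}" by auto
      then show False
        using b[of 0 0 0 0] D by simp
    qed
    then obtain w where w: "w \<in> ?W" by blast
    have "0 \<le> K * cmod (tr4 n (?bl w) f (?bl w) Q)"
      using K0 by simp
    ultimately show False
      using small[OF w w] by linarith
  qed
  then show ?thesis
    using K0 by blast
qed

lemma words_bounded:
  "\<exists>\<beta>\<ge>1. \<forall>i\<in>cfgs d b. \<forall>j\<in>cfgs d b. \<forall>r<n. \<forall>s<n. cmod (ent (block d D B {..<b} i j b) r s) \<le> \<beta>"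
proof -
  define S where "S = (\<lambda>p. cmod (ent (block d D B {..<b} (fst (fst p)) (snd (fst p)) b) (fst (snd p)) (snd (snd p))))
    ` ((cfgs d b \<times> cfgs d b) \<times> ({..<n} \<times> {..<n}))"
  have "finite S" by (simp add: S_def)
  then have "cmod (ent (block d D B {..<b} i j b) r s) \<le> Max (insert 1 S)"
    if "i \<in> cfgs d b" "j \<in> cfgs d b" "r < n" "s < n" for i j r s
    using that by (intro Max_ge) (force simp: S_def)+
  moreover have "1 \<le> Max (insert 1 S)"
    using \<open>finite S\<close> by (intro Max_ge) auto
  ultimately show ?thesis by blast
qed

end

section \<open>Periodic families of observables\<close>

definition cell_sites :: "nat \<Rightarrow> nat \<Rightarrow> nat set \<Rightarrow> nat \<Rightarrow> nat set" where
  "cell_sites M off V a = (\<lambda>t. a * M + off + t) ` V"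

text \<open>Periodic with period \<open>M\<close>, so that a single word describes the operators in
  all cells.\<close>

definition cell_word :: "nat \<Rightarrow> nat \<Rightarrow> (nat \<Rightarrow> nat) \<Rightarrow> nat \<Rightarrow> nat" where
  "cell_word M off w s = w ((s - off) mod M)"

definition cell_op :: "nat \<Rightarrow> nat \<Rightarrow> nat set \<Rightarrow> (nat \<Rightarrow> nat) \<Rightarrow> (nat \<Rightarrow> nat) \<Rightarrow> nat \<Rightarrow> op" where
  "cell_op M off V iw jw a = unit_op (cell_sites M off V a) (cell_word M off iw) (cell_word M off jw)"

lemma cell_word_eq: "t < M \<Longrightarrow> cell_word M off w (a * M + off + t) = w t"
  by (simp add: cell_word_def add.commute[of "a * M"] add.assoc)

lemma cell_op_adj: "op_adj (cell_op M off V iw jw a) = cell_op M off V jw iw a"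
  by (simp add: cell_op_def unit_op_adj)

lemma cell_end_le:
  assumes "(a::nat) < M" "off + len \<le> M" "M * M \<le> N"
  shows "a * M + off + len \<le> N"
proof -
  have "a * M + M \<le> M * M"
    using mult_le_mono1[of "Suc a" M M] assms(1) by simp
  then show ?thesis
    using assms by linarith
qed

lemma cell_gap:
  assumes "(a::nat) < b" "len \<le> M"
  shows "a * M + off + len + (M - len) \<le> b * M + off"
proof -
  have "a * M + M \<le> b * M"
    using mult_le_mono1[of "Suc a" b M] assms(1) by simp
  then show ?thesis
    using assms(2) by linarith
qed

lemma cell_sites_subset: "V \<subseteq> {..<len} \<Longrightarrow> cell_sites M off V a \<subseteq> {a * M + off..<a * M + off + len}"
  by (auto simp: cell_sites_def)

lemma block_cong:
  assumes "\<And>t. t \<in> V \<Longrightarrow> i t = i' t \<and> j t = j' t"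
  shows "block d D B V i j len = block d D B V i' j' len"
proof -
  have "site_op V i j = site_op V i' j'"
    using assms by (auto simp: site_op_def fun_eq_iff)
  then show ?thesis
    by (simp add: block_def)
qed

lemma apply_unit_op_empty:
  assumes "x \<in> cfgs d N"
  shows "apply_op d N (unit_op {} i j) u x = u x"
  by (subst apply_unit_op[OF assms]) (auto simp: repl_def)

section \<open>Expectation values of the cell observables\<close>

locale mps_state_limit = mps_limit d D "coeffs_of A" R L C q
  for d D :: nat and A :: "nat \<Rightarrow> complex mat" and R L :: "nat \<Rightarrow> nat \<Rightarrow> complex" and C q :: real +
  assumes tensor: "tensor d D A"
begin

abbreviation amp :: "nat \<Rightarrow> (nat \<Rightarrow> nat) \<Rightarrow> complex" where "amp N \<equiv> mps_amp D A N"
abbreviation \<phi> :: "nat \<Rightarrow> (nat \<Rightarrow> nat) \<Rightarrow> complex" where "\<phi> N \<equiv> mps_state d D A N"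
abbreviation Bl :: "nat set \<Rightarrow> (nat \<Rightarrow> nat) \<Rightarrow> (nat \<Rightarrow> nat) \<Rightarrow> nat \<Rightarrow> nat \<Rightarrow> nat \<Rightarrow> complex" where
  "Bl V i j len \<equiv> ent (block d D (coeffs_of A) V i j len)"

definition Z :: "nat \<Rightarrow> complex" where "Z N = mtr n (E ^\<^sub>m N)"

text \<open>The norm is the expectation value for the empty window, where the matrix unit is the
  identity.\<close>

lemma Z_eq: "Z N = of_real (sqn d N (amp N))"
proof -
  have "inner d N (amp N) (apply_op d N (unit_op {} i j) (amp N)) = inner d N (amp N) (amp N)" for i j
    by (rule inner_cong) (simp_all add: apply_unit_op_empty)
  moreover have "prodm n (\<lambda>s. smat d D (coeffs_of A) (site_op {} i j s)) N = E ^\<^sub>m N" for i j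
    by (simp add: smat_site_op_notin prodm_const)
  ultimately show ?thesis
    using inner_mps_amp_unit_op[OF tensor, of "{}" N "\<lambda>_. 0" "\<lambda>_. 0"] by (simp add: Z_def inner_self)
qed

lemma mps_norm_const_sq: "complex_of_real (mps_norm_const d D A N) * complex_of_real (mps_norm_const d D A N) = Z N"
proof -
  have "mps_norm_const d D A N * mps_norm_const d D A N = sqn d N (amp N)"
    unfolding mps_norm_const_def sqn_def[symmetric] by (simp add: sqn_nonneg)
  then show ?thesis
    unfolding Z_eq of_real_mult[symmetric] by simp
qed

lemma inner_\<phi>: "inner d N (\<phi> N) (apply_op d N G (\<phi> N)) = inner d N (amp N) (apply_op d N G (amp N)) / Z N"
proof -
  let ?c = "complex_of_real (mps_norm_const d D A N)"
  have 1: "apply_op d N G (\<phi> N) = (\<lambda>x. apply_op d N G (amp N) x / ?c)"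
    by (simp add: apply_op_def mps_state_def sum_divide_distrib fun_eq_iff)
  show ?thesis
    unfolding 1 inner_def sum_divide_distrib mps_norm_const_sq[symmetric]
    by (intro sum.cong refl) (simp add: mps_state_def)
qed

lemma \<phi>_normalised:
  assumes "Z N \<noteq> 0"
  shows "inner d N (\<phi> N) (\<phi> N) = 1"
proof -
  have "inner d N u (apply_op d N (unit_op {} i j) v) = inner d N u v" for i j u v
    by (rule inner_cong) (simp_all add: apply_unit_op_empty)
  then have "inner d N (\<phi> N) (\<phi> N) = inner d N (amp N) (amp N) / Z N"
    using inner_\<phi>[of N "unit_op {} i j" for i j] by simp
  then show ?thesis
    using assms by (simp add: inner_self Z_eq)
qed

lemma expectation_single:
  assumes V: "V \<subseteq> {..<len}" and a: "a < M" and off: "off + len \<le> M" and N: "M * M \<le> N"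
  shows "inner d N (\<phi> N) (apply_op d N (cell_op M off V iw jw a) (\<phi> N))
    = tr2 n (Bl V iw jw len) (ent (E ^\<^sub>m (N - len))) / Z N"
proof -
  have le: "a * M + off + len \<le> N"
    by (rule cell_end_le[OF a off N])
  have W: "cell_sites M off V a \<subseteq> {..<N}"
    using cell_sites_subset[OF V, of M off a] le by force
  have "mtr n (prodm n (\<lambda>s. smat d D (coeffs_of A) (site_op (cell_sites M off V a) (cell_word M off iw) (cell_word M off jw) s)) N)
      = mtr n (block d D (coeffs_of A) V iw jw len * E ^\<^sub>m (N - len))"
  proof (rule mtr_single_block[OF _ V le])
    show "cell_sites M off V a = (\<lambda>t. a * M + off + t) ` V"
      by (simp add: cell_sites_def)
    fix t assume "t \<in> V"
    then have "t < M"
      using V off by force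
    then show "cell_word M off iw (a * M + off + t) = iw t \<and> cell_word M off jw (a * M + off + t) = jw t"
      by (simp add: cell_word_eq)
  qed
  then show ?thesis
    unfolding inner_\<phi> cell_op_def inner_mps_amp_unit_op[OF tensor W]
    by (simp add: mtr_mult_eq_tr2[OF block_carrier pow_carrier_mat[OF smat_carrier]])
qed

lemma expectation_pair:
  assumes V: "V \<subseteq> {..<len}" "V' \<subseteq> {..<len'}" and le: "p + len + g = p'" "p' + len' \<le> N"
  shows "inner d N (\<phi> N) (apply_op d N (unit_op ((\<lambda>t. p + t) ` V \<union> (\<lambda>t. p' + t) ` V') i j) (\<phi> N))
    = tr4 n (Bl V (\<lambda>t. i (p + t)) (\<lambda>t. j (p + t)) len) (ent (E ^\<^sub>m g))
        (Bl V' (\<lambda>t. i (p' + t)) (\<lambda>t. j (p' + t)) len') (ent (E ^\<^sub>m (N - (len + g + len')))) / Z N"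
proof -
  let ?W = "(\<lambda>t. p + t) ` V \<union> (\<lambda>t. p' + t) ` V'"
  have W: "?W \<subseteq> {..<N}"
    using V le by force
  have "mtr n (prodm n (\<lambda>s. smat d D (coeffs_of A) (site_op ?W i j s)) N)
      = mtr n (block d D (coeffs_of A) V (\<lambda>t. i (p + t)) (\<lambda>t. j (p + t)) len * (E ^\<^sub>m g *
        (block d D (coeffs_of A) V' (\<lambda>t. i (p' + t)) (\<lambda>t. j (p' + t)) len' * E ^\<^sub>m (N - (len + g + len')))))"
    by (rule mtr_two_blocks[OF refl V le]) simp_all
  then show ?thesis
    unfolding inner_\<phi> inner_mps_amp_unit_op[OF tensor W]
    by (simp only: mtr_mult_eq_tr4[OF block_carrier pow_carrier_mat[OF smat_carrier] block_carrier pow_carrier_mat[OF smat_carrier]])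
qed

text \<open>The summands are the errors of a joint expectation value, of a single one and of the
  norm, so one bound \<open>cst \<beta> * q ^ g0\<close> serves all three.\<close>

definition cst :: "real \<Rightarrow> real" where
  "cst \<beta> = real n ^ 4 * (\<beta> * \<beta> * (2 * Kb * C)) + (real n)\<^sup>2 * (\<beta> * C) + real n * C"

definition kap :: "real \<Rightarrow> real" where
  "kap \<beta> = 1 + (real n)\<^sup>2 * (\<beta> * Kb)"

lemma cst_nonneg: "0 \<le> \<beta> \<Longrightarrow> 0 \<le> cst \<beta>"
  unfolding cst_def using C Kb_ge1 by (intro add_nonneg_nonneg mult_nonneg_nonneg) auto

lemma kap_ge1: "0 \<le> \<beta> \<Longrightarrow> 1 \<le> kap \<beta>"
  unfolding kap_def using Kb_ge1 by simp

lemma power_le_g0: "g0 \<le> m \<Longrightarrow> C * q ^ m \<le> C * q ^ g0"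
  using C q by (intro mult_left_mono power_decreasing) auto

lemma E_pow_close_g0:
  assumes "1 \<le> g0" "g0 \<le> m" "r < n" "s < n"
  shows "cmod (ent (E ^\<^sub>m m) r s - Q r s) \<le> C * q ^ g0"
  using E_pow_close[of m r s] power_le_g0[OF assms(2)] assms by linarith

lemma Q_le_Kb: "r < n \<Longrightarrow> s < n \<Longrightarrow> cmod (Q r s) \<le> Kb"
  using Q_bound[of r s] C by linarith

lemma tr2_E_close:
  assumes b: "\<And>r s. r < n \<Longrightarrow> s < n \<Longrightarrow> cmod (b r s) \<le> \<beta>" and \<beta>: "0 \<le> \<beta>" and g: "1 \<le> g0" "g0 \<le> m"
  shows "cmod (tr2 n b (ent (E ^\<^sub>m m)) - tr2 n b Q) \<le> cst \<beta> * q ^ g0" "cmod (tr2 n b Q) \<le> kap \<beta>"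
proof -
  have "cmod (tr2 n b (ent (E ^\<^sub>m m)) - tr2 n b Q) \<le> (real n)\<^sup>2 * (\<beta> * (C * q ^ g0))"
    by (rule tr2_close[OF b E_pow_close_g0[OF g] \<beta>])
  also have "\<dots> = ((real n)\<^sup>2 * (\<beta> * C)) * q ^ g0"
    by simp
  also have "\<dots> \<le> cst \<beta> * q ^ g0"
  proof (rule mult_right_mono)
    have "0 \<le> real n ^ 4 * (\<beta> * \<beta> * (2 * Kb * C))" "0 \<le> real n * C"
      using C Kb_ge1 \<beta> by (intro mult_nonneg_nonneg; simp)+
    then show "(real n)\<^sup>2 * (\<beta> * C) \<le> cst \<beta>"
      unfolding cst_def by linarith
  qed (use q in simp)
  finally show "cmod (tr2 n b (ent (E ^\<^sub>m m)) - tr2 n b Q) \<le> cst \<beta> * q ^ g0" .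
  show "cmod (tr2 n b Q) \<le> kap \<beta>"
  proof -
    have "cmod (tr2 n b Q) \<le> (real n)\<^sup>2 * (\<beta> * Kb)"
      by (rule tr2_bound) (fact b Q_le_Kb \<beta>)+
    then show ?thesis
      unfolding kap_def by linarith
  qed
qed

lemma tr4_E_close:
  assumes b1: "\<And>r s. r < n \<Longrightarrow> s < n \<Longrightarrow> cmod (b1 r s) \<le> \<beta>"
    and b2: "\<And>r s. r < n \<Longrightarrow> s < n \<Longrightarrow> cmod (b2 r s) \<le> \<beta>" and \<beta>: "0 \<le> \<beta>"
    and x: "\<And>r s. r < n \<Longrightarrow> s < n \<Longrightarrow> cmod (x r s - x' r s) \<le> C * q ^ g0"
    and x': "\<And>r s. r < n \<Longrightarrow> s < n \<Longrightarrow> cmod (x' r s) \<le> Kb" and g: "1 \<le> g0" "g0 \<le> m"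
  shows "cmod (tr4 n b1 x b2 (ent (E ^\<^sub>m m)) - tr4 n b1 x' b2 Q) \<le> cst \<beta> * q ^ g0"
    "cmod (tr4 n b1 x' b2 Q) \<le> (kap \<beta>)\<^sup>2"
proof -
  have Kb0: "0 \<le> Kb" using Kb_ge1 by linarith
  have "cmod (tr4 n b1 x b2 (ent (E ^\<^sub>m m)) - tr4 n b1 x' b2 Q) \<le> (real n) ^ 4 * (\<beta> * \<beta> * (2 * Kb * (C * q ^ g0)))"
    by (rule tr4_close[OF b1 b2 x E_pow_close_g0[OF g] E_pow_bound x' \<beta> _ Kb0]) (use C q in auto)
  also have "\<dots> = (real n ^ 4 * (\<beta> * \<beta> * (2 * Kb * C))) * q ^ g0"
    by simp
  also have "\<dots> \<le> cst \<beta> * q ^ g0"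
  proof (rule mult_right_mono)
    have "0 \<le> (real n)\<^sup>2 * (\<beta> * C)" "0 \<le> real n * C"
      using C \<beta> by (intro mult_nonneg_nonneg; simp)+
    then show "real n ^ 4 * (\<beta> * \<beta> * (2 * Kb * C)) \<le> cst \<beta>"
      unfolding cst_def by linarith
  qed (use q in simp)
  finally show "cmod (tr4 n b1 x b2 (ent (E ^\<^sub>m m)) - tr4 n b1 x' b2 Q) \<le> cst \<beta> * q ^ g0" .
  have "cmod (tr4 n b1 x' b2 Q) \<le> ((real n)\<^sup>2 * (\<beta> * Kb))\<^sup>2"
    by (rule tr4_bound[OF b1 b2 x' Q_le_Kb \<beta> Kb0])
  also have "\<dots> \<le> (kap \<beta>)\<^sup>2"
    unfolding kap_def using \<beta> Kb0 by (intro power_mono) auto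
  finally show "cmod (tr4 n b1 x' b2 Q) \<le> (kap \<beta>)\<^sup>2" .
qed

lemma Z_close:
  assumes \<beta>: "0 \<le> \<beta>" and g: "1 \<le> g0" "g0 \<le> N"
  shows "cmod (Z N - 1) \<le> cst \<beta> * q ^ g0"
proof -
  have "Z N - 1 = (\<Sum>r<n. ent (E ^\<^sub>m N) r r - Q r r)"
    using \<sigma>\<rho> by (simp add: Z_def mtr_def ent_def Q_def sum_subtractf mult.commute)
  also have "cmod \<dots> \<le> (\<Sum>r<n. C * q ^ g0)"
    by (rule sum_norm_le) (use E_pow_close_g0[OF g] in auto)
  also have "\<dots> = (real n * C) * q ^ g0"
    by simp
  also have "\<dots> \<le> cst \<beta> * q ^ g0"
  proof (rule mult_right_mono)
    have "0 \<le> (real n)\<^sup>2 * (\<beta> * C)" "0 \<le> real n ^ 4 * (\<beta> * \<beta> * (2 * Kb * C))"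
      using C \<beta> Kb_ge1 by (intro mult_nonneg_nonneg; simp)+
    then show "real n * C \<le> cst \<beta>"
      unfolding cst_def by linarith
  qed (use q in simp)
  finally show ?thesis .
qed

lemma Z_nonzero: "cmod (Z N - 1) \<le> \<eta> \<Longrightarrow> \<eta> \<le> 1 / 2 \<Longrightarrow> Z N \<noteq> 0"
  by auto

text \<open>On the ring two cells are joined by two empty stretches, both at least \<open>g0\<close>
  long. Replacing both powers of \<open>E\<close> by \<open>Q\<close> costs the stated error, and
  with \<open>Q\<close> the covariance is zero by \<open>tr4_rank_one\<close>.\<close>

lemma cell_covariance:
  assumes V: "V \<subseteq> {..<len}" and iw: "\<And>t. t \<in> V \<Longrightarrow> iw t < d \<and> jw t < d"
    and off: "off + len \<le> M" and N: "M * M \<le> N"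
    and g: "1 \<le> g0" "g0 + len \<le> M"
    and \<beta>: "0 \<le> \<beta>" "\<And>r s. r < n \<Longrightarrow> s < n \<Longrightarrow> cmod (Bl V iw jw len r s) \<le> \<beta>"
      "\<And>r s. r < n \<Longrightarrow> s < n \<Longrightarrow> cmod (Bl V jw iw len r s) \<le> \<beta>"
    and \<eta>: "cst \<beta> * q ^ g0 \<le> 1 / 2"
    and ab: "a < M" "b < M" "a \<noteq> b"
  defines "u \<equiv> (\<lambda>a. apply_op d N (cell_op M off V jw iw a) (\<phi> N))"
  shows "cmod (inner d N (u a) (u b) - inner d N (u a) (\<phi> N) * inner d N (\<phi> N) (u b))
    \<le> 20 * (kap \<beta>)\<^sup>2 * (cst \<beta> * q ^ g0)"
proof -
  have main: "cmod (inner d N (u a) (u b) - inner d N (u a) (\<phi> N) * inner d N (\<phi> N) (u b))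
    \<le> 20 * (kap \<beta>)\<^sup>2 * (cst \<beta> * q ^ g0)" if ab: "a < b" "b < M" for a b
  proof -
    have a: "a < M" using ab by simp
    define p p' where "p = a * M + off" and "p' = b * M + off"
    define gap where "gap = p' - (p + len)"
    have gap1: "p + len + (M - len) \<le> p'"
      unfolding p_def p'_def by (rule cell_gap) (use ab off in auto)
    then have gap: "p + len + gap = p'" "g0 \<le> gap"
      using g by (auto simp: gap_def)
    have le: "p' + len \<le> N"
      unfolding p'_def by (rule cell_end_le[OF ab(2) off N])
    \<comment> \<open>The stretch that leads the other way around the ring: at least one cell width
      less \<open>len\<close> remains, since there are \<open>M\<close> cells of width
      \<open>M\<close>.\<close>
    have far: "g0 \<le> N - (len + gap + len)"
    proof -
      have "p' + M \<le> M * M + off"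
        using mult_le_mono1[of "Suc b" M M] ab(2) by (simp add: p'_def)
      moreover have "off \<le> p" by (simp add: p_def)
      moreover have "p \<le> p'"
        using gap1 by simp
      ultimately have "p' - p + M \<le> N"
        using N by linarith
      then show ?thesis
        using gap g by linarith
    qed
    let ?I = "cell_word M off iw" and ?J = "cell_word M off jw"
    let ?Wa = "cell_sites M off V a" and ?Wb = "cell_sites M off V b"
    have tM: "t < M" if "t \<in> V" for t
      using that V off by force
    have Wa: "?Wa \<subseteq> {..<N}" and Wb: "?Wb \<subseteq> {..<N}"
      using cell_sites_subset[OF V, of M off a] cell_sites_subset[OF V, of M off b] gap(1) le
      by (force simp: p_def p'_def)+
    have disj: "?Wa \<inter> ?Wb = {}"
      using cell_sites_subset[OF V, of M off a] cell_sites_subset[OF V, of M off b] gap(1)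
      unfolding p_def p'_def by fastforce
    \<comment> \<open>Taking the adjoint of the operator in cell \<open>a\<close> exchanges its two
      words. The merged words therefore run \<open>iw\<close>, \<open>jw\<close> in cell
      \<open>a\<close> and \<open>jw\<close>, \<open>iw\<close> in cell \<open>b\<close>.\<close>
    define i' where "i' s = (if s \<in> ?Wa then ?I s else ?J s)" for s
    define j' where "j' s = (if s \<in> ?Wa then ?J s else ?I s)" for s
    have Ia: "?I (p + t) = iw t" "?J (p + t) = jw t" if "t \<in> V" for t
      using cell_word_eq[OF tM[OF that]] by (simp_all add: p_def)
    have Ib: "?I (p' + t) = iw t" "?J (p' + t) = jw t" if "t \<in> V" for t
      using cell_word_eq[OF tM[OF that]] by (simp_all add: p'_def)
    have ina: "p + t \<in> ?Wa" if "t \<in> V" for t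
      using that by (simp add: cell_sites_def p_def)
    have inb: "p' + t \<notin> ?Wa" if "t \<in> V" for t
      using that disj by (auto simp: cell_sites_def p'_def)
    have pair: "inner d N (u a) (u b) = tr4 n (Bl V iw jw len) (ent (E ^\<^sub>m gap)) (Bl V jw iw len)
        (ent (E ^\<^sub>m (N - (len + gap + len)))) / Z N"
    proof -
      have 1: "unit_op ?Wa ?I ?J = unit_op ?Wa i' j'"
        by (rule unit_op_cong) (simp add: i'_def j'_def)
      have 2: "unit_op ?Wb ?J ?I = unit_op ?Wb i' j'"
        by (rule unit_op_cong) (use disj in \<open>auto simp: i'_def j'_def\<close>)
      have j'd: "j' s < d" if "s \<in> ?Wa \<union> ?Wb" for s
        using that iw Ia Ib by (auto simp: j'_def cell_sites_def p_def p'_def)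
      have "inner d N (u a) (u b) = inner d N (\<phi> N) (apply_op d N (cell_op M off V iw jw a) (u b))"
        unfolding u_def inner_apply_left cell_op_adj ..
      also have "\<dots> = inner d N (\<phi> N) (apply_op d N (unit_op (?Wa \<union> ?Wb) i' j') (\<phi> N))"
        unfolding u_def cell_op_def 1 2
      proof (rule inner_cong)
        fix x assume x: "x \<in> cfgs d N"
        show "apply_op d N (unit_op ?Wa i' j') (apply_op d N (unit_op ?Wb i' j') (\<phi> N)) x
            = apply_op d N (unit_op (?Wa \<union> ?Wb) i' j') (\<phi> N) x"
          by (rule apply_unit_op_disjoint[OF Wa Wb disj _ x]) (rule j'd)
      qed simp
      also have "?Wa \<union> ?Wb = (\<lambda>t. p + t) ` V \<union> (\<lambda>t. p' + t) ` V"
        by (simp add: cell_sites_def p_def p'_def)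
      also have "inner d N (\<phi> N) (apply_op d N (unit_op ((\<lambda>t. p + t) ` V \<union> (\<lambda>t. p' + t) ` V) i' j') (\<phi> N))
          = tr4 n (Bl V (\<lambda>t. i' (p + t)) (\<lambda>t. j' (p + t)) len) (ent (E ^\<^sub>m gap))
            (Bl V (\<lambda>t. i' (p' + t)) (\<lambda>t. j' (p' + t)) len) (ent (E ^\<^sub>m (N - (len + gap + len)))) / Z N"
        by (rule expectation_pair[OF V V gap(1) le])
      also have "block d D (coeffs_of A) V (\<lambda>t. i' (p + t)) (\<lambda>t. j' (p + t)) len = block d D (coeffs_of A) V iw jw len"
        by (rule block_cong) (simp add: i'_def j'_def Ia ina)
      also have "block d D (coeffs_of A) V (\<lambda>t. i' (p' + t)) (\<lambda>t. j' (p' + t)) len = block d D (coeffs_of A) V jw iw len"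
        by (rule block_cong) (simp add: i'_def j'_def Ib inb)
      finally show ?thesis .
    qed
    have t1: "inner d N (u a) (\<phi> N) = tr2 n (Bl V iw jw len) (ent (E ^\<^sub>m (N - len))) / Z N"
      unfolding u_def inner_apply_left cell_op_adj by (rule expectation_single[OF V a off N])
    have t2: "inner d N (\<phi> N) (u b) = tr2 n (Bl V jw iw len) (ent (E ^\<^sub>m (N - len))) / Z N"
      unfolding u_def by (rule expectation_single[OF V ab(2) off N])
    have g0N: "g0 \<le> N - len" "g0 \<le> N"
      using far by linarith+
    let ?\<tau>1 = "tr2 n (Bl V iw jw len) Q" and ?\<tau>2 = "tr2 n (Bl V jw iw len) Q"
    have T: "tr4 n (Bl V iw jw len) Q (Bl V jw iw len) Q = ?\<tau>1 * ?\<tau>2"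
      by (rule tr4_rank_one[where \<rho> = \<rho> and \<sigma> = \<sigma>]) (simp add: Q_def)
    have "cmod (tr4 n (Bl V iw jw len) (ent (E ^\<^sub>m gap)) (Bl V jw iw len) (ent (E ^\<^sub>m (N - (len + gap + len)))) / Z N
        - tr2 n (Bl V iw jw len) (ent (E ^\<^sub>m (N - len))) / Z N * (tr2 n (Bl V jw iw len) (ent (E ^\<^sub>m (N - len))) / Z N)
        - (tr4 n (Bl V iw jw len) Q (Bl V jw iw len) Q - ?\<tau>1 * ?\<tau>2)) \<le> 20 * (kap \<beta>)\<^sup>2 * (cst \<beta> * q ^ g0)"
      by (rule normalised_covariance_close[OF
            tr4_E_close[OF \<beta>(2,3,1) E_pow_close_g0[OF g(1) gap(2)] Q_le_Kb g(1) far]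
            tr2_E_close[OF \<beta>(2,1) g(1) g0N(1)] tr2_E_close[OF \<beta>(3,1) g(1) g0N(1)]
            Z_close[OF \<beta>(1) g(1) g0N(2)] \<eta> kap_ge1[OF \<beta>(1)]])
    then show ?thesis
      unfolding pair t1 t2 T by simp
  qed
  show ?thesis
  proof (cases "a < b")
    case True
    then show ?thesis using main ab by blast
  next
    case False
    then have "b < a" using ab by simp
    have "inner d N (u a) (u b) - inner d N (u a) (\<phi> N) * inner d N (\<phi> N) (u b)
        = cnj (inner d N (u b) (u a) - inner d N (u b) (\<phi> N) * inner d N (\<phi> N) (u a))"
      by (simp add: inner_cnj mult.commute)
    then show ?thesis
      using main[OF \<open>b < a\<close> ab(1)] by (simp only: complex_mod_cnj)
  qed
qed

text \<open>\<open>overlap_bound\<close> for one observable repeated in all cells. The first two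
  depth conditions keep the light cones of the first and the last cell inside the chain; the third
  separates the light cones of neighbouring cells.\<close>

lemma cell_op_difference:
  assumes V: "V \<subseteq> {..<len}" and iw: "\<And>t. t \<in> V \<Longrightarrow> iw t < d \<and> jw t < d" and len: "1 \<le> len"
    and N: "M * M \<le> N" and g: "1 \<le> g0" "g0 + len \<le> M"
    and \<beta>: "0 \<le> \<beta>" "\<And>r s. r < n \<Longrightarrow> s < n \<Longrightarrow> cmod (Bl V iw jw len r s) \<le> \<beta>"
      "\<And>r s. r < n \<Longrightarrow> s < n \<Longrightarrow> cmod (Bl V jw iw len r s) \<le> \<beta>"
    and \<eta>: "cst \<beta> * q ^ g0 \<le> 1 / 2"
    and circ: "valid_circuit d N k Ci" "product_state d N \<chi>"
    and depth: "k * length Ci \<le> off" "off + len + k * length Ci \<le> M" "len + 2 * (k * length Ci) \<le> M"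
  defines "\<psi> \<equiv> apply_circuit d N Ci \<chi>"
  shows "(\<Sum>a<M. cmod (inner d N \<psi> (apply_op d N (cell_op M off V iw jw a) \<psi>)
      - inner d N (\<phi> N) (apply_op d N (cell_op M off V iw jw a) (\<phi> N)))) * cmod (inner d N (\<phi> N) \<psi>)
    \<le> 2 * sqrt (real M + (real M)\<^sup>2 * (20 * (kap \<beta>)\<^sup>2 * (cst \<beta> * q ^ g0)))"
proof -
  let ?O = "cell_op M off V iw jw" and ?O' = "cell_op M off V jw iw"
  have off: "off + len \<le> M" using depth(2) by simp
  have M0: "0 < M" using g by simp
  have g0N: "g0 \<le> N"
    using g N M0 by (metis (no_types, lifting) add_leD1 le_trans mult_le_mono2 Suc_leI One_nat_def mult.right_neutral)
  have Z0: "Z N \<noteq> 0"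
    by (rule Z_nonzero[OF Z_close[OF \<beta>(1) g(1) g0N] \<eta>])
  have unit: "inner d N (\<phi> N) (\<phi> N) = 1" "inner d N \<psi> \<psi> = 1"
    using \<phi>_normalised[OF Z0] inner_apply_circuit[OF circ(1)] product_state_inner[OF circ(2)]
    by (simp_all add: \<psi>_def)
  have sites: "cell_sites M off V a \<subseteq> {..<N}" if "a < M" for a
    using cell_sites_subset[OF V, of M off a] cell_end_le[OF that off N] by force
  have word: "cell_word M off iw s < d \<and> cell_word M off jw s < d" if s: "s \<in> cell_sites M off V a" for a s
  proof -
    obtain t where t: "t \<in> V" "s = a * M + off + t"
      using s by (auto simp: cell_sites_def)
    then have "t < M" using V off by force
    then show ?thesis
      using iw[OF t(1)] by (simp add: t(2) cell_word_eq)
  qed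
  have contr: "sqn d N (apply_op d N (?O a) v) \<le> 1" "sqn d N (apply_op d N (?O' a) v) \<le> 1"
    if "a < M" "inner d N v v = 1" for a v
  proof -
    have "sqn d N v = 1"
      using that(2) by (simp add: inner_self)
    then show "sqn d N (apply_op d N (?O a) v) \<le> 1" "sqn d N (apply_op d N (?O' a) v) \<le> 1"
      using sqn_unit_op_le[OF sites[OF that(1)], of _ d _ v] word unfolding cell_op_def by metis+
  qed
  have unc: "uncorrelated d N \<psi> (cell_sites M off V a) (cell_sites M off V b)" if ab: "a < M" "b < M" "a \<noteq> b" for a b
  proof -
    have main: "uncorrelated d N \<psi> (cell_sites M off V a) (cell_sites M off V b)" if ab: "a < b" "b < M" for a b
      unfolding \<psi>_def
    proof (rule uncorrelated_apply_circuit[OF circ(1) product_state_uncorrelated[OF circ(2)]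
          cell_sites_subset[OF V] cell_sites_subset[OF V]])
      show "k * length Ci \<le> a * M + off"
        using depth(1) by simp
      have "a * M + off + len + (M - len) \<le> b * M + off"
        by (rule cell_gap[OF ab(1)]) (use off in simp)
      then show "a * M + off + len + 2 * (k * length Ci) \<le> b * M + off"
        using depth(3) by linarith
      have "b * M + M \<le> M * M"
        using mult_le_mono1[of "Suc b" M M] ab(2) by simp
      then show "b * M + off + len + k * length Ci \<le> N"
        using depth(2) N by linarith
    qed (use len in auto)
    show ?thesis
      using main[of a b] main[of b a] ab by (cases "a < b") (auto intro: uncorrelated_commute)
  qed
  have e0: "0 \<le> 20 * (kap \<beta>)\<^sup>2 * (cst \<beta> * q ^ g0)"
    using cst_nonneg[OF \<beta>(1)] q by (intro mult_nonneg_nonneg) auto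
  have dual: "inner d N (apply_op d N (?O' a) v) w = inner d N v (apply_op d N (?O a) w)" for a v w
    unfolding inner_apply_left cell_op_adj ..
  have "(\<Sum>a<M. cmod (inner d N \<psi> (apply_op d N (?O a) \<psi>) - inner d N (apply_op d N (?O' a) (\<phi> N)) (\<phi> N)))
      * cmod (inner d N (\<phi> N) \<psi>) \<le> 2 * sqrt (real M + (real M)\<^sup>2 * (20 * (kap \<beta>)\<^sup>2 * (cst \<beta> * q ^ g0)))"
  proof (rule overlap_bound[OF unit dual _ _ _ _ e0])
    show "sqn d N (apply_op d N (?O a) \<psi>) \<le> 1" if "a < M" for a
      using contr that unit by blast
    show "sqn d N (apply_op d N (?O' a) (\<phi> N)) \<le> 1" if "a < M" for a
      using contr that unit by blast
    fix a b assume ab: "a < M" "b < M" "a \<noteq> b"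
    have "inner d N (apply_op d N (?O a) \<psi>) (apply_op d N (?O b) \<psi>)
        = inner d N (apply_op d N (?O a) \<psi>) \<psi> * inner d N \<psi> (apply_op d N (?O b) \<psi>)"
      using unc[OF ab] acts_on_unit_op unfolding uncorrelated_def cell_op_def by blast
    then show "cmod (inner d N (apply_op d N (?O a) \<psi>) (apply_op d N (?O b) \<psi>)
        - inner d N (apply_op d N (?O a) \<psi>) \<psi> * inner d N \<psi> (apply_op d N (?O b) \<psi>))
        \<le> 20 * (kap \<beta>)\<^sup>2 * (cst \<beta> * q ^ g0)"
      using e0 by simp
    show "cmod (inner d N (apply_op d N (?O' a) (\<phi> N)) (apply_op d N (?O' b) (\<phi> N))
        - inner d N (apply_op d N (?O' a) (\<phi> N)) (\<phi> N) * inner d N (\<phi> N) (apply_op d N (?O' b) (\<phi> N)))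
        \<le> 20 * (kap \<beta>)\<^sup>2 * (cst \<beta> * q ^ g0)"
      by (rule cell_covariance[OF V iw off N g \<beta> \<eta> ab])
  qed
  then show ?thesis
    unfolding dual .
qed

end

section \<open>Two windows as one observable\<close>

lemma cmod_inner_unit_op_le_1:
  assumes v: "inner d N v v = 1" and W: "W \<subseteq> {..<N}" "\<And>s. s \<in> W \<Longrightarrow> j s < d"
  shows "cmod (inner d N v (apply_op d N (unit_op W i j) v)) \<le> 1"
proof -
  have 1: "sqn d N v = 1"
    using v by (simp add: inner_self)
  have "cmod (inner d N v (apply_op d N (unit_op W i j) v)) \<le> sqrt 1 * sqrt (sqn d N (apply_op d N (unit_op W i j) v))"
    using cauchy_schwarz_inner[of d N v "apply_op d N (unit_op W i j) v"] 1 by simp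
  also have "\<dots> \<le> sqrt 1 * sqrt 1"
    using sqn_unit_op_le[of W N j d i v] W 1 by (intro mult_left_mono real_sqrt_le_mono) auto
  finally show ?thesis by simp
qed

text \<open>Between the windows the value is arbitrary: \<open>pair_sites\<close> leaves these sites
  out.\<close>

definition pair_word :: "nat \<Rightarrow> nat \<Rightarrow> (nat \<Rightarrow> nat) \<Rightarrow> (nat \<Rightarrow> nat) \<Rightarrow> nat \<Rightarrow> nat" where
  "pair_word b l w w' t = (if t < b then w t else w' (t - (b + l)))"

definition pair_sites :: "nat \<Rightarrow> nat \<Rightarrow> nat set" where
  "pair_sites b l = {..<b} \<union> {b + l..<b + l + b}"

lemma block_pair:
  "block d D B (pair_sites b l) (pair_word b l i i') (pair_word b l j j') (b + l + b)
    = block d D B {..<b} i j b * tmat d D B ^\<^sub>m l * block d D B {..<b} i' j' b"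
proof -
  let ?F = "prodm (D * D) (\<lambda>s. smat d D B (site_op (pair_sites b l) (pair_word b l i i') (pair_word b l j j') s))"
  have "?F (b + l + b) = ?F (b + l) * block d D B {..<b} i' j' b"
    by (rule prodm_block) (auto simp: pair_sites_def pair_word_def)
  also have "?F (b + l) = ?F b * tmat d D B ^\<^sub>m l"
    by (rule prodm_window) (auto simp: pair_sites_def)
  also have "?F b = block d D B {..<b} i j b"
    unfolding block_def
  proof (rule prodm_cong)
    fix s assume "s < b"
    then have "site_op (pair_sites b l) (pair_word b l i i') (pair_word b l j j') s = site_op {..<b} i j s"
      by (simp add: site_op_def pair_sites_def pair_word_def fun_eq_iff)
    then show "smat d D B (site_op (pair_sites b l) (pair_word b l i i') (pair_word b l j j') s) = smat d D B (site_op {..<b} i j s)"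
      by simp
  qed
  finally show ?thesis
    by (simp add: block_def)
qed

lemma cell_sites_pair:
  "cell_sites M off (pair_sites b l) a = cell_sites M off {..<b} a \<union> cell_sites M (off + b + l) {..<b} a"
proof -
  have "{b + l..<b + l + b} = (\<lambda>t. b + l + t) ` {..<b}"
    using image_add_atLeastLessThan[of "b + l" 0 b] by (simp add: lessThan_atLeast0 add.commute)
  then show ?thesis
    unfolding cell_sites_def pair_sites_def image_Un by (simp add: image_image add.assoc)
qed

context mps_state_limit
begin

text \<open>Uniform in \<open>l\<close>, because \<open>Kb\<close> bounds all powers of
  \<open>E\<close>. The distance grows with \<open>N\<close>, while \<beta> has to be a
  constant.\<close>

lemma pair_block_bound:
  assumes X: "\<And>r s. r < n \<Longrightarrow> s < n \<Longrightarrow> cmod (Bl {..<b} i j b r s) \<le> \<beta>"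
    and Y: "\<And>r s. r < n \<Longrightarrow> s < n \<Longrightarrow> cmod (Bl {..<b} i' j' b r s) \<le> \<beta>" and \<beta>: "0 \<le> \<beta>"
    and rs: "r < n" "s < n"
  shows "cmod (Bl (pair_sites b l) (pair_word b l i i') (pair_word b l j j') (b + l + b) r s)
    \<le> (real n)\<^sup>2 * (\<beta> * Kb * \<beta>)"
proof -
  let ?X = "block d D (coeffs_of A) {..<b} i j b" and ?Y = "block d D (coeffs_of A) {..<b} i' j' b"
  note pc = pow_carrier_mat[OF smat_carrier[of d D "coeffs_of A" kdelta]]
  have 1: "Bl (pair_sites b l) (pair_word b l i i') (pair_word b l j j') (b + l + b) r s
      = (\<Sum>u<n. (?X * E ^\<^sub>m l) $$ (r, u) * ?Y $$ (u, s))"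
    unfolding ent_def block_pair by (rule mat_mult_entry[OF mult_carrier_mat[OF block_carrier pc] block_carrier rs])
  have 2: "(\<Sum>u<n. (?X * E ^\<^sub>m l) $$ (r, u) * ?Y $$ (u, s))
      = (\<Sum>u<n. (\<Sum>t<n. ?X $$ (r, t) * (E ^\<^sub>m l) $$ (t, u)) * ?Y $$ (u, s))"
    by (intro sum.cong refl) (simp only: mat_mult_entry[OF block_carrier pc rs(1)] lessThan_iff)
  have "cmod (Bl (pair_sites b l) (pair_word b l i i') (pair_word b l j j') (b + l + b) r s)
      \<le> (\<Sum>u<n. \<Sum>t<n. \<beta> * Kb * \<beta>)"
    unfolding 1 2 sum_distrib_right
  proof (intro sum_norm_le)
    fix t u assume tu: "u \<in> {..<n}" "t \<in> {..<n}"
    have "cmod (?X $$ (r, t)) * cmod ((E ^\<^sub>m l) $$ (t, u)) * cmod (?Y $$ (u, s)) \<le> \<beta> * Kb * \<beta>"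
      using X[of r t] Y[of u s] E_pow_bound[of t u l] tu rs \<beta> Kb_ge1
      by (intro mult_mono) (auto simp: ent_def)
    then show "cmod (?X $$ (r, t) * (E ^\<^sub>m l) $$ (t, u) * ?Y $$ (u, s)) \<le> \<beta> * Kb * \<beta>"
      by (simp add: norm_mult)
  qed
  also have "\<dots> = (real n)\<^sup>2 * (\<beta> * Kb * \<beta>)"
    by (simp only: sum_constant card_lessThan power2_eq_square mult.assoc)
  finally show ?thesis .
qed

text \<open>If \<open>\<psi>\<close> had overlap at least \<open>1/2\<close> with \<open>\<phi>\<close>, then on most cells its local expectation values would
  be close to those of \<open>\<phi>\<close>; as they factorise in \<open>\<psi>\<close>, they would nearly factorise in \<open>\<phi>\<close>.\<close>

lemma connected_correlation_small:
  assumes words: "i \<in> cfgs d b" "j \<in> cfgs d b" "i' \<in> cfgs d b" "j' \<in> cfgs d b" and b: "1 \<le> b"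
    and \<beta>0: "1 \<le> \<beta>0" "\<And>i j r s. i \<in> cfgs d b \<Longrightarrow> j \<in> cfgs d b \<Longrightarrow> r < n \<Longrightarrow> s < n \<Longrightarrow> cmod (Bl {..<b} i j b r s) \<le> \<beta>0"
    and \<beta>: "\<beta> = (real n)\<^sup>2 * (\<beta>0 * Kb * \<beta>0) + \<beta>0"
    and N: "M * M \<le> N" and g: "1 \<le> g0" "g0 + (b + l + b) \<le> M"
    and \<eta>: "cst \<beta> * q ^ g0 \<le> 1 / 2" "real M * (20 * (kap \<beta>)\<^sup>2 * (cst \<beta> * q ^ g0)) \<le> 1"
    and circ: "valid_circuit d N k Ci" "product_state d N \<chi>" and h: "h = k * length Ci" "2 * h \<le> l"
    and cell: "h + (b + l + b) + h \<le> M"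
    and overlap: "1 / 2 \<le> cmod (inner d N (\<phi> N) (apply_circuit d N Ci \<chi>))"
  shows "cmod (tr4 n (Bl {..<b} i j b) (\<lambda>r s. ent (E ^\<^sub>m l) r s - Q r s) (Bl {..<b} i' j' b) Q)
    \<le> 18 / sqrt (real M) + 20 * (kap \<beta>)\<^sup>2 * (cst \<beta> * q ^ g0)"
proof -
  define \<psi> where "\<psi> = apply_circuit d N Ci \<chi>"
  define e where "e = 20 * (kap \<beta>)\<^sup>2 * (cst \<beta> * q ^ g0)"
  define S where "S = sqrt (real M)"
  have M0: "0 < M" using g by simp
  have S0: "0 < S" using M0 by (simp add: S_def)
  have SS: "S * S = real M" by (simp add: S_def)
  have nn: "0 \<le> \<beta>" "\<beta>0 \<le> \<beta>" "(real n)\<^sup>2 * (\<beta>0 * Kb * \<beta>0) \<le> \<beta>"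
    using \<beta>0(1) Kb_ge1 by (simp_all add: \<beta>)
  have bound: "cmod (Bl {..<b} i j b r s) \<le> \<beta>" if "i \<in> cfgs d b" "j \<in> cfgs d b" "r < n" "s < n" for i j r s
    using \<beta>0(2)[OF that] nn(2) by linarith
  have pair_bound: "cmod (Bl (pair_sites b l) (pair_word b l i i') (pair_word b l j j') (b + l + b) r s) \<le> \<beta>"
    if "i \<in> cfgs d b" "j \<in> cfgs d b" "i' \<in> cfgs d b" "j' \<in> cfgs d b" "r < n" "s < n" for i j i' j' r s
    using pair_block_bound[of b i j \<beta>0 i' j' r s l] \<beta>0 that nn(3) by (smt (verit))
  have less_d: "w t < d" if "w \<in> cfgs d b" "t < b" for w t
    using that by (simp add: cfgs_def)
  let ?OX = "cell_op M h {..<b} i j" and ?OY = "cell_op M (h + b + l) {..<b} i' j'"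
  let ?OP = "cell_op M h (pair_sites b l) (pair_word b l i i') (pair_word b l j j')"
  let ?ex = "\<lambda>v G. inner d N v (apply_op d N G v)"
  \<comment> \<open>The covariance errors at most double the variance \<open>M\<close>, and 2 * sqrt
    2 is at most 3.\<close>
  have sq: "2 * sqrt (real M + (real M)\<^sup>2 * e) \<le> 3 * S"
  proof -
    have "real M * (real M * e) \<le> real M * 1"
      using \<eta>(2) unfolding e_def by (intro mult_left_mono) auto
    then have "real M + (real M)\<^sup>2 * e \<le> 2 * real M"
      by (simp add: power2_eq_square mult.assoc)
    then have "4 * (real M + (real M)\<^sup>2 * e) \<le> (3 * S)\<^sup>2"
      using SS by (simp add: power2_eq_square)
    then have "sqrt (4 * (real M + (real M)\<^sup>2 * e)) \<le> 3 * S"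
      using S0 by (intro real_le_lsqrt) auto
    moreover have "sqrt (4 * (real M + (real M)\<^sup>2 * e)) = 2 * sqrt (real M + (real M)\<^sup>2 * e)"
      by (simp only: real_sqrt_mult real_sqrt_four)
    ultimately show ?thesis by linarith
  qed
  \<comment> \<open>Dividing by an overlap of at least 1/2 turns 3 into 6; the three families
    together give the 18 below.\<close>
  have from_overlap: "x \<le> 6 * S" if "x * cmod (inner d N (\<phi> N) \<psi>) \<le> 2 * sqrt (real M + (real M)\<^sup>2 * e)" "0 \<le> x" for x
  proof -
    have "x * (1 / 2) \<le> x * cmod (inner d N (\<phi> N) \<psi>)"
      using overlap that(2) unfolding \<psi>_def by (intro mult_left_mono)
    then show ?thesis
      using that(1) sq by linarith
  qed
  have dX: "(\<Sum>a<M. cmod (?ex \<psi> (?OX a) - ?ex (\<phi> N) (?OX a))) \<le> 6 * S"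
    unfolding \<psi>_def
  proof (rule from_overlap[unfolded \<psi>_def e_def, OF cell_op_difference[OF order_refl _ b N g(1) _ nn(1) _ _ \<eta>(1) circ]])
    show "k * length Ci \<le> h" "h + b + k * length Ci \<le> M" "b + 2 * (k * length Ci) \<le> M"
      using h cell by simp_all
  qed (use words less_d bound g in \<open>auto intro: sum_nonneg\<close>)
  have dY: "(\<Sum>a<M. cmod (?ex \<psi> (?OY a) - ?ex (\<phi> N) (?OY a))) \<le> 6 * S"
    unfolding \<psi>_def
  proof (rule from_overlap[unfolded \<psi>_def e_def, OF cell_op_difference[OF order_refl _ b N g(1) _ nn(1) _ _ \<eta>(1) circ]])
    show "k * length Ci \<le> h + b + l" "h + b + l + b + k * length Ci \<le> M" "b + 2 * (k * length Ci) \<le> M"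
      using h cell by simp_all
  qed (use words less_d bound g in \<open>auto intro: sum_nonneg\<close>)
  have pw: "pair_word b l w w' t < d" if "t \<in> pair_sites b l" "w \<in> cfgs d b" "w' \<in> cfgs d b" for w w' t
    using that less_d by (auto simp: pair_word_def pair_sites_def)
  have dP: "(\<Sum>a<M. cmod (?ex \<psi> (?OP a) - ?ex (\<phi> N) (?OP a))) \<le> 6 * S"
    unfolding \<psi>_def
  proof (rule from_overlap[unfolded \<psi>_def e_def, OF cell_op_difference[OF _ _ _ N g(1,2) nn(1) _ _ \<eta>(1) circ]])
    show "pair_sites b l \<subseteq> {..<b + l + b}"
      by (auto simp: pair_sites_def)
    show "k * length Ci \<le> h" "h + (b + l + b) + k * length Ci \<le> M" "b + l + b + 2 * (k * length Ci) \<le> M"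
      using h cell by simp_all
    show "cmod (Bl (pair_sites b l) (pair_word b l i i') (pair_word b l j j') (b + l + b) r s) \<le> \<beta>"
      "cmod (Bl (pair_sites b l) (pair_word b l j j') (pair_word b l i i') (b + l + b) r s) \<le> \<beta>"
      if "r < n" "s < n" for r s
      using pair_bound words that by blast+
    show "pair_word b l i i' t < d \<and> pair_word b l j j' t < d" if "t \<in> pair_sites b l" for t
      using pw that words by blast
  qed (use b in \<open>auto intro: sum_nonneg\<close>)
  have MN: "M \<le> N"
    using N M0 by (metis Suc_leI le_trans mult_le_mono2 One_nat_def mult.right_neutral)
  have g0N: "g0 \<le> N"
    using g MN by simp
  note Zc = Z_close[OF nn(1) g(1) g0N]
  have Z0: "Z N \<noteq> 0"
    by (rule Z_nonzero[OF Zc \<eta>(1)])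
  have unit: "inner d N (\<phi> N) (\<phi> N) = 1" "inner d N \<psi> \<psi> = 1"
    using \<phi>_normalised[OF Z0] inner_apply_circuit[OF circ(1)] product_state_inner[OF circ(2)]
    by (simp_all add: \<psi>_def)
  define \<alpha> where "\<alpha> = tr2 n (Bl {..<b} i j b) (ent (E ^\<^sub>m (N - b))) / Z N"
  define \<alpha>' where "\<alpha>' = tr2 n (Bl {..<b} i' j' b) (ent (E ^\<^sub>m (N - b))) / Z N"
  define \<gamma> where "\<gamma> = tr4 n (Bl {..<b} i j b) (ent (E ^\<^sub>m l)) (Bl {..<b} i' j' b) (ent (E ^\<^sub>m (N - (b + l + b)))) / Z N"
  have X\<phi>: "?ex (\<phi> N) (?OX a) = \<alpha>" if "a < M" for a
    unfolding \<alpha>_def by (rule expectation_single[OF order_refl that _ N]) (use cell in simp)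
  have Y\<phi>: "?ex (\<phi> N) (?OY a) = \<alpha>'" if "a < M" for a
    unfolding \<alpha>'_def by (rule expectation_single[OF order_refl that _ N]) (use cell in simp)
  have pos: "a * M + h + (b + l + b) + h \<le> N" if "a < M" for a
    using cell_end_le[OF that, of 0 M N] N mult_le_mono1[of "Suc a" M M] that cell by simp
  have word_X: "cell_word M h w (a * M + h + t) = w t" if "t < b" for w a t
    using that cell by (intro cell_word_eq) simp
  have word_Y: "cell_word M (h + b + l) w (a * M + (h + b + l) + t) = w t" if "t < b" for w a t
    using that cell by (intro cell_word_eq) simp
  have word_PX: "cell_word M h (pair_word b l w w') (a * M + h + t) = w t" if "t < b" for w w' a t
    using that cell cell_word_eq[of t M h "pair_word b l w w'" a] by (simp add: pair_word_def)
  have word_PY: "cell_word M h (pair_word b l w w') (a * M + (h + b + l) + t) = w' t" if "t < b" for w w' a t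
    using that cell cell_word_eq[of "b + l + t" M h "pair_word b l w w'" a] by (simp add: pair_word_def add.assoc)
  let ?WX = "cell_sites M h {..<b}" and ?WY = "cell_sites M (h + b + l) {..<b}"
  have P\<phi>: "?ex (\<phi> N) (?OP a) = \<gamma>" if a: "a < M" for a
  proof -
    let ?p = "a * M + h" and ?p' = "a * M + (h + b + l)"
    let ?I = "cell_word M h (pair_word b l i i')" and ?J = "cell_word M h (pair_word b l j j')"
    have "?OP a = unit_op ((\<lambda>t. ?p + t) ` {..<b} \<union> (\<lambda>t. ?p' + t) ` {..<b}) ?I ?J"
      unfolding cell_op_def cell_sites_pair by (simp add: cell_sites_def add.assoc)
    then have "?ex (\<phi> N) (?OP a) = tr4 n (Bl {..<b} (\<lambda>t. ?I (?p + t)) (\<lambda>t. ?J (?p + t)) b) (ent (E ^\<^sub>m l))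
        (Bl {..<b} (\<lambda>t. ?I (?p' + t)) (\<lambda>t. ?J (?p' + t)) b) (ent (E ^\<^sub>m (N - (b + l + b)))) / Z N"
      by (simp only:) (rule expectation_pair, use pos[OF a] in auto)
    also have "block d D (coeffs_of A) {..<b} (\<lambda>t. ?I (?p + t)) (\<lambda>t. ?J (?p + t)) b = block d D (coeffs_of A) {..<b} i j b"
      by (rule block_cong) (simp add: word_PX)
    also have "block d D (coeffs_of A) {..<b} (\<lambda>t. ?I (?p' + t)) (\<lambda>t. ?J (?p' + t)) b = block d D (coeffs_of A) {..<b} i' j' b"
      by (rule block_cong) (simp add: word_PY)
    finally show ?thesis
      by (simp only: \<gamma>_def)
  qed
  have WX: "?WX a \<subseteq> {a * M + h..<a * M + h + b}" and WY: "?WY a \<subseteq> {a * M + (h + b + l)..<a * M + (h + b + l) + b}" for a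
    by (rule cell_sites_subset, rule order_refl)+
  have WXN: "?WX a \<subseteq> {..<N}" and WYN: "?WY a \<subseteq> {..<N}" if "a < M" for a
    using WX[of a] WY[of a] pos[OF that] by force+
  have disj: "?WX a \<inter> ?WY a = {}" for a
    using WX[of a] WY[of a] by fastforce
  have jX: "cell_word M h j s < d" if "s \<in> ?WX a" for s a
    using that word_X less_d words(2) by (auto simp: cell_sites_def)
  have jY: "cell_word M (h + b + l) j' s < d" if "s \<in> ?WY a" for s a
    using that word_Y less_d words(4) by (auto simp: cell_sites_def)
  have X1: "cmod (?ex v (?OX a)) \<le> 1" and Y1: "cmod (?ex v (?OY a)) \<le> 1" if "a < M" "inner d N v v = 1" for a v
    unfolding cell_op_def using that WXN WYN jX jY by (auto intro!: cmod_inner_unit_op_le_1)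
  \<comment> \<open>In the circuit state the windows factorise exactly, because their distance
    \<open>l\<close> is at least \<open>2 * h\<close>.\<close>
  have P\<psi>: "?ex \<psi> (?OP a) = ?ex \<psi> (?OX a) * ?ex \<psi> (?OY a)" if a: "a < M" for a
  proof -
    let ?I = "cell_word M h (pair_word b l i i')" and ?J = "cell_word M h (pair_word b l j j')"
    have 1: "?OX a = unit_op (?WX a) ?I ?J"
      unfolding cell_op_def by (rule unit_op_cong) (auto simp: cell_sites_def word_X pair_word_def)
    have 2: "?OY a = unit_op (?WY a) ?I ?J"
      unfolding cell_op_def by (rule unit_op_cong) (auto simp: cell_sites_def word_Y word_PY)
    have 3: "?OP a = unit_op (?WX a \<union> ?WY a) ?I ?J"
      unfolding cell_op_def cell_sites_pair ..
    have J: "?J s < d" if "s \<in> ?WX a \<union> ?WY a" for s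
      using that word_PX word_PY less_d words by (auto simp: cell_sites_def)
    have "?ex \<psi> (?OP a) = inner d N \<psi> (apply_op d N (?OX a) (apply_op d N (?OY a) \<psi>))"
    proof (rule inner_cong)
      fix x assume x: "x \<in> cfgs d N"
      show "apply_op d N (?OP a) \<psi> x = apply_op d N (?OX a) (apply_op d N (?OY a) \<psi>) x"
        unfolding 1 2 3 by (rule apply_unit_op_disjoint[OF WXN[OF a] WYN[OF a] disj J x, symmetric])
    qed simp
    also have "\<dots> = inner d N (apply_op d N (op_adj (?OX a)) \<psi>) (apply_op d N (?OY a) \<psi>)"
      unfolding inner_apply_left by (simp add: op_adj_def)
    also have "\<dots> = inner d N (apply_op d N (op_adj (?OX a)) \<psi>) \<psi> * inner d N \<psi> (apply_op d N (?OY a) \<psi>)"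
    proof -
      have "uncorrelated d N \<psi> (?WX a) (?WY a)"
        unfolding \<psi>_def
      proof (rule uncorrelated_apply_circuit[OF circ(1) product_state_uncorrelated[OF circ(2)] WX WY])
        show "a * M + h + b + 2 * (k * length Ci) \<le> a * M + (h + b + l)"
          using h by simp
        show "a * M + (h + b + l) + b + k * length Ci \<le> N"
          using pos[OF a] h by simp
      qed (use b h in auto)
      then show ?thesis
        unfolding uncorrelated_def cell_op_adj by (simp add: cell_op_def acts_on_unit_op)
    qed
    also have "inner d N (apply_op d N (op_adj (?OX a)) \<psi>) \<psi> = ?ex \<psi> (?OX a)"
      unfolding inner_apply_left by (simp add: op_adj_def)
    finally show ?thesis .
  qed
  \<comment> \<open>All these expectation values have modulus at most 1, so passing from one product
    to the other costs just the sum of the two differences.\<close>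
  have each: "cmod (\<gamma> - \<alpha> * \<alpha>') \<le> cmod (?ex \<psi> (?OP a) - ?ex (\<phi> N) (?OP a)) + (cmod (?ex \<psi> (?OX a) - ?ex (\<phi> N) (?OX a))
      + cmod (?ex \<psi> (?OY a) - ?ex (\<phi> N) (?OY a)))" if a: "a < M" for a
  proof -
    define x y where "x = ?ex \<psi> (?OX a)" and "y = ?ex \<psi> (?OY a)"
    have le1: "cmod y \<le> 1" "cmod \<alpha> \<le> 1"
      using Y1[OF a unit(2)] X1[OF a unit(1)] X\<phi>[OF a] by (simp_all add: y_def)
    have split: "\<gamma> - \<alpha> * \<alpha>' = (\<gamma> - x * y) + ((x - \<alpha>) * y + \<alpha> * (y - \<alpha>'))"
      by (simp add: algebra_simps)
    have "cmod (\<gamma> - \<alpha> * \<alpha>') \<le> cmod (\<gamma> - x * y) + (cmod ((x - \<alpha>) * y) + cmod (\<alpha> * (y - \<alpha>')))"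
      unfolding split using norm_triangle_ineq[of "\<gamma> - x * y" "(x - \<alpha>) * y + \<alpha> * (y - \<alpha>')"]
        norm_triangle_ineq[of "(x - \<alpha>) * y" "\<alpha> * (y - \<alpha>')"] by linarith
    moreover have "cmod ((x - \<alpha>) * y) \<le> cmod (x - \<alpha>) * 1"
      unfolding norm_mult by (rule mult_left_mono[OF le1(1)]) simp
    moreover have "cmod (\<alpha> * (y - \<alpha>')) \<le> 1 * cmod (y - \<alpha>')"
      unfolding norm_mult by (rule mult_right_mono[OF le1(2)]) simp
    ultimately have "cmod (\<gamma> - \<alpha> * \<alpha>') \<le> cmod (x * y - \<gamma>) + (cmod (x - \<alpha>) + cmod (y - \<alpha>'))"
      using norm_minus_commute[of \<gamma> "x * y"] by linarith
    then show ?thesis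
      unfolding P\<psi>[OF a] P\<phi>[OF a] X\<phi>[OF a] Y\<phi>[OF a] x_def y_def .
  qed
  \<comment> \<open>By translation invariance every cell has the same covariance, so the sum over
    cells is \<open>M\<close> times that number, and \<open>M = S * S\<close> leaves
    \<open>18 / S\<close>.\<close>
  have "real M * cmod (\<gamma> - \<alpha> * \<alpha>') = (\<Sum>a<M. cmod (\<gamma> - \<alpha> * \<alpha>'))"
    by simp
  also have "\<dots> \<le> (\<Sum>a<M. cmod (?ex \<psi> (?OP a) - ?ex (\<phi> N) (?OP a)) + (cmod (?ex \<psi> (?OX a) - ?ex (\<phi> N) (?OX a))
      + cmod (?ex \<psi> (?OY a) - ?ex (\<phi> N) (?OY a))))"
    by (rule sum_mono) (use each in simp)
  also have "\<dots> \<le> 18 * S"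
    unfolding sum.distrib using dX dY dP by linarith
  finally have "S * (S * cmod (\<gamma> - \<alpha> * \<alpha>')) \<le> S * 18"
    using SS by (simp add: mult.assoc[symmetric] mult.commute)
  then have "S * cmod (\<gamma> - \<alpha> * \<alpha>') \<le> 18"
    using S0 by simp
  then have small: "cmod (\<gamma> - \<alpha> * \<alpha>') \<le> 18 / S"
    using S0 by (simp add: pos_le_divide_eq mult.commute)
  have far: "g0 \<le> N - (b + l + b)" "g0 \<le> N - b"
    using g MN by linarith+
  let ?\<tau> = "tr2 n (Bl {..<b} i j b) Q" and ?\<tau>' = "tr2 n (Bl {..<b} i' j' b) Q"
  \<comment> \<open>Only the long way around the ring is replaced by \<open>Q\<close>. The short
    connection keeps its power, whose deviation from \<open>Q\<close> is the quantity to be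
    bounded.\<close>
  let ?T = "tr4 n (Bl {..<b} i j b) (ent (E ^\<^sub>m l)) (Bl {..<b} i' j' b) Q"
  note bX = bound[OF words(1,2)] and bY = bound[OF words(3,4)]
  have t4: "cmod (tr4 n (Bl {..<b} i j b) (ent (E ^\<^sub>m l)) (Bl {..<b} i' j' b) (ent (E ^\<^sub>m (N - (b + l + b)))) - ?T) \<le> cst \<beta> * q ^ g0"
    "cmod ?T \<le> (kap \<beta>)\<^sup>2"
    by (rule tr4_E_close[where x = "ent (E ^\<^sub>m l)", OF bX bY nn(1) _ E_pow_bound g(1) far(1)]; use C q in simp)+
  have close: "cmod ((\<gamma> - \<alpha> * \<alpha>') - (?T - ?\<tau> * ?\<tau>')) \<le> 20 * (kap \<beta>)\<^sup>2 * (cst \<beta> * q ^ g0)"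
    unfolding \<gamma>_def \<alpha>_def \<alpha>'_def
    by (rule normalised_covariance_close[OF t4 tr2_E_close[OF bX nn(1) g(1) far(2)] tr2_E_close[OF bY nn(1) g(1) far(2)]
          Zc \<eta>(1) kap_ge1[OF nn(1)]])
  have "tr4 n (Bl {..<b} i j b) (\<lambda>r s. ent (E ^\<^sub>m l) r s - Q r s) (Bl {..<b} i' j' b) Q = ?T - ?\<tau> * ?\<tau>'"
    unfolding tr4_diff tr4_rank_one[where \<rho> = \<rho> and \<sigma> = \<sigma> and Q = Q, OF Q_def] ..
  then show ?thesis
    using small close norm_triangle_ineq2[of "?T - ?\<tau> * ?\<tau>'" "\<gamma> - \<alpha> * \<alpha>'"]
    unfolding S_def by (simp add: norm_minus_commute)
qed

end

section \<open>Asymptotics\<close>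

lemma normal_tensor_mps_state_limit:
  assumes "normal_tensor d D A"
  obtains R L C q where "mps_state_limit d D A R L C q"
proof -
  from normal_tensor_limit[OF assms] obtain R L C q where
    "0 < D" "nondegenerate D R" "nondegenerate D L" "(\<Sum>a<D. \<Sum>b<D. L a b * R a b) = 1"
    "fixed_by d D (transposed (coeffs_of A)) L"
    "0 \<le> C" "0 < q" "q < (1::real)"
    and bound: "\<forall>m. \<forall>a<D. \<forall>b<D. \<forall>c<D. \<forall>e<D.
      cmod ((tmat d D (coeffs_of A) ^\<^sub>m Suc m) $$ (a * D + b, c * D + e) - R a b * L c e) \<le> C * q ^ Suc m"
    by (elim exE conjE)
  moreover have "tensor d D A"
    using assms by (simp add: normal_tensor_def)
  ultimately have "mps_state_limit d D A R L C q"
    unfolding mps_state_limit_def mps_limit_def mps_state_limit_axioms_def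
    by (intro conjI allI impI) (simp_all only: simp_thms)
  then show ?thesis by (rule that)
qed

lemma subleading_attained:
  assumes "subleading_eigenvalues d D A \<noteq> {}"
  obtains \<mu> where "eigenvalue (transfer_matrix d D A) \<mu>" "\<mu> \<noteq> 1" "cmod \<mu> = lambda2_mod d D A"
proof -
  have "transfer_matrix d D A \<in> carrier_mat (D * D) (D * D)"
    by (simp add: transfer_matrix_def)
  then have "finite (spectrum (transfer_matrix d D A))"
    by (rule card_finite_spectrum(1))
  then have "finite (subleading_eigenvalues d D A)"
    by (rule finite_subset[rotated]) (auto simp: subleading_eigenvalues_def spectrum_def)
  then have "lambda2_mod d D A \<in> cmod ` subleading_eigenvalues d D A"
    unfolding lambda2_mod_def using assms by (intro Max_in) auto
  then show ?thesis
    using that by (auto simp: subleading_eigenvalues_def)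
qed

lemma eventually_geometric_small:
  fixes c1 c2 q :: real
  assumes "0 < q" "q < 1"
  shows "\<forall>\<^sub>F g in sequentially. c1 * q ^ g \<le> 1 / 2 \<and> real g * (c2 * q ^ g) \<le> 1"
proof (rule eventually_conj)
  have "(\<lambda>g. c1 * q ^ g) \<longlonglongrightarrow> c1 * 0"
    using assms by (intro tendsto_mult_left LIMSEQ_realpow_zero) auto
  then have "\<forall>\<^sub>F g in sequentially. c1 * q ^ g < 1 / 2"
    by (rule order_tendstoD(2)) simp
  then show "\<forall>\<^sub>F g in sequentially. c1 * q ^ g \<le> 1 / 2"
    by (rule eventually_mono) simp
  have "(\<lambda>g. c2 * (real g * q ^ g)) \<longlonglongrightarrow> c2 * 0"
    using assms by (intro tendsto_mult_left powser_times_n_limit_0) auto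
  then have "\<forall>\<^sub>F g in sequentially. c2 * (real g * q ^ g) < 1"
    by (rule order_tendstoD(2)) simp
  then show "\<forall>\<^sub>F g in sequentially. real g * (c2 * q ^ g) \<le> 1"
    by (rule eventually_mono) (simp add: mult_ac)
qed

lemma power_ge_of_le_ln:
  assumes \<mu>: "0 < x" "x \<le> (1::real)" and m: "real m * (- ln x) \<le> c * ln N" and N: "0 < N"
  shows "N powr (- c) \<le> x ^ m"
proof -
  have "N powr (- c) = exp (- (c * ln N))"
    using N by (simp add: powr_def)
  also have "\<dots> \<le> exp (real m * ln x)"
    using m by simp
  also have "\<dots> = x ^ m"
    using \<mu>(1) by (simp add: exp_of_nat_mult)
  finally show ?thesis .
qed

theorem theorem1:
  fixes d D k :: nat
    and A :: "nat \<Rightarrow> complex mat"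
    and T :: "nat \<Rightarrow> nat"
    and C :: "nat \<Rightarrow> (nat set \<times> op) list list"
    and \<chi> \<psi> :: "nat \<Rightarrow> (nat \<Rightarrow> nat) \<Rightarrow> complex"
  assumes normal: "normal_tensor d D A"
    and sub_ex: "subleading_eigenvalues d D A \<noteq> {}"
    and xi_finite: "0 < lambda2_mod d D A"
    and xi_pos: "0 < corr_length d D A"
    and prod: "\<And>N. product_state d N (\<chi> N)"
    and circ: "\<And>N. valid_circuit d N k (C N)"
    and depth: "\<And>N. length (C N) = T N"
    and psi: "\<And>N. \<psi> N = apply_circuit d N (C N) (\<chi> N)"
    and T_small: "(\<lambda>N. real (T N)) \<in> o(\<lambda>N. ln (real N))"
  shows "\<exists>N0. \<forall>N>N0. 1 - cmod (inner d N (mps_state d D A N) (\<psi> N)) > 1 / 2"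
proof -
  obtain R L Cd q where "mps_state_limit d D A R L Cd q"
    using normal_tensor_mps_state_limit[OF normal] .
  then interpret mps_state_limit d D A R L Cd q .
  obtain \<mu> where \<mu>: "eigenvalue E \<mu>" "\<mu> \<noteq> 1" "cmod \<mu> = lambda2_mod d D A"
    using subleading_attained[OF sub_ex] unfolding transfer_matrix_eq_tmat by blast
  define x where "x = cmod \<mu>"
  have x: "0 < x" "x < 1"
    using xi_finite \<mu> normal unfolding x_def normal_tensor_def transfer_matrix_eq_tmat by auto
  obtain b coef where b: "1 \<le> b" and coef: "\<And>p p' a c. p < D \<Longrightarrow> p' < D \<Longrightarrow> a < D \<Longrightarrow> c < D \<Longrightarrow>
      (\<Sum>y\<in>cfgs d b. coef p p' y * wp D (coeffs_of A) y b a c) = (if a = p \<and> c = p' then 1 else 0)"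
    using words_span by blast
  obtain K where K: "0 < K" and large: "\<And>m. \<exists>i\<in>cfgs d b. \<exists>j\<in>cfgs d b. \<exists>i'\<in>cfgs d b. \<exists>j'\<in>cfgs d b.
      x ^ m \<le> K * cmod (tr4 n (Bl {..<b} i j b) (\<lambda>r s. ent (E ^\<^sub>m m) r s - Q r s) (Bl {..<b} i' j' b) Q)"
    using correlations_bounded_below[OF coef] \<mu>(1,2) unfolding x_def by blast
  obtain \<beta>0 where \<beta>0: "1 \<le> \<beta>0"
    "\<And>i j r s. i \<in> cfgs d b \<Longrightarrow> j \<in> cfgs d b \<Longrightarrow> r < n \<Longrightarrow> s < n \<Longrightarrow> cmod (Bl {..<b} i j b r s) \<le> \<beta>0"
    using words_bounded[of b] by blast
  define \<beta> where "\<beta> = (real n)\<^sup>2 * (\<beta>0 * Kb * \<beta>0) + \<beta>0"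
  define c2 where "c2 = 20 * (kap \<beta>)\<^sup>2 * cst \<beta>"
  have c2: "0 \<le> c2"
    unfolding c2_def \<beta>_def using \<beta>0(1) Kb_ge1 by (intro mult_nonneg_nonneg cst_nonneg add_nonneg_nonneg) auto
  \<comment> \<open>The factor 2 pays for \<open>M \<le> 2 * g0\<close>: the decay has to beat the
    number of cells and not just \<open>g0\<close>.\<close>
  obtain G where G: "\<And>g. G \<le> g \<Longrightarrow> cst \<beta> * q ^ g \<le> 1 / 2 \<and> real g * ((2 * c2) * q ^ g) \<le> 1"
    using eventually_geometric_small[OF q, of "cst \<beta>" "2 * c2"] by (auto simp: eventually_sequentially)
  define w where "w = - ln x"
  have w: "0 < w"
    using x by (simp add: w_def)
  \<comment> \<open>Small enough for both \<open>4 * h \<le> ln N\<close>, so that the windows fit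
    into a cell, and \<open>2 * h * w \<le> ln N / 8\<close>, which yields the exponent 1/8; the 1
    in the denominator covers \<open>k = 0\<close>.\<close>
  define \<delta> where "\<delta> = 1 / (16 * real k * w + 4 * real k + 1)"
  have den: "0 < 16 * real k * w + 4 * real k + 1"
    using w by (intro add_nonneg_pos add_nonneg_nonneg) auto
  have \<delta>: "0 < \<delta>" "4 * real k * \<delta> \<le> 1" "2 * real k * w * \<delta> \<le> 1 / 8"
  proof -
    show "0 < \<delta>" unfolding \<delta>_def using den by simp
    have "0 \<le> 16 * real k * w" "0 \<le> 4 * real k"
      using w by auto
    then show "4 * real k * \<delta> \<le> 1" "2 * real k * w * \<delta> \<le> 1 / 8"
      unfolding \<delta>_def using den by (simp_all add: pos_divide_le_eq)
  qed
  have "\<forall>\<^sub>F N in sequentially. norm (real (T N)) \<le> \<delta> * norm (ln (real N))"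
    by (rule landau_o.smallD[OF T_small \<delta>(1)])
  moreover have "\<forall>\<^sub>F N in sequentially. (1::nat) \<le> N"
    by (rule eventually_ge_at_top)
  \<comment> \<open>Room inside a cell: \<open>8 * h\<close> is at most \<open>2 * ln N\<close>, and
    \<open>M\<close> is at least \<open>sqrt N - 1\<close>.\<close>
  moreover have "\<forall>\<^sub>F N :: nat in sequentially. 2 * real G + 4 * real b + 6 \<le> sqrt (real N) - 1 - 2 * ln (real N)"
  proof -
    have "filterlim (\<lambda>N::nat. sqrt (real N) - 1 - 2 * ln (real N)) at_top sequentially"
      by real_asymp
    then show ?thesis
      by (simp only: filterlim_at_top)
  qed
  \<comment> \<open>The right side grows like N^(1/4 - 1/8). The 1 makes the final comparison
    strict.\<close>
  moreover have "\<forall>\<^sub>F N :: nat in sequentially. 19 * K / x + 1 \<le> sqrt (sqrt (real N) - 1) * real N powr (- (1 / 8))"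
  proof -
    have "filterlim (\<lambda>N::nat. sqrt (sqrt (real N) - 1) * real N powr (- (1 / 8))) at_top sequentially"
      by real_asymp
    then show ?thesis
      by (simp only: filterlim_at_top)
  qed
  ultimately have "\<forall>\<^sub>F N in sequentially. 1 - cmod (inner d N (mps_state d D A N) (\<psi> N)) > 1 / 2"
  proof eventually_elim
    case (elim N)
    show ?case
    proof (rule ccontr)
      assume "\<not> ?case"
      then have overlap: "1 / 2 \<le> cmod (inner d N (\<phi> N) (apply_circuit d N (C N) (\<chi> N)))"
        by (simp add: psi)
      define M where "M = nat \<lfloor>sqrt (real N)\<rfloor>"
      have M_le: "real M \<le> sqrt (real N)" and M_ge: "sqrt (real N) - 1 \<le> real M"
      proof -
        have "real M = of_int \<lfloor>sqrt (real N)\<rfloor>"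
          unfolding M_def by simp
        then show "real M \<le> sqrt (real N)" "sqrt (real N) - 1 \<le> real M"
          using of_int_floor_le[of "sqrt (real N)"] real_of_int_floor_gt_diff_one[of "sqrt (real N)"] by simp_all
      qed
      have MN: "M * M \<le> N"
      proof -
        have "real M * real M \<le> sqrt (real N) * sqrt (real N)"
          using M_le by (intro mult_mono) auto
        then have "real (M * M) \<le> real N" by simp
        then show ?thesis by (simp only: of_nat_le_iff)
      qed
      have ln0: "0 \<le> ln (real N)"
        using elim(2) by simp
      have T: "real (T N) \<le> \<delta> * ln (real N)"
        using elim(1) ln0 by simp
      define h where "h = k * T N"
      \<comment> \<open>The odd site costs one factor \<open>x\<close>, which reappears in the
        threshold \<open>19 * K / x\<close>.\<close>
      define l where "l = 2 * h + 1"
      have h: "4 * real h \<le> ln (real N)"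
      proof -
        have "4 * real h \<le> (4 * real k) * (\<delta> * ln (real N))"
          unfolding h_def using mult_left_mono[OF T, of "4 * real k"] by simp
        also have "\<dots> \<le> 1 * ln (real N)"
          using mult_right_mono[OF \<delta>(2) ln0] by (simp add: mult.assoc)
        finally show ?thesis by simp
      qed
      have hw: "real (2 * h) * w \<le> 1 / 8 * ln (real N)"
      proof -
        have "real (2 * h) * w \<le> (2 * real k * w) * (\<delta> * ln (real N))"
          unfolding h_def using mult_left_mono[OF T, of "2 * real k * w"] w by (simp add: mult_ac)
        also have "\<dots> \<le> 1 / 8 * ln (real N)"
          using mult_right_mono[OF \<delta>(3) ln0] by (simp add: mult.assoc)
        finally show ?thesis .
      qed
      \<comment> \<open>The gap between joint windows in neighbouring cells; it is at least half a
        cell.\<close>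
      define g0 where "g0 = M - (b + l + b)"
      have cellR: "2 * real G + 4 * real b + 6 + 8 * real h \<le> real M"
        using elim(3) M_ge h by linarith
      then have "2 * G + 4 * b + 6 + 8 * h \<le> M"
        by linarith
      then have cell: "h + (b + l + b) + h \<le> M" and g0: "1 \<le> g0" "g0 + (b + l + b) \<le> M" "G \<le> g0" "M \<le> 2 * g0"
        unfolding g0_def l_def by linarith+
      have \<eta>: "cst \<beta> * q ^ g0 \<le> 1 / 2" and small: "real g0 * ((2 * c2) * q ^ g0) \<le> 1"
        using G[OF g0(3)] by blast+
      have e: "real M * (20 * (kap \<beta>)\<^sup>2 * (cst \<beta> * q ^ g0)) \<le> 1"
      proof -
        have "real M * (c2 * q ^ g0) \<le> real (2 * g0) * (c2 * q ^ g0)"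
          using g0(4) c2 q by (intro mult_right_mono) auto
        also have "\<dots> = real g0 * ((2 * c2) * q ^ g0)"
          by simp
        finally have "real M * (c2 * q ^ g0) \<le> 1"
          using small by linarith
        moreover have "c2 * q ^ g0 = 20 * (kap \<beta>)\<^sup>2 * (cst \<beta> * q ^ g0)"
          by (simp only: c2_def mult.assoc)
        ultimately show ?thesis
          by simp
      qed
      obtain i j i' j' where words: "i \<in> cfgs d b" "j \<in> cfgs d b" "i' \<in> cfgs d b" "j' \<in> cfgs d b"
        and lb: "x ^ l \<le> K * cmod (tr4 n (Bl {..<b} i j b) (\<lambda>r s. ent (E ^\<^sub>m l) r s - Q r s) (Bl {..<b} i' j' b) Q)"
        using large by blast
      have M0: "0 < M"
        using g0 by simp
      define S where "S = sqrt (real M)"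
      have S: "0 < S" "S * S = real M" "1 \<le> S"
        using M0 by (simp_all add: S_def)
      have "cmod (tr4 n (Bl {..<b} i j b) (\<lambda>r s. ent (E ^\<^sub>m l) r s - Q r s) (Bl {..<b} i' j' b) Q)
          \<le> 18 / sqrt (real M) + 20 * (kap \<beta>)\<^sup>2 * (cst \<beta> * q ^ g0)"
        by (rule connected_correlation_small[OF words b \<beta>0 \<beta>_def MN g0(1,2) \<eta> e circ[of N] prod[of N] _ _ cell overlap])
          (simp_all add: h_def l_def depth)
      \<comment> \<open>The exponentially small error is at most \<open>1 / real M\<close> by
        \<open>e\<close>, hence at most \<open>1 / S\<close>.\<close>
      also have "\<dots> \<le> 18 / S + 1 / S"
      proof (rule add_mono)
        have "S * (20 * (kap \<beta>)\<^sup>2 * (cst \<beta> * q ^ g0)) \<le> real M * (20 * (kap \<beta>)\<^sup>2 * (cst \<beta> * q ^ g0))"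
        proof (rule mult_right_mono)
          show "S \<le> real M"
            using mult_right_mono[OF S(3), of S] S by simp
          show "0 \<le> 20 * (kap \<beta>)\<^sup>2 * (cst \<beta> * q ^ g0)"
            using c2 q unfolding c2_def by (simp add: mult.assoc[symmetric])
        qed
        then show "20 * (kap \<beta>)\<^sup>2 * (cst \<beta> * q ^ g0) \<le> 1 / S"
          using e S(1) by (simp add: pos_le_divide_eq mult.commute)
      qed (simp add: S_def)
      finally have "x ^ l \<le> K * (19 / S)"
        using lb K by (smt (verit, best) add_divide_distrib mult_left_mono)
      moreover have "real N powr (- (1 / 8)) * x \<le> x ^ l"
      proof -
        have "real N powr (- (1 / 8)) \<le> x ^ (2 * h)"
          by (rule power_ge_of_le_ln) (use x hw elim(2) in \<open>auto simp: w_def\<close>)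
        then show ?thesis
          unfolding l_def using x by (simp add: mult_right_mono)
      qed
      ultimately have "real N powr (- (1 / 8)) * x \<le> K * (19 / S)"
        by linarith
      then have "S * real N powr (- (1 / 8)) \<le> 19 * K / x"
        using S(1) x by (simp add: field_simps)
      moreover have "sqrt (sqrt (real N) - 1) * real N powr (- (1 / 8)) \<le> S * real N powr (- (1 / 8))"
        unfolding S_def using M_ge by (intro mult_right_mono real_sqrt_le_mono) auto
      ultimately show False
        using elim(4) by linarith
    qed
  qed
  then obtain N0 where "\<And>N. N0 \<le> N \<Longrightarrow> 1 - cmod (inner d N (mps_state d D A N) (\<psi> N)) > 1 / 2"
    unfolding eventually_sequentially by blast
  then show ?thesis
    by (intro exI[of _ N0]) simp
qed

end
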